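(* Let $k\ge2$ be an integer and let $\Omega_{\varepsilon,k}$, $\varepsilon>0$, be the sets defined in the context. There exists $\varepsilon_0>0$ such that the $\Omega_{\varepsilon,k}$, $0<\varepsilon<\varepsilon_0$, are smooth bounded domains satisfying (P2) and (P3) below, and such that the following holds. Let $f:[0,\infty)\to\mathbb{R}$ be of class $C^1$ with $f(0)>0$, let $C>0$ and let $\varepsilon\in(0,\varepsilon_0)$. Then there exists $\bar\lambda>0$ (depending on $\varepsilon$) such that, for every $0<\lambda<\bar\lambda$, every solution $u_{\lambda,\varepsilon,k}$ of $$\begin{cases}-\Delta u=\lambda f(u)&\text{in }\Omega_{\varepsilon,k}\\ u>0&\text{in }\Omega_{\varepsilon,k}\\ u=0&\text{on }\partial\Omega_{\varepsilon,k}\end{cases}$$ with $\|u_{\lambda,\varepsilon,k}\|_\infty\le C$ is semi-stable and satisfies (P1), where: (P1) There is $c\in\mathbb{R}$ such that the superlevel set $\{u_{\lambda,\varepsilon,k}>c\}$ is non-empty and has at least $k$ connected components; in particular $u_{\lambda,\varepsilon,k}$ has at least $k$ maximum points. (P2) With $S=\{(x,y)\in\mathbb{R}^2:|y|<1\}$, for every compact set $Q\subset\mathbb{R}^2$, $\Omega_{\varepsilon,k}\cap Q\to S\cap Q$ as $\varepsilon\to0$. (P3) For every $\varepsilon\in(0,\varepsilon_0)$ the curvature of $\partial\Omega_{\varepsilon,k}$ changes sign and vanishes at exactly two points; moreover $\min_{\partial\Omega_{\varepsilon,k}}\mathrm{Curv}_{\partial\Omega_{\varepsilon,k}}\to0$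 as $\varepsilon\to0$.
   Context: Definition of $\Omega_{\varepsilon,k}$. Fix real numbers $x_1<x_2<\dots<x_{2k}$, and set $F(z)=-\prod_{i=1}^{2k}(z-x_i)$ for $z\in\mathbb{C}$, $v(x,y)=\mathrm{Re}\,F(x+iy)$, and $$u_\varepsilon(x,y)=\tfrac12-\tfrac12y^2+\varepsilon(y^3-3x^2y)+\varepsilon^{3/2}v(x,y),\qquad (x,y)\in\mathbb{R}^2.$$ Then $\Omega_{\varepsilon,k}$ is the connected component of $\{(x,y)\in\mathbb{R}^2:u_\varepsilon(x,y)>0\}$ that contains the point $(x_1,0)$ (note $u_\varepsilon(x_1,0)=\frac12$). The threshold $\varepsilon_0$ may depend on $k$ and $x_1,\dots,x_{2k}$. Solutions are classical. A solution $u$ of $-\Delta u=\lambda f(u)$ in $\Omega$, $u=0$ on $\partial\Omega$, is semi-stable if the first eigenvalue of the linearized operator $-\Delta-\lambda f'(u)$ in $\Omega$ with zero Dirichlet boundary condition is nonnegative. "Maximum points" are local maximum points. $\mathrm{Curv}_{\partial\Omega}$ is the oriented curvature of the boundary curve, with the sign convention that it is nonnegative when $\Omega$ is convex; on $\partial\Omega_{\varepsilon,k}$, with $u=u_\varepsilon$, it equals $$-\frac{u_{xx}u_y^2-2u_{xy}u_xu_y+u_{yy}u_x^2}{(u_x^2+u_y^2)^{3/2}}.$$ The convergence $\Omega_{\varepsilon,k}\cap Q\to S\cap Q$ as $\varepsilon\to0$ means: for every $\delta\in(0,1)$ one has, for all sufficiently small $\varepsilon$ (depending on $\delta$ and $Q$),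 $\{|y|<1-\delta\}\cap Q\subset\Omega_{\varepsilon,k}\cap Q\subset\{|y|<1+\delta\}\cap Q$. *)

theory Defs
  imports "HOL-Analysis.Analysis"
begin

definition D1 :: "(real \<times> real \<Rightarrow> real) \<Rightarrow> real \<times> real \<Rightarrow> real" where
  "D1 u p = deriv (\<lambda>t. u (t, snd p)) (fst p)"

definition D2 :: "(real \<times> real \<Rightarrow> real) \<Rightarrow> real \<times> real \<Rightarrow> real" where
  "D2 u p = deriv (\<lambda>t. u (fst p, t)) (snd p)"

definition grad :: "(real \<times> real \<Rightarrow> real) \<Rightarrow> real \<times> real \<Rightarrow> real \<times> real" where
  "grad u p = (D1 u p, D2 u p)"

definition Laplacian :: "(real \<times> real \<Rightarrow> real) \<Rightarrow> real \<times> real \<Rightarrow> real" where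
  "Laplacian u p = D1 (D1 u) p + D2 (D2 u) p"

text \<open>Meant for open sets \<open>S\<close>: \<open>Ck_on n u S\<close> is \<open>u \<in> C\<^sup>n(S)\<close>, and values of \<open>u\<close> outside \<open>S\<close> are
  irrelevant.\<close>

fun Ck_on :: "nat \<Rightarrow> (real \<times> real \<Rightarrow> real) \<Rightarrow> (real \<times> real) set \<Rightarrow> bool" where
  "Ck_on 0 u S \<longleftrightarrow> continuous_on S u"
| "Ck_on (Suc n) u S \<longleftrightarrow>
     (\<forall>p\<in>S. u differentiable (at p)) \<and> Ck_on n (D1 u) S \<and> Ck_on n (D2 u) S"

definition smooth_fun_on :: "(real \<times> real \<Rightarrow> real) \<Rightarrow> (real \<times> real) set \<Rightarrow> bool" where
  "smooth_fun_on u S \<longleftrightarrow> (\<forall>n. Ck_on n u S)"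

text \<open>Near each boundary point the domain is the positivity set of a smooth function with nonzero
  gradient; by the implicit function theorem it then lies locally on one side of a smooth curve.\<close>

definition smooth_bounded_domain :: "(real \<times> real) set \<Rightarrow> bool" where
  "smooth_bounded_domain \<Omega> \<longleftrightarrow>
     \<Omega> \<noteq> {} \<and> open \<Omega> \<and> connected \<Omega> \<and> bounded \<Omega> \<and>
     (\<forall>p\<in>frontier \<Omega>. \<exists>U \<rho>. open U \<and> p \<in> U \<and> smooth_fun_on \<rho> U \<and> grad \<rho> p \<noteq> 0 \<and>
        \<Omega> \<inter> U = {q \<in> U. \<rho> q > 0})"

text \<open>The boundary is parametrised near \<open>p\<close> by a regular \<open>C\<^sup>2\<close> curve \<open>\<gamma>\<close> having the domain on its left,
  and \<open>\<kappa> = det (\<gamma>', \<gamma>'') / |\<gamma>'|\<^sup>3\<close>. With this orientation a disc of radius \<open>r\<close> has curvature \<open>1 / r\<close>.\<close>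

definition has_boundary_curvature :: "(real \<times> real) set \<Rightarrow> real \<times> real \<Rightarrow> real \<Rightarrow> bool" where
  "has_boundary_curvature \<Omega> p \<kappa> \<longleftrightarrow>
     (\<exists>(\<gamma> :: real \<Rightarrow> real \<times> real) \<gamma>' \<gamma>'' r.
        r > 0 \<and> \<gamma> 0 = p \<and> \<gamma>' 0 \<noteq> 0 \<and>
        (\<forall>t\<in>{-r<..<r}. \<gamma> t \<in> frontier \<Omega> \<and>
           (\<gamma> has_vector_derivative \<gamma>' t) (at t) \<and> (\<gamma>' has_vector_derivative \<gamma>'' t) (at t)) \<and>
        continuous_on {-r<..<r} \<gamma>'' \<and>
        (\<forall>\<^sub>F s in at_right 0. p + s *\<^sub>R (- snd (\<gamma>' 0), fst (\<gamma>' 0)) \<in> \<Omega>) \<and>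
        \<kappa> = (fst (\<gamma>' 0) * snd (\<gamma>'' 0) - snd (\<gamma>' 0) * fst (\<gamma>'' 0)) / norm (\<gamma>' 0) ^ 3)"

text \<open>Exists and is unique at every boundary point of a smooth bounded domain.\<close>

definition Curv :: "(real \<times> real) set \<Rightarrow> real \<times> real \<Rightarrow> real" where
  "Curv \<Omega> p = (THE \<kappa>. has_boundary_curvature \<Omega> p \<kappa>)"

definition F_poly :: "nat \<Rightarrow> (nat \<Rightarrow> real) \<Rightarrow> complex \<Rightarrow> complex" where
  "F_poly k x z = - (\<Prod>i=1..2*k. z - of_real (x i))"

definition u_eps :: "nat \<Rightarrow> (nat \<Rightarrow> real) \<Rightarrow> real \<Rightarrow> real \<times> real \<Rightarrow> real" where
  "u_eps k x \<epsilon> = (\<lambda>(a, b). 1/2 - 1/2 * b^2 + \<epsilon> * (b^3 - 3 * a^2 * b)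
      + \<epsilon> powr (3/2) * Re (F_poly k x (Complex a b)))"

definition Omega :: "nat \<Rightarrow> (nat \<Rightarrow> real) \<Rightarrow> real \<Rightarrow> (real \<times> real) set" where
  "Omega k x \<epsilon> = connected_component_set {p. u_eps k x \<epsilon> p > 0} (x 1, 0)"

definition classical_solution ::
  "(real \<times> real) set \<Rightarrow> real \<Rightarrow> (real \<Rightarrow> real) \<Rightarrow> (real \<times> real \<Rightarrow> real) \<Rightarrow> bool" where
  "classical_solution \<Omega> lam f u \<longleftrightarrow>
     Ck_on 2 u \<Omega> \<and> continuous_on (closure \<Omega>) u \<and>
     (\<forall>p\<in>\<Omega>. - Laplacian u p = lam * f (u p)) \<and>
     (\<forall>p\<in>\<Omega>. u p > 0) \<and>
     (\<forall>p\<in>frontier \<Omega>. u p = 0)"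

definition test_function :: "(real \<times> real) set \<Rightarrow> (real \<times> real \<Rightarrow> real) \<Rightarrow> bool" where
  "test_function \<Omega> \<psi> \<longleftrightarrow> smooth_fun_on \<psi> UNIV \<and>
     compact (closure {p. \<psi> p \<noteq> 0}) \<and> closure {p. \<psi> p \<noteq> 0} \<subseteq> \<Omega>"

definition square_integrable :: "(real \<times> real \<Rightarrow> 'b::euclidean_space) \<Rightarrow> bool" where
  "square_integrable h \<longleftrightarrow>
     h \<in> borel_measurable lborel \<and> integrable lborel (\<lambda>p. (norm (h p))^2)"

text \<open>\<open>\<phi> \<in> H\<^sup>1\<^sub>0(\<Omega>)\<close> with weak gradient \<open>g\<close>, both extended by zero to the plane; \<open>H\<^sup>1\<^sub>0(\<Omega>)\<close> is the
  closure of the test functions in the \<open>H\<^sup>1\<close> norm.\<close>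

definition H10_with_grad ::
  "(real \<times> real) set \<Rightarrow> (real \<times> real \<Rightarrow> real) \<Rightarrow> (real \<times> real \<Rightarrow> real \<times> real) \<Rightarrow> bool" where
  "H10_with_grad \<Omega> \<phi> g \<longleftrightarrow> square_integrable \<phi> \<and> square_integrable g \<and>
     (\<exists>\<psi> :: nat \<Rightarrow> real \<times> real \<Rightarrow> real. (\<forall>n. test_function \<Omega> (\<psi> n)) \<and>
        (\<lambda>n. LINT p|lborel. (norm (\<psi> n p - \<phi> p))^2) \<longlonglongrightarrow> 0 \<and>
        (\<lambda>n. LINT p|lborel. (norm (grad (\<psi> n) p - g p))^2) \<longlonglongrightarrow> 0)"

text \<open>Eigenvalues of \<open>-\<Delta> - a\<close> with zero Dirichlet condition. The eigenfunctions are weak: for \<open>a\<close> merely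
  continuous, as in \<open>a = \<lambda> f'(u)\<close> with \<open>f\<close> of class \<open>C\<^sup>1\<close>, they need not be of class \<open>C\<^sup>2\<close>.\<close>

definition dirichlet_eigenvalue ::
  "(real \<times> real) set \<Rightarrow> (real \<times> real \<Rightarrow> real) \<Rightarrow> real \<Rightarrow> bool" where
  "dirichlet_eigenvalue \<Omega> a \<mu> \<longleftrightarrow>
     (\<exists>\<phi> g. H10_with_grad \<Omega> \<phi> g \<and> \<not> (AE p in lborel. \<phi> p = 0) \<and>
        (\<forall>\<psi>. test_function \<Omega> \<psi> \<longrightarrow>
           (LINT p:\<Omega>|lborel. g p \<bullet> grad \<psi> p - a p * \<phi> p * \<psi> p)
             = \<mu> * (LINT p:\<Omega>|lborel. \<phi> p * \<psi> p)))"

definition first_dirichlet_eigenvalue ::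
  "(real \<times> real) set \<Rightarrow> (real \<times> real \<Rightarrow> real) \<Rightarrow> real \<Rightarrow> bool" where
  "first_dirichlet_eigenvalue \<Omega> a \<mu> \<longleftrightarrow>
     dirichlet_eigenvalue \<Omega> a \<mu> \<and> (\<forall>\<nu>. dirichlet_eigenvalue \<Omega> a \<nu> \<longrightarrow> \<mu> \<le> \<nu>)"

text \<open>The argument \<open>f'\<close> is the derivative of the nonlinearity.\<close>

definition semi_stable ::
  "(real \<times> real) set \<Rightarrow> real \<Rightarrow> (real \<Rightarrow> real) \<Rightarrow> (real \<times> real \<Rightarrow> real) \<Rightarrow> bool" where
  "semi_stable \<Omega> lam f' u \<longleftrightarrow>
     (\<exists>\<mu>. first_dirichlet_eigenvalue \<Omega> (\<lambda>p. lam * f' (u p)) \<mu> \<and> \<mu> \<ge> 0)"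

definition at_least :: "nat \<Rightarrow> 'a set \<Rightarrow> bool" where
  "at_least k A \<longleftrightarrow> (\<exists>B\<subseteq>A. finite B \<and> card B = k)"

definition local_max_points :: "(real \<times> real) set \<Rightarrow> (real \<times> real \<Rightarrow> real) \<Rightarrow> (real \<times> real) set" where
  "local_max_points \<Omega> u = {p \<in> \<Omega>. \<exists>r>0. \<forall>q\<in>\<Omega> \<inter> ball p r. u q \<le> u p}"

definition P1 :: "nat \<Rightarrow> (real \<times> real) set \<Rightarrow> (real \<times> real \<Rightarrow> real) \<Rightarrow> bool" where
  "P1 k \<Omega> u \<longleftrightarrow>
     (\<exists>c. {p \<in> \<Omega>. u p > c} \<noteq> {} \<and> at_least k (components {p \<in> \<Omega>. u p > c})) \<and>
     at_least k (local_max_points \<Omega> u)"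

definition P2 :: "(real \<Rightarrow> (real \<times> real) set) \<Rightarrow> bool" where
  "P2 \<Omega> \<longleftrightarrow>
     (\<forall>Q. compact Q \<longrightarrow> (\<forall>\<delta>\<in>{0<..<1}. \<forall>\<^sub>F \<epsilon> in at_right 0.
        {(a, b). \<bar>b\<bar> < 1 - \<delta>} \<inter> Q \<subseteq> \<Omega> \<epsilon> \<inter> Q \<and> \<Omega> \<epsilon> \<inter> Q \<subseteq> {(a, b). \<bar>b\<bar> < 1 + \<delta>} \<inter> Q))"

definition P3 :: "(real \<Rightarrow> (real \<times> real) set) \<Rightarrow> real \<Rightarrow> bool" where
  "P3 \<Omega> \<epsilon>\<^sub>0 \<longleftrightarrow>
     (\<forall>\<epsilon>\<in>{0<..<\<epsilon>\<^sub>0}.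
        (\<exists>p\<in>frontier (\<Omega> \<epsilon>). Curv (\<Omega> \<epsilon>) p < 0) \<and>
        (\<exists>p\<in>frontier (\<Omega> \<epsilon>). Curv (\<Omega> \<epsilon>) p > 0) \<and>
        card {p \<in> frontier (\<Omega> \<epsilon>). Curv (\<Omega> \<epsilon>) p = 0} = 2) \<and>
     (\<exists>m. (\<forall>\<epsilon>\<in>{0<..<\<epsilon>\<^sub>0}. m \<epsilon> \<in> Curv (\<Omega> \<epsilon>) ` frontier (\<Omega> \<epsilon>) \<and>
               (\<forall>p\<in>frontier (\<Omega> \<epsilon>). m \<epsilon> \<le> Curv (\<Omega> \<epsilon>) p)) \<and>
          (m \<longlongrightarrow> 0) (at_right 0))"

end

theory Submission
  imports Defs "HOL-Complex_Analysis.Great_Picard"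
begin

text \<open>Write \<open>e = \<epsilon>\<^bsup>3/2\<^esup>\<close>, \<open>n = 2k\<close>, \<open>T = 1 + \<bar>x\<bar>\<close>. Where \<open>e T\<^sup>n\<close> is bounded the lower order terms
of \<open>F\<close> and the cubic term are small compared with \<open>1/2 - y\<^sup>2/2 - e x\<^sup>n\<close>, so \<open>u\<^sub>\<epsilon>\<close> is concave in \<open>y\<close> and
decreases in \<open>\<bar>x\<bar>\<close> far out, and \<open>\<Omega>\<close> is the positivity set of \<open>u\<^sub>\<epsilon>\<close> in a box. The sign of the curvature
is that of \<open>- u\<^sub>x\<^sub>x \<approx> 6 \<epsilon> y + n (n - 1) e x\<^bsup>n-2\<^esup>\<close>: positive on the upper arc and for large \<open>\<bar>x\<bar>\<close>, and on
the lower arc changing sign once on each side, at \<open>\<bar>x\<bar>\<close> of order \<open>\<epsilon>\<^bsup>-1/(2n-4)\<^esup>\<close>.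

Since \<open>-\<Delta>u\<^sub>\<epsilon> = 1\<close>, comparison with multiples of \<open>u\<^sub>\<epsilon>\<close> shows that a bounded solution is
\<open>\<lambda> f(0) u\<^sub>\<epsilon> + O(\<lambda>\<^sup>2)\<close> uniformly. On the axis \<open>u\<^sub>\<epsilon> - 1/2 = e F\<close> is positive on \<open>k\<close> intervals, and
\<open>u\<^sub>\<epsilon> \<le> 1/2\<close> on vertical lines separating them, because the cubic term gains only \<open>O(\<epsilon>\<^sup>2)\<close> there.

For small \<open>\<lambda>\<close> the quadratic form of the linearised operator is nonnegative by Poincare's inequality; that
its first eigenvalue is attained follows from Rellich's theorem.\<close>

section \<open>Partial derivatives and smooth functions\<close>

text \<open>The exponent 3/2 lies strictly between two demands: \<open>e\<close> must be small
  against \<open>\<epsilon>\<close>, so that near the origin the cubic term alone fixes the sign of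
  the curvature, and large against \<open>\<epsilon>\<^sup>2\<close>, so that on a separating line
  \<open>e F\<close> beats the gain of the cubic term. All other smallness is collected in one
  number \<open>s\<close>, chosen in terms of \<open>F\<close> before \<open>\<epsilon>\<close>; the
  box has half-width \<open>\<tau> - 1\<close> with \<open>e \<tau> ^ (2 k) = 4\<close>, which makes
  the function negative on its rim. The delicate claim is that exactly two boundary points have zero
  curvature: the curvature numerator is compared at two of its zeros by the mean value theorem along
  the chord between them. The peaks exceed 1/2 only by a multiple of \<open>e\<close>, and the
  quadratic error in \<lambda> has to stay below \<lambda> times such a multiple; hence the bound on
  \<lambda> depends on \<epsilon>. Semi-stability asks for a least eigenvalue that exists with a
  weak eigenfunction, not merely for a nonnegative form; this is what brings in compactness.\<close>

lemma has_derivative_D1D2: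
  assumes "(u has_derivative L) (at p)"
  shows "D1 u p = L (1, 0)" "D2 u p = L (0, 1)"
    "((\<lambda>t. u (t, snd p)) has_real_derivative L (1, 0)) (at (fst p))"
    "((\<lambda>t. u (fst p, t)) has_real_derivative L (0, 1)) (at (snd p))"
proof -
  interpret L: bounded_linear L
    using assms by (rule has_derivative_bounded_linear)
  have 1: "((\<lambda>t. u (t, snd p)) has_derivative (\<lambda>t. L (t, 0))) (at (fst p))"
  proof (rule has_derivative_compose[where f = "\<lambda>t. (t, snd p)" and g = u])
    show "((\<lambda>t. (t, snd p)) has_derivative (\<lambda>t. (t, 0))) (at (fst p))"
      by (auto intro!: derivative_eq_intros)
  qed (use assms in simp)
  have 2: "((\<lambda>t. u (fst p, t)) has_derivative (\<lambda>t. L (0, t))) (at (snd p))"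
  proof (rule has_derivative_compose[where f = "\<lambda>t. (fst p, t)" and g = u])
    show "((\<lambda>t. (fst p, t)) has_derivative (\<lambda>t. (0, t))) (at (snd p))"
      by (auto intro!: derivative_eq_intros)
  qed (use assms in simp)
  have e: "L (t, 0) = L (1, 0) * t" "L (0, t) = L (0, 1) * t" for t
    using L.scaleR[of t "(1, 0)"] L.scaleR[of t "(0, 1)"] by (simp_all add: mult.commute)
  have f: "(\<lambda>t. L (t, 0)) = (*) (L (1, 0))" "(\<lambda>t. L (0, t)) = (*) (L (0, 1))"
    by (rule ext, rule e)+
  show 3: "((\<lambda>t. u (t, snd p)) has_real_derivative L (1, 0)) (at (fst p))"
    using 1 unfolding has_field_derivative_def f(1) .
  show 4: "((\<lambda>t. u (fst p, t)) has_real_derivative L (0, 1)) (at (snd p))"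
    using 2 unfolding has_field_derivative_def f(2) .
  show "D1 u p = L (1, 0)" "D2 u p = L (0, 1)"
    unfolding D1_def D2_def using 3 4 by (simp_all add: DERIV_imp_deriv)
qed

lemma differentiable_has_derivative:
  assumes "u differentiable (at p)"
  shows "(u has_derivative (\<lambda>h. D1 u p * fst h + D2 u p * snd h)) (at p)"
proof -
  obtain L where L: "(u has_derivative L) (at p)"
    using assms by (auto simp: differentiable_def)
  interpret L: bounded_linear L
    using L by (rule has_derivative_bounded_linear)
  have "L h = D1 u p * fst h + D2 u p * snd h" for h
  proof -
    have "h = fst h *\<^sub>R (1, 0) + snd h *\<^sub>R (0, 1)"
      by (cases h) simp
    then have "L h = fst h *\<^sub>R L (1, 0) + snd h *\<^sub>R L (0, 1)"
      by (metis L.add L.scaleR)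
    then show ?thesis
      by (simp add: has_derivative_D1D2(1,2)[OF L] mult.commute)
  qed
  then show ?thesis
    using L by (metis (no_types, lifting) ext)
qed

lemma D1_D2_cong:
  assumes "open S" "p \<in> S" "\<And>q. q \<in> S \<Longrightarrow> u q = v q"
  shows "D1 u p = D1 v p" "D2 u p = D2 v p"
proof -
  have a: "open ((\<lambda>t. (t, snd p)) -` S)" "open ((\<lambda>t. (fst p, t)) -` S)"
    using assms(1) by (auto intro!: open_vimage continuous_intros)
  have "\<forall>\<^sub>F t in nhds (fst p). u (t, snd p) = v (t, snd p)"
    using a(1) assms(2,3) by (auto simp: eventually_nhds intro!: exI[of _ "(\<lambda>t. (t, snd p)) -` S"])
  then show "D1 u p = D1 v p"
    unfolding D1_def by (rule deriv_cong_ev) simp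
  have "\<forall>\<^sub>F t in nhds (snd p). u (fst p, t) = v (fst p, t)"
    using a(2) assms(2,3) by (auto simp: eventually_nhds intro!: exI[of _ "(\<lambda>t. (fst p, t)) -` S"])
  then show "D2 u p = D2 v p"
    unfolding D2_def by (rule deriv_cong_ev) simp
qed

text \<open>The rules for \<open>D1\<close> and \<open>D2\<close> of a combination hold only at
  points of differentiability, hence only on \<open>S\<close>. Openness makes the partials on
  \<open>S\<close> depend on the values on \<open>S\<close> alone, so such identities can be
  rewritten under \<open>Ck_on\<close>.\<close>

lemma Ck_on_cong:
  assumes "open S" "\<And>q. q \<in> S \<Longrightarrow> u q = v q"
  shows "Ck_on n u S \<longleftrightarrow> Ck_on n v S"
  using assms(2)
proof (induction n arbitrary: u v)
  case 0
  then show ?case using continuous_on_cong[of S S u v] by simp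
next
  case (Suc n)
  have d: "w' differentiable (at p)"
    if "p \<in> S" "w differentiable (at p)" "\<And>q. q \<in> S \<Longrightarrow> w q = w' q" for p w w'
    using has_derivative_transform_within_open[where f = w and g = w' and s = S and t = UNIV] assms(1) that
    unfolding differentiable_def by blast
  have d: "u differentiable (at p) \<longleftrightarrow> v differentiable (at p)" if "p \<in> S" for p
    using d[OF that, of u v] d[OF that, of v u] Suc.prems by fastforce
  have "Ck_on n (D1 u) S \<longleftrightarrow> Ck_on n (D1 v) S" "Ck_on n (D2 u) S \<longleftrightarrow> Ck_on n (D2 v) S"
    by (rule Suc.IH, rule D1_D2_cong[OF assms(1) _ Suc.prems]; assumption)+
  then show ?case
    using d by simp
qed

lemma Ck_on_imp_continuous_on:
  "Ck_on n u S \<Longrightarrow> continuous_on S u"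
proof (cases n)
  case (Suc m)
  assume "Ck_on n u S"
  then have "\<forall>p\<in>S. u differentiable (at p)"
    by (simp add: Suc)
  then show ?thesis
    by (meson continuous_at_imp_continuous_on differentiable_imp_continuous_within)
qed simp

lemma D1_D2_lincomb:
  assumes "u differentiable (at p)" "v differentiable (at p)"
  shows "D1 (\<lambda>q. a * u q + b * v q) p = a * D1 u p + b * D1 v p"
    "D2 (\<lambda>q. a * u q + b * v q) p = a * D2 u p + b * D2 v p"
    "(\<lambda>q. a * u q + b * v q) differentiable (at p)"
proof -
  have "((\<lambda>q. a * u q + b * v q) has_derivative (\<lambda>h. a * (D1 u p * fst h + D2 u p * snd h)
      + b * (D1 v p * fst h + D2 v p * snd h))) (at p)"
    by (intro has_derivative_add has_derivative_mult_right differentiable_has_derivative assms)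
  from has_derivative_D1D2(1,2)[OF this] this
  show "D1 (\<lambda>q. a * u q + b * v q) p = a * D1 u p + b * D1 v p"
    "D2 (\<lambda>q. a * u q + b * v q) p = a * D2 u p + b * D2 v p"
    "(\<lambda>q. a * u q + b * v q) differentiable (at p)"
    by (auto simp: differentiable_def)
qed

lemma Ck_on_lincomb:
  assumes "open S" "Ck_on n u S" "Ck_on n v S"
  shows "Ck_on n (\<lambda>q. a * u q + b * v q) S"
  using assms(2,3)
proof (induction n arbitrary: u v)
  case 0
  then show ?case by (auto intro!: continuous_intros)
next
  case (Suc n)
  have "Ck_on n (D1 (\<lambda>q. a * u q + b * v q)) S \<longleftrightarrow> Ck_on n (\<lambda>q. a * D1 u q + b * D1 v q) S"
    "Ck_on n (D2 (\<lambda>q. a * u q + b * v q)) S \<longleftrightarrow> Ck_on n (\<lambda>q. a * D2 u q + b * D2 v q) S"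
    using Suc.prems by (auto intro!: Ck_on_cong[OF assms(1)] D1_D2_lincomb)
  then show ?case
    using Suc by (auto intro: D1_D2_lincomb)
qed

text \<open>A class of differentiable functions stable under both partials contains every iterated
  partial of its members, so smoothness is proved by naming such a class: the polynomials once, the
  bump functions once.\<close>

lemma smooth_fun_on_closed_class:
  assumes "u \<in> C"
    and "\<And>u p. u \<in> C \<Longrightarrow> u differentiable (at p)"
    and "\<And>u. u \<in> C \<Longrightarrow> D1 u \<in> C" "\<And>u. u \<in> C \<Longrightarrow> D2 u \<in> C"
  shows "smooth_fun_on u S"
proof -
  have "Ck_on n u S" for n
    using assms(1)
  proof (induction n arbitrary: u)
    case 0
    then show ?case
      by (simp add: assms(2) continuous_at_imp_continuous_on differentiable_imp_continuous_within)
  qed (use assms in auto)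
  then show ?thesis
    by (simp add: smooth_fun_on_def)
qed

lemma real_polynomial_function_differentiable:
  fixes u :: "real \<times> real \<Rightarrow> real"
  assumes "real_polynomial_function u"
  shows "u differentiable (at p)"
  using assms by induction (auto intro: bounded_linear_imp_differentiable)

lemma D1_D2_mult:
  assumes "u differentiable (at p)" "v differentiable (at p)"
  shows "D1 (\<lambda>q. u q * v q) p = D1 u p * v p + u p * D1 v p"
    "D2 (\<lambda>q. u q * v q) p = D2 u p * v p + u p * D2 v p"
proof -
  have "((\<lambda>q. u q * v q) has_derivative (\<lambda>h. u p * (D1 v p * fst h + D2 v p * snd h)
      + (D1 u p * fst h + D2 u p * snd h) * v p)) (at p)"
    by (intro has_derivative_mult differentiable_has_derivative assms)
  from has_derivative_D1D2(1,2)[OF this]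
  show "D1 (\<lambda>q. u q * v q) p = D1 u p * v p + u p * D1 v p"
    "D2 (\<lambda>q. u q * v q) p = D2 u p * v p + u p * D2 v p"
    by auto
qed

lemma real_polynomial_function_D1_D2:
  fixes u :: "real \<times> real \<Rightarrow> real"
  assumes "real_polynomial_function u"
  shows "real_polynomial_function (D1 u)" "real_polynomial_function (D2 u)"
proof -
  have "real_polynomial_function (D1 u) \<and> real_polynomial_function (D2 u)"
    using assms
  proof induction
    case (linear f)
    then have "D1 f = (\<lambda>_. f (1, 0))" "D2 f = (\<lambda>_. f (0, 1))"
      using has_derivative_D1D2(1,2)[OF bounded_linear_imp_has_derivative] by blast+
    then show ?case by auto
  next
    case (const c)
    have "D1 (\<lambda>x. c) = (\<lambda>_. 0)" "D2 (\<lambda>x. c) = (\<lambda>_. 0)"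
      by (auto simp: D1_def D2_def)
    then show ?case by auto
  next
    case (add f g)
    have "D1 (\<lambda>x. f x + g x) = (\<lambda>x. D1 f x + D1 g x)" "D2 (\<lambda>x. f x + g x) = (\<lambda>x. D2 f x + D2 g x)"
      using D1_D2_lincomb[of f _ g 1 1] add
      by (auto simp: real_polynomial_function_differentiable)
    then show ?case using add by auto
  next
    case (mult f g)
    have "D1 (\<lambda>x. f x * g x) = (\<lambda>x. D1 f x * g x + f x * D1 g x)"
      "D2 (\<lambda>x. f x * g x) = (\<lambda>x. D2 f x * g x + f x * D2 g x)"
      using D1_D2_mult[of f _ g] mult
      by (auto simp: real_polynomial_function_differentiable)
    then show ?case using mult by auto
  qed
  then show "real_polynomial_function (D1 u)" "real_polynomial_function (D2 u)"
    by auto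
qed

lemma real_polynomial_function_smooth:
  "real_polynomial_function u \<Longrightarrow> smooth_fun_on u S"
  by (rule smooth_fun_on_closed_class[where C = "{u. real_polynomial_function u}"])
    (auto simp: real_polynomial_function_differentiable real_polynomial_function_D1_D2)

section \<open>Test functions\<close>

text \<open>Differentiating \<open>exp (- 1 / t)\<close> produces powers of \<open>1 / t\<close>;
  carrying them as an index makes the family closed under derivatives up to linear combinations, at
  0 as well.\<close>

definition flat_exp :: "nat \<Rightarrow> real \<Rightarrow> real" where
  "flat_exp m t = (if t > 0 then exp (- 1 / t) / t ^ m else 0)"

lemma flat_exp_tendsto_0: "(flat_exp m \<longlongrightarrow> 0) (at 0)"
proof -
  have "((\<lambda>t. inverse t ^ m / exp (inverse t)) \<longlongrightarrow> 0) (at_right (0::real))"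
    by (rule filterlim_compose[OF tendsto_power_div_exp_0 filterlim_inverse_at_top_right])
  then have "(flat_exp m \<longlongrightarrow> 0) (at_right 0)"
    by (rule Lim_transform_eventually)
      (auto simp: flat_exp_def eventually_at_filter field_simps exp_minus)
  moreover have "(flat_exp m \<longlongrightarrow> 0) (at_left 0)"
    by (rule Lim_transform_eventually[of "\<lambda>_. 0"])
      (auto simp: flat_exp_def eventually_at_filter)
  ultimately show ?thesis
    by (simp add: filterlim_split_at)
qed

lemma flat_exp_has_derivative:
  "(flat_exp m has_real_derivative flat_exp (m + 2) t - real m * flat_exp (m + 1) t) (at t)"
proof -
  consider "t > 0" | "t < 0" | "t = 0" by linarith
  then show ?thesis
  proof cases
    case 1
    have e: "\<forall>\<^sub>F s in nhds t. exp (- 1 / s) / s ^ m = flat_exp m s"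
      using 1 by (auto simp: eventually_nhds flat_exp_def intro!: exI[of _ "{0<..}"])
    have "((\<lambda>s. exp (- 1 / s)) has_real_derivative exp (- 1 / t) / t\<^sup>2) (at t)"
      using 1 by (auto intro!: derivative_eq_intros simp: power2_eq_square)
    from DERIV_divide[OF this DERIV_pow[of m t]]
    have "((\<lambda>s. exp (- 1 / s) / s ^ m) has_real_derivative
        flat_exp (m + 2) t - real m * flat_exp (m + 1) t) (at t)"
    proof (rule DERIV_cong)
      show "(exp (- 1 / t) / t\<^sup>2 * t ^ m - exp (- 1 / t) * (real m * t ^ (m - Suc 0))) / (t ^ m * t ^ m)
          = flat_exp (m + 2) t - real m * flat_exp (m + 1) t"
        using 1 by (cases m) (auto simp: flat_exp_def field_simps power2_eq_square)
    qed (use 1 in simp)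
    then show ?thesis
      using e DERIV_cong_ev[OF refl e refl] by simp
  next
    case 2
    have e: "\<forall>\<^sub>F s in nhds t. 0 = flat_exp m s"
      using 2 by (auto simp: eventually_nhds flat_exp_def intro!: exI[of _ "{..<0}"])
    have "((\<lambda>s. 0) has_real_derivative flat_exp (m + 2) t - real m * flat_exp (m + 1) t) (at t)"
      using 2 by (auto simp: flat_exp_def)
    then show ?thesis
      using e DERIV_cong_ev[OF refl e refl] by simp
  next
    case 3
    \<comment> \<open>Away from 0 this difference quotient is \<open>flat_exp (m + 1)\<close>
      itself, whose limit at 0 is already known.\<close>
    have "((\<lambda>h. (flat_exp m (0 + h) - flat_exp m 0) / h) \<longlongrightarrow> 0) (at 0)"
      by (rule Lim_transform_eventually[OF flat_exp_tendsto_0[of "m + 1"]])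
        (auto simp: flat_exp_def eventually_at_filter)
    then show ?thesis
      using 3 by (simp add: DERIV_def flat_exp_def)
  qed
qed

text \<open>By the chain rule the partials of a generator are sums of generators with indices up to
  \<open>m + 2\<close>, so the class is stable under \<open>D1\<close> and
  \<open>D2\<close>.\<close>

inductive_set bump_class :: "(real \<times> real \<Rightarrow> real) \<Rightarrow> (real \<times> real \<Rightarrow> real) set" for q where
  base: "real_polynomial_function P \<Longrightarrow> (\<lambda>p. P p * flat_exp m (q p)) \<in> bump_class q"
| add: "\<lbrakk>u \<in> bump_class q; v \<in> bump_class q\<rbrakk> \<Longrightarrow> (\<lambda>p. u p + v p) \<in> bump_class q"

lemma bump_class_D:
  assumes q: "real_polynomial_function q" and "u \<in> bump_class q"
  shows "(\<forall>p. u differentiable (at p)) \<and> D1 u \<in> bump_class q \<and> D2 u \<in> bump_class q"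
  using assms(2)
proof induction
  case (base P m)
  have dq: "q differentiable (at p)" and dP: "P differentiable (at p)" for p
    using q base by (auto intro: real_polynomial_function_differentiable)
  let ?f' = "\<lambda>t. flat_exp (m + 2) t - real m * flat_exp (m + 1) t"
  have c: "((\<lambda>p. flat_exp m (q p)) has_derivative
      (\<lambda>h. ?f' (q p) * (D1 q p * fst h + D2 q p * snd h))) (at p)" for p
    using has_derivative_compose[OF differentiable_has_derivative[OF dq[of p]]
        flat_exp_has_derivative[of m "q p", unfolded has_field_derivative_def]]
    by (simp add: mult.commute)
  have d: "(\<lambda>p. flat_exp m (q p)) differentiable (at p)" for p
    using c[of p] unfolding differentiable_def by blast
  have g: "D1 (\<lambda>p. flat_exp m (q p)) p = ?f' (q p) * D1 q p"
    "D2 (\<lambda>p. flat_exp m (q p)) p = ?f' (q p) * D2 q p" for p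
    using has_derivative_D1D2(1,2)[OF c[of p]] by auto
  have "D1 (\<lambda>p. P p * flat_exp m (q p)) = (\<lambda>p. D1 P p * flat_exp m (q p) +
      (P p * D1 q p * flat_exp (m + 2) (q p) + (- real m * (P p * D1 q p)) * flat_exp (m + 1) (q p)))"
    "D2 (\<lambda>p. P p * flat_exp m (q p)) = (\<lambda>p. D2 P p * flat_exp m (q p) +
      (P p * D2 q p * flat_exp (m + 2) (q p) + (- real m * (P p * D2 q p)) * flat_exp (m + 1) (q p)))"
    by (auto simp: fun_eq_iff D1_D2_mult[OF dP d] g algebra_simps)
  moreover have "(\<lambda>p. D1 P p * flat_exp m (q p) +
      (P p * D1 q p * flat_exp (m + 2) (q p) + (- real m * (P p * D1 q p)) * flat_exp (m + 1) (q p))) \<in> bump_class q"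
    "(\<lambda>p. D2 P p * flat_exp m (q p) +
      (P p * D2 q p * flat_exp (m + 2) (q p) + (- real m * (P p * D2 q p)) * flat_exp (m + 1) (q p))) \<in> bump_class q"
    using base q by (intro bump_class.intros real_polynomial_function.intros(3,4,2) real_polynomial_function_D1_D2; simp)+
  ultimately show ?case
    using dP d by simp
next
  case (add u v)
  have "D1 (\<lambda>x. u x + v x) = (\<lambda>x. D1 u x + D1 v x)" "D2 (\<lambda>x. u x + v x) = (\<lambda>x. D2 u x + D2 v x)"
    using D1_D2_lincomb[of u _ v 1 1] add by auto
  then show ?case
    using add by (auto intro: bump_class.add)
qed

lemma bump_class_smooth:
  "real_polynomial_function q \<Longrightarrow> u \<in> bump_class q \<Longrightarrow> smooth_fun_on u S"
  by (rule smooth_fun_on_closed_class[where C = "bump_class q"]) (auto simp: bump_class_D)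

lemma ex_test_function:
  assumes "open \<Omega>" "p0 \<in> \<Omega>"
  obtains \<psi> where "test_function \<Omega> \<psi>" "\<psi> p0 > 0"
proof -
  obtain r where r: "r > 0" "cball p0 r \<subseteq> \<Omega>"
    using assms open_contains_cball by blast
  define q :: "real \<times> real \<Rightarrow> real"
    where "q = (\<lambda>p. r\<^sup>2 - ((fst p - fst p0)\<^sup>2 + (snd p - snd p0)\<^sup>2))"
  \<comment> \<open>\<open>q\<close> is positive exactly in the open disc of radius
    \<open>r\<close>, so the bump lives there. The factor 1 is the polynomial that
    \<open>bump_class.base\<close> expects.\<close>
  define \<psi> :: "real \<times> real \<Rightarrow> real" where "\<psi> = (\<lambda>p. 1 * flat_exp 0 (q p))"
  have "real_polynomial_function q"
    unfolding q_def
    by (intro real_polynomial_function_diff real_polynomial_function_power real_polynomial_function.intros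
        bounded_linear_fst bounded_linear_snd)
  then have s: "smooth_fun_on \<psi> UNIV"
    unfolding \<psi>_def by (rule bump_class_smooth[OF _ bump_class.base]) auto
  have "q p = r\<^sup>2 - (dist p0 p)\<^sup>2" for p
    unfolding q_def dist_prod_def by (simp add: dist_real_def power2_commute)
  then have "{p. \<psi> p \<noteq> 0} \<subseteq> cball p0 r"
    using r(1) by (auto simp: \<psi>_def flat_exp_def power_less_imp_less_base less_imp_le split: if_splits)
  then have sub: "closure {p. \<psi> p \<noteq> 0} \<subseteq> cball p0 r"
    by (simp add: closure_minimal)
  then have "compact (closure {p. \<psi> p \<noteq> 0})"
    by (meson bounded_cball bounded_subset closed_closure compact_eq_bounded_closed)
  then have "test_function \<Omega> \<psi>"
    using s sub r(2) by (auto simp: test_function_def)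
  moreover have "\<psi> p0 > 0"
    using r(1) by (simp add: \<psi>_def q_def flat_exp_def)
  ultimately show thesis
    by (rule that)
qed

lemma test_function_lincomb:
  assumes "test_function \<Omega> \<phi>" "test_function \<Omega> \<psi>"
  shows "test_function \<Omega> (\<lambda>p. a * \<phi> p + b * \<psi> p)"
proof -
  have sub: "closure {p. a * \<phi> p + b * \<psi> p \<noteq> 0} \<subseteq> closure {p. \<phi> p \<noteq> 0} \<union> closure {p. \<psi> p \<noteq> 0}"
    unfolding closure_Un[symmetric] by (rule closure_mono) auto
  moreover have "compact (closure {p. \<phi> p \<noteq> 0} \<union> closure {p. \<psi> p \<noteq> 0})"
    using assms by (auto simp: test_function_def)
  ultimately have "compact (closure {p. a * \<phi> p + b * \<psi> p \<noteq> 0})"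
    by (meson closed_closure compact_eq_bounded_closed bounded_subset)
  then show ?thesis
    using assms sub by (auto simp: test_function_def smooth_fun_on_def intro: Ck_on_lincomb)
qed

lemma test_functionD:
  assumes "test_function \<Omega> \<psi>"
  shows "\<psi> differentiable (at p)" "continuous_on UNIV \<psi>" "continuous_on UNIV (D1 \<psi>)"
    "continuous_on UNIV (D2 \<psi>)" "p \<notin> \<Omega> \<Longrightarrow> \<psi> p = 0"
    "p \<notin> \<Omega> \<Longrightarrow> D1 \<psi> p = 0" "p \<notin> \<Omega> \<Longrightarrow> D2 \<psi> p = 0"
proof -
  have "Ck_on (Suc 0) \<psi> UNIV"
    using assms unfolding test_function_def smooth_fun_on_def by blast
  then show "\<psi> differentiable (at p)" "continuous_on UNIV \<psi>" "continuous_on UNIV (D1 \<psi>)"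
    "continuous_on UNIV (D2 \<psi>)"
    using Ck_on_imp_continuous_on[of "Suc 0" \<psi> UNIV] by (cases p; simp)+
  define K where "K = closure {p. \<psi> p \<noteq> 0}"
  have K: "open (- K)" "p \<notin> \<Omega> \<Longrightarrow> p \<in> - K"
    using assms by (auto simp: test_function_def K_def)
  have z: "\<psi> q = 0" if "q \<in> - K" for q
    using that closure_subset[of "{p. \<psi> p \<noteq> 0}"] by (auto simp: K_def)
  assume "p \<notin> \<Omega>"
  then have p: "p \<in> - K" by (rule K)
  show "\<psi> p = 0" using z p .
  show "D1 \<psi> p = 0" "D2 \<psi> p = 0"
    using D1_D2_cong[OF K(1) p z] by (simp_all add: D1_def D2_def)
qed

section \<open>A Poincare inequality on cells\<close>

text \<open>Cauchy-Schwarz against the constant 1, obtained by expanding the nonnegative integral of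
  \<open>(g s - c)\<^sup>2\<close> with \<open>c\<close> the mean of \<open>g\<close>.\<close>

lemma integral_square_le:
  fixes g :: "real \<Rightarrow> real"
  assumes "a \<le> b" "continuous_on {a..b} g"
  shows "(integral {a..b} g)\<^sup>2 \<le> (b - a) * integral {a..b} (\<lambda>s. (g s)\<^sup>2)"
proof (cases "a = b")
  case False
  then have l: "b - a > 0" using assms(1) by simp
  define I where "I = integral {a..b} g"
  define c where "c = I / (b - a)"
  have i: "g integrable_on {a..b}" "(\<lambda>s. (g s)\<^sup>2) integrable_on {a..b}"
    using assms(2) by (auto intro!: integrable_continuous_interval continuous_intros)
  have "0 \<le> integral {a..b} (\<lambda>s. (g s - c)\<^sup>2)"
    by (rule integral_nonneg) (use assms(2) in \<open>auto intro!: integrable_continuous_interval continuous_intros\<close>)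
  also have "(\<lambda>s. (g s - c)\<^sup>2) = (\<lambda>s. ((g s)\<^sup>2 - (2 * c) * g s) + c\<^sup>2)"
    by (auto simp: power2_eq_square algebra_simps)
  also have "integral {a..b} (\<lambda>s. ((g s)\<^sup>2 - (2 * c) * g s) + c\<^sup>2)
      = (integral {a..b} (\<lambda>s. (g s)\<^sup>2) - (2 * c) * I) + (b - a) * c\<^sup>2"
  proof (rule integral_unique)
    have "((\<lambda>s. (g s)\<^sup>2) has_integral integral {a..b} (\<lambda>s. (g s)\<^sup>2)) {a..b}" "(g has_integral I) {a..b}"
      using i by (auto simp: I_def)
    then show "((\<lambda>s. ((g s)\<^sup>2 - (2 * c) * g s) + c\<^sup>2) has_integral
        (integral {a..b} (\<lambda>s. (g s)\<^sup>2) - (2 * c) * I) + (b - a) * c\<^sup>2) {a..b}"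
      using assms(1) has_integral_const_real[of "c\<^sup>2" a b]
      by (intro has_integral_add has_integral_diff has_integral_mult_right) auto
  qed
  also have "\<dots> = integral {a..b} (\<lambda>s. (g s)\<^sup>2) - I\<^sup>2 / (b - a)"
  proof -
    have "(b - a) * c = I" "I\<^sup>2 / (b - a) = I * c"
      using l by (auto simp: c_def power2_eq_square)
    then have "(b - a) * c\<^sup>2 = I * c"
      by (metis mult.assoc power2_eq_square)
    then show ?thesis
      using \<open>I\<^sup>2 / (b - a) = I * c\<close> by (simp add: algebra_simps)
  qed
  finally show ?thesis
    using l by (simp add: I_def field_simps)
qed simp

lemma diff_square_le:
  fixes f f' :: "real \<Rightarrow> real"
  assumes "\<And>t. t \<in> {a..b} \<Longrightarrow> (f has_real_derivative f' t) (at t)" "continuous_on {a..b} f'"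
    and "x \<in> {a..b}" "y \<in> {a..b}"
  shows "(f x - f y)\<^sup>2 \<le> (b - a) * integral {a..b} (\<lambda>s. (f' s)\<^sup>2)"
  using assms(3,4)
proof (induction x y rule: linorder_wlog)
  case (le x y)
  have sub: "{x..y} \<subseteq> {a..b}" using le by auto
  have c: "continuous_on {x..y} f'" using assms(2) sub continuous_on_subset by blast
  have "(f' has_integral (f y - f x)) {x..y}"
    using le sub assms(1)
    by (intro fundamental_theorem_of_calculus)
      (auto simp: has_real_derivative_iff_has_vector_derivative[symmetric] intro: has_field_derivative_at_within)
  then have "(f x - f y)\<^sup>2 = (integral {x..y} f')\<^sup>2"
    by (simp add: integral_unique power2_commute)
  also have "\<dots> \<le> (y - x) * integral {x..y} (\<lambda>s. (f' s)\<^sup>2)"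
    using le c by (intro integral_square_le)
  also have "\<dots> \<le> (b - a) * integral {a..b} (\<lambda>s. (f' s)\<^sup>2)"
  proof (rule mult_mono)
    show "integral {x..y} (\<lambda>s. (f' s)\<^sup>2) \<le> integral {a..b} (\<lambda>s. (f' s)\<^sup>2)"
      using sub c assms(2)
      by (intro integral_subset_le) (auto intro!: integrable_continuous_interval continuous_intros)
    show "0 \<le> integral {x..y} (\<lambda>s. (f' s)\<^sup>2)"
      by (rule integral_nonneg) (use c in \<open>auto intro!: integrable_continuous_interval continuous_intros\<close>)
  qed (use le in auto)
  finally show ?case .
next
  case (sym x y)
  then show ?case by (simp add: power2_commute)
qed

text \<open>On a short cell \<open>f\<close> differs from its mean by at most the square root of
  \<open>h\<close> times its energy. The shape matters for compactness: one number per cell plus a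
  multiple of the energy that vanishes with the mesh.\<close>

lemma cell_inequality:
  fixes f f' :: "real \<Rightarrow> real"
  assumes h: "h > 0" "\<And>t. t \<in> {a..a + h} \<Longrightarrow> (f has_real_derivative f' t) (at t)"
    "continuous_on {a..a + h} f'"
  shows "integral {a..a + h} (\<lambda>s. (f s)\<^sup>2)
    \<le> 2 / h * (integral {a..a + h} f)\<^sup>2 + 2 * h\<^sup>2 * integral {a..a + h} (\<lambda>s. (f' s)\<^sup>2)"
proof -
  define I where "I = integral {a..a + h} f"
  define V where "V = integral {a..a + h} (\<lambda>s. (f' s)\<^sup>2)"
  have cf: "continuous_on {a..a + h} f"
    using h(2) by (meson DERIV_isCont continuous_at_imp_continuous_on)
  then have i: "f integrable_on {a..a + h}" "(\<lambda>s. (f s)\<^sup>2) integrable_on {a..a + h}"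
    by (auto intro!: integrable_continuous_interval continuous_intros)
  \<comment> \<open>A continuous function attains its mean, which lies between its minimum and its
    maximum.\<close>
  have "\<exists>\<xi>\<in>{a..a + h}. h * f \<xi> = I"
  proof -
    obtain l where l: "l \<in> {a..a + h}" "\<forall>y\<in>{a..a + h}. f l \<le> f y"
      using continuous_attains_inf[OF _ _ cf] h(1) by auto
    obtain u where u: "u \<in> {a..a + h}" "\<forall>y\<in>{a..a + h}. f y \<le> f u"
      using continuous_attains_sup[OF _ _ cf] h(1) by auto
    have "integral {a..a + h} (\<lambda>_. f l) \<le> I" "I \<le> integral {a..a + h} (\<lambda>_. f u)"
      unfolding I_def using i(1) l u by (auto intro!: integral_le simp del: integral_const_real)
    then have "f l \<le> I / h" "I / h \<le> f u"
      using h(1) by (auto simp: field_simps)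
    moreover have "connected (f ` {a..a + h})"
      using cf connected_continuous_image connected_Icc by blast
    ultimately have "I / h \<in> f ` {a..a + h}"
      using l(1) u(1) by (meson connected_contains_Icc atLeastAtMost_iff image_eqI subsetD)
    then show ?thesis
      using h(1) by (auto simp: field_simps image_iff)
  qed
  then obtain \<xi> where \<xi>: "\<xi> \<in> {a..a + h}" "h * f \<xi> = I" by blast
  have f\<xi>: "f \<xi> = I / h" using \<xi>(2) h(1) by (simp add: field_simps)
  have "(f s)\<^sup>2 \<le> 2 * (I / h)\<^sup>2 + 2 * (h * V)" if "s \<in> {a..a + h}" for s
  proof -
    have "(f s - f \<xi>)\<^sup>2 \<le> h * V"
      using diff_square_le[OF h(2,3) that \<xi>(1)] by (simp add: V_def)
    moreover have "(f s)\<^sup>2 \<le> 2 * (f \<xi>)\<^sup>2 + 2 * (f s - f \<xi>)\<^sup>2"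
      using zero_le_power2[of "f s - 2 * f \<xi>"] by (simp add: power2_eq_square algebra_simps)
    ultimately show ?thesis by (simp add: f\<xi>)
  qed
  then have "integral {a..a + h} (\<lambda>s. (f s)\<^sup>2) \<le> integral {a..a + h} (\<lambda>_. 2 * (I / h)\<^sup>2 + 2 * (h * V))"
    using i by (intro integral_le) (auto simp del: integral_const_real)
  also have "\<dots> = 2 / h * I\<^sup>2 + 2 * h\<^sup>2 * V"
    using h(1) by (simp add: field_simps power2_eq_square)
  finally show ?thesis
    by (simp add: I_def V_def)
qed

lemma integral_cells:
  fixes g :: "real \<Rightarrow> real"
  assumes "h \<ge> 0" "continuous_on UNIV g"
  shows "integral {a..a + real N * h} g = (\<Sum>i<N. integral {a + real i * h..a + real i * h + h} g)"
proof (induction N)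
  case (Suc N)
  have "integral {a..a + real N * h} g + integral {a + real N * h..a + real (Suc N) * h} g
      = integral {a..a + real (Suc N) * h} g"
    using assms by (intro Henstock_Kurzweil_Integration.integral_combine)
      (auto intro!: integrable_continuous_interval continuous_on_subset[OF assms(2)] simp: algebra_simps)
  then show ?case
    using Suc by (simp add: algebra_simps)
qed simp

lemma cells_inequality:
  fixes f f' :: "real \<Rightarrow> real"
  assumes h: "h > 0" "\<And>t. (f has_real_derivative f' t) (at t)" "continuous_on UNIV f'"
  shows "integral {a..a + real N * h} (\<lambda>s. (f s)\<^sup>2)
    \<le> (\<Sum>i<N. 2 / h * (integral {a + real i * h..a + real i * h + h} f)\<^sup>2)
      + 2 * h\<^sup>2 * integral {a..a + real N * h} (\<lambda>s. (f' s)\<^sup>2)"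
proof -
  have cf: "continuous_on UNIV f"
    using h(2) by (meson DERIV_isCont continuous_at_imp_continuous_on)
  have "integral {a..a + real N * h} (\<lambda>s. (f s)\<^sup>2)
      = (\<Sum>i<N. integral {a + real i * h..a + real i * h + h} (\<lambda>s. (f s)\<^sup>2))"
    using h(1) cf by (intro integral_cells) (auto intro!: continuous_intros)
  also have "\<dots> \<le> (\<Sum>i<N. 2 / h * (integral {a + real i * h..a + real i * h + h} f)\<^sup>2
      + 2 * h\<^sup>2 * integral {a + real i * h..a + real i * h + h} (\<lambda>s. (f' s)\<^sup>2))"
    using h by (intro sum_mono cell_inequality) (auto intro: continuous_on_subset)
  also have "\<dots> = (\<Sum>i<N. 2 / h * (integral {a + real i * h..a + real i * h + h} f)\<^sup>2)
      + 2 * h\<^sup>2 * (\<Sum>i<N. integral {a + real i * h..a + real i * h + h} (\<lambda>s. (f' s)\<^sup>2))"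
    by (simp add: sum.distrib sum_distrib_left)
  also have "(\<Sum>i<N. integral {a + real i * h..a + real i * h + h} (\<lambda>s. (f' s)\<^sup>2))
      = integral {a..a + real N * h} (\<lambda>s. (f' s)\<^sup>2)"
    using h(1,3) by (intro integral_cells[symmetric]) (auto intro!: continuous_intros)
  finally show ?thesis .
qed

text \<open>Gauge integrals in one variable at a time give direct access to the fundamental theorem
  of calculus and to differentiation under the integral sign; the passage to Lebesgue measure in the
  plane is made once, in \<open>lborel_integral_eq_iterated\<close>.\<close>

definition iterated_integral :: "real \<Rightarrow> real \<Rightarrow> real \<Rightarrow> real \<Rightarrow> (real \<times> real \<Rightarrow> real) \<Rightarrow> real" where
  "iterated_integral a b c d F = integral {a..b} (\<lambda>s. integral {c..d} (\<lambda>t. F (s, t)))"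

lemma continuous_on_slice:
  assumes "continuous_on UNIV (F :: real \<times> real \<Rightarrow> real)"
  shows "continuous_on A (\<lambda>t. F (s, t))" "continuous_on A (\<lambda>s. F (s, t))"
  by (rule continuous_on_compose2[OF assms]; auto intro!: continuous_intros)+

lemma continuous_on_inner_integral:
  assumes "continuous_on UNIV (F :: real \<times> real \<Rightarrow> real)"
  shows "continuous_on A (\<lambda>s. integral {c..d} (\<lambda>t. F (s, t)))"
proof -
  have "continuous_on A (\<lambda>s. integral (cbox c d) (\<lambda>t. F (s, t)))"
    by (rule integral_continuous_on_param) (use assms in \<open>auto intro: continuous_on_subset\<close>)
  then show ?thesis by simp
qed

lemma slice_integrable:
  assumes "continuous_on UNIV (F :: real \<times> real \<Rightarrow> real)"
  shows "(\<lambda>t. F (s, t)) integrable_on {c..d}"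
    "(\<lambda>s. integral {c..d} (\<lambda>t. F (s, t))) integrable_on {a..b}"
  using assms by (auto intro!: integrable_continuous_interval continuous_on_slice continuous_on_inner_integral)

lemma iterated_integral_nonneg:
  assumes "continuous_on UNIV F" "\<And>p. 0 \<le> F p"
  shows "0 \<le> iterated_integral a b c d F"
  unfolding iterated_integral_def
  by (intro integral_nonneg slice_integrable assms)

lemma iterated_integral_subset:
  assumes "continuous_on UNIV F" "\<And>p. 0 \<le> F p" "{a'..b'} \<subseteq> {a..b}" "{c'..d'} \<subseteq> {c..d}"
  shows "iterated_integral a' b' c' d' F \<le> iterated_integral a b c d F"
proof -
  have "iterated_integral a' b' c' d' F \<le> iterated_integral a' b' c d F"
    unfolding iterated_integral_def
    by (intro integral_le slice_integrable assms integral_subset_le) (use assms in auto)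
  also have "\<dots> \<le> iterated_integral a b c d F"
    unfolding iterated_integral_def
    by (intro integral_subset_le slice_integrable assms ballI integral_nonneg)
  finally show ?thesis .
qed

lemma iterated_integral_diff:
  assumes "continuous_on UNIV F" "continuous_on UNIV G"
  shows "iterated_integral a b c d (\<lambda>p. F p - G p)
    = iterated_integral a b c d F - iterated_integral a b c d G"
  unfolding iterated_integral_def
  by (simp add: Henstock_Kurzweil_Integration.integral_diff slice_integrable assms)

lemma iterated_integral_square_le:
  assumes "a \<le> b" "c \<le> d" "continuous_on UNIV F"
  shows "(iterated_integral a b c d F)\<^sup>2 \<le> (b - a) * (d - c) * iterated_integral a b c d (\<lambda>p. (F p)\<^sup>2)"
proof -
  have F2: "continuous_on UNIV (\<lambda>p. (F p)\<^sup>2)"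
    using assms(3) by (intro continuous_intros)
  have "(iterated_integral a b c d F)\<^sup>2
      \<le> (b - a) * integral {a..b} (\<lambda>s. (integral {c..d} (\<lambda>t. F (s, t)))\<^sup>2)"
    unfolding iterated_integral_def
    by (rule integral_square_le[OF assms(1) continuous_on_inner_integral[OF assms(3)]])
  also have "\<dots> \<le> (b - a) * integral {a..b} (\<lambda>s. (d - c) * integral {c..d} (\<lambda>t. (F (s, t))\<^sup>2))"
    by (intro mult_left_mono integral_le integral_square_le integrable_continuous_interval
        continuous_intros continuous_on_inner_integral continuous_on_slice assms F2)
      (use assms F2 in \<open>auto intro: continuous_on_inner_integral\<close>)
  also have "\<dots> = (b - a) * (d - c) * iterated_integral a b c d (\<lambda>p. (F p)\<^sup>2)"
    by (simp add: iterated_integral_def)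
  finally show ?thesis .
qed

text \<open>The one-dimensional inequality is applied twice: in \<open>t\<close> on every vertical
  line, and then in \<open>s\<close> to the integrals \<open>m j\<close> over horizontal strips,
  whose cell integrals are the planar ones.\<close>

lemma planar_cells_inequality:
  fixes \<psi> :: "real \<times> real \<Rightarrow> real"
  assumes d: "\<And>p. \<psi> differentiable (at p)" and c1: "continuous_on UNIV (D1 \<psi>)"
    and c2: "continuous_on UNIV (D2 \<psi>)" and h: "h > 0"
  shows "iterated_integral a (a + real N * h) c (c + real N * h) (\<lambda>p. (\<psi> p)\<^sup>2)
    \<le> 4 / h\<^sup>2 * (\<Sum>j<N. \<Sum>i<N. (iterated_integral (a + real i * h) (a + real i * h + h)
          (c + real j * h) (c + real j * h + h) \<psi>)\<^sup>2)
      + 4 * h\<^sup>2 * iterated_integral a (a + real N * h) c (c + real N * h) (\<lambda>p. (D1 \<psi> p)\<^sup>2)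
      + 2 * h\<^sup>2 * iterated_integral a (a + real N * h) c (c + real N * h) (\<lambda>p. (D2 \<psi> p)\<^sup>2)"
proof -
  have cc: "continuous_on UNIV \<psi>"
    using d by (meson continuous_at_imp_continuous_on differentiable_imp_continuous_within)
  have sq: "continuous_on UNIV (\<lambda>p. (D1 \<psi> p)\<^sup>2)" "continuous_on UNIV (\<lambda>p. (D2 \<psi> p)\<^sup>2)"
    "continuous_on UNIV (\<lambda>p. (\<psi> p)\<^sup>2)"
    using c1 c2 cc by (auto intro!: continuous_intros)
  define I where "I = {a..a + real N * h}"
  define J where "J j = {c + real j * h..c + real j * h + h}" for j :: nat
  define m where "m j s = integral (J j) (\<lambda>t. \<psi> (s, t))" for j s
  define m' where "m' j s = integral (J j) (\<lambda>t. D1 \<psi> (s, t))" for j s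
  have pd: "((\<lambda>t. \<psi> (s, t)) has_real_derivative D2 \<psi> (s, t)) (at t)"
    "((\<lambda>s. \<psi> (s, t)) has_real_derivative D1 \<psi> (s, t)) (at s)" for s t
    using has_derivative_D1D2(3,4)[OF differentiable_has_derivative[OF d[of "(s, t)"]]] by auto
  have m': "(m j has_real_derivative m' j s) (at s)" for j s
    unfolding m_def m'_def J_def
    by (rule leibniz_rule_field_derivative[of UNIV "c + real j * h" "c + real j * h + h",
          unfolded cbox_interval])
      (use pd c1 cc in \<open>auto intro: slice_integrable continuous_on_subset\<close>)
  have cm: "continuous_on A (m j)" "continuous_on A (m' j)" for A j
    unfolding m_def m'_def J_def using c1 cc by (auto intro: continuous_on_inner_integral)
  have int1: "(\<lambda>s. (m j s)\<^sup>2) integrable_on I" "(\<lambda>s. (m' j s)\<^sup>2) integrable_on I" for j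
    unfolding I_def by (auto intro!: integrable_continuous_interval continuous_intros cm)
  have "iterated_integral a (a + real N * h) c (c + real N * h) (\<lambda>p. (\<psi> p)\<^sup>2)
     \<le> integral I (\<lambda>s. (\<Sum>j<N. 2 / h * (m j s)\<^sup>2)
        + 2 * h\<^sup>2 * integral {c..c + real N * h} (\<lambda>t. (D2 \<psi> (s, t))\<^sup>2))"
    unfolding iterated_integral_def I_def m_def J_def
  proof (rule integral_le)
    show "integral {c..c + real N * h} (\<lambda>t. (\<psi> (s, t))\<^sup>2)
        \<le> (\<Sum>j<N. 2 / h * (integral {c + real j * h..c + real j * h + h} (\<lambda>t. \<psi> (s, t)))\<^sup>2)
        + 2 * h\<^sup>2 * integral {c..c + real N * h} (\<lambda>t. (D2 \<psi> (s, t))\<^sup>2)" for s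
      by (rule cells_inequality[OF h]) (use pd c2 in \<open>auto intro: continuous_on_slice\<close>)
  qed (use h sq cc in \<open>auto intro!: integrable_continuous_interval continuous_intros
      continuous_on_inner_integral\<close>)
  also have "\<dots> = (\<Sum>j<N. 2 / h * integral I (\<lambda>s. (m j s)\<^sup>2))
      + 2 * h\<^sup>2 * iterated_integral a (a + real N * h) c (c + real N * h) (\<lambda>p. (D2 \<psi> p)\<^sup>2)"
    unfolding iterated_integral_def I_def[symmetric]
  proof (rule integral_unique, intro has_integral_add)
    show "((\<lambda>s. \<Sum>j<N. 2 / h * (m j s)\<^sup>2) has_integral (\<Sum>j<N. 2 / h * integral I (\<lambda>s. (m j s)\<^sup>2))) I"
      using int1 by (intro has_integral_sum has_integral_mult_right integrable_integral) auto
    show "((\<lambda>s. 2 * h\<^sup>2 * integral {c..c + real N * h} (\<lambda>t. (D2 \<psi> (s, t))\<^sup>2)) has_integral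
        2 * h\<^sup>2 * integral I (\<lambda>s. integral {c..c + real N * h} (\<lambda>t. (D2 \<psi> (s, t))\<^sup>2))) I"
      unfolding I_def by (intro has_integral_mult_right integrable_integral slice_integrable sq)
  qed
  also have "(\<Sum>j<N. 2 / h * integral I (\<lambda>s. (m j s)\<^sup>2))
      \<le> (\<Sum>j<N. 2 / h * ((\<Sum>i<N. 2 / h * (iterated_integral (a + real i * h) (a + real i * h + h)
          (c + real j * h) (c + real j * h + h) \<psi>)\<^sup>2)
        + 2 * h\<^sup>2 * integral I (\<lambda>s. h * integral (J j) (\<lambda>t. (D1 \<psi> (s, t))\<^sup>2))))"
  proof (intro sum_mono mult_left_mono)
    fix j
    have "integral I (\<lambda>s. (m j s)\<^sup>2) \<le> (\<Sum>i<N. 2 / h * (iterated_integral (a + real i * h) (a + real i * h + h)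
          (c + real j * h) (c + real j * h + h) \<psi>)\<^sup>2) + 2 * h\<^sup>2 * integral I (\<lambda>s. (m' j s)\<^sup>2)"
      using cells_inequality[OF h m' cm(2)]
      unfolding I_def iterated_integral_def J_def m_def by blast
    \<comment> \<open>Cauchy-Schwarz across a strip of height \<open>h\<close> turns the derivative
      of the strip integral back into the planar energy of \<open>D1\<close>.\<close>
    also have "integral I (\<lambda>s. (m' j s)\<^sup>2) \<le> integral I (\<lambda>s. h * integral (J j) (\<lambda>t. (D1 \<psi> (s, t))\<^sup>2))"
    proof (rule integral_le)
      show "(m' j s)\<^sup>2 \<le> h * integral (J j) (\<lambda>t. (D1 \<psi> (s, t))\<^sup>2)" for s
        using integral_square_le[of "c + real j * h" "c + real j * h + h" "\<lambda>t. D1 \<psi> (s, t)"] h c1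
        by (auto simp: m'_def J_def intro: continuous_on_slice)
    qed (use int1 sq in \<open>auto intro!: integrable_on_mult_right slice_integrable simp: I_def J_def\<close>)
    finally show "integral I (\<lambda>s. (m j s)\<^sup>2) \<le> (\<Sum>i<N. 2 / h * (iterated_integral (a + real i * h) (a + real i * h + h)
          (c + real j * h) (c + real j * h + h) \<psi>)\<^sup>2)
        + 2 * h\<^sup>2 * integral I (\<lambda>s. h * integral (J j) (\<lambda>t. (D1 \<psi> (s, t))\<^sup>2))"
      by (simp add: mult_left_mono)
  qed (use h in auto)
  also have "\<dots> = 4 / h\<^sup>2 * (\<Sum>j<N. \<Sum>i<N. (iterated_integral (a + real i * h) (a + real i * h + h)
          (c + real j * h) (c + real j * h + h) \<psi>)\<^sup>2)
      + 4 * h\<^sup>2 * (\<Sum>j<N. integral I (\<lambda>s. integral (J j) (\<lambda>t. (D1 \<psi> (s, t))\<^sup>2)))"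
  proof -
    have aux: "2 / h * ((\<Sum>i<N. 2 / h * q i) + 2 * h\<^sup>2 * (h * W)) = 4 / h\<^sup>2 * (\<Sum>i<N. q i) + 4 * h\<^sup>2 * W"
      for q W
    proof -
      have "2 / h * ((2 / h * S) + 2 * h\<^sup>2 * (h * W)) = 4 / h\<^sup>2 * S + 4 * h\<^sup>2 * W" for S
        using h by (simp add: field_simps power2_eq_square)
      then show ?thesis by (simp only: sum_distrib_left[symmetric])
    qed
    show ?thesis
      by (simp only: integral_mult_right aux sum.distrib) (simp only: sum_distrib_left[symmetric])
  qed
  also have "(\<Sum>j<N. integral I (\<lambda>s. integral (J j) (\<lambda>t. (D1 \<psi> (s, t))\<^sup>2)))
      = integral I (\<lambda>s. \<Sum>j<N. integral (J j) (\<lambda>t. (D1 \<psi> (s, t))\<^sup>2))"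
    by (subst integral_sum) (use sq in \<open>auto intro!: slice_integrable simp: I_def J_def\<close>)
  also have "\<dots> = iterated_integral a (a + real N * h) c (c + real N * h) (\<lambda>p. (D1 \<psi> p)\<^sup>2)"
    unfolding iterated_integral_def I_def J_def
    by (subst integral_cells) (use h sq in \<open>auto intro: continuous_on_slice\<close>)
  finally show ?thesis by simp
qed

text \<open>On each vertical line \<psi> is the integral of \<open>D2 \<psi>\<close> from the edge
  where it vanishes; Cauchy-Schwarz bounds it pointwise, and two integrations finish.\<close>

lemma planar_Poincare:
  fixes \<psi> :: "real \<times> real \<Rightarrow> real"
  assumes d: "\<And>p. \<psi> differentiable (at p)" and c2: "continuous_on UNIV (D2 \<psi>)"
    and z: "\<And>s. \<psi> (s, c) = 0" and l: "c \<le> d"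
  shows "iterated_integral a b c d (\<lambda>p. (\<psi> p)\<^sup>2) \<le> (d - c)\<^sup>2 * iterated_integral a b c d (\<lambda>p. (D2 \<psi> p)\<^sup>2)"
proof -
  have cc: "continuous_on UNIV \<psi>"
    using d by (meson continuous_at_imp_continuous_on differentiable_imp_continuous_within)
  have sq: "continuous_on UNIV (\<lambda>p. (D2 \<psi> p)\<^sup>2)" "continuous_on UNIV (\<lambda>p. (\<psi> p)\<^sup>2)"
    using c2 cc by (auto intro!: continuous_intros)
  have "integral {c..d} (\<lambda>t. (\<psi> (s, t))\<^sup>2) \<le> (d - c)\<^sup>2 * integral {c..d} (\<lambda>t. (D2 \<psi> (s, t))\<^sup>2)" for s
  proof -
    have "(\<psi> (s, t))\<^sup>2 \<le> (d - c) * integral {c..d} (\<lambda>t. (D2 \<psi> (s, t))\<^sup>2)" if "t \<in> {c..d}" for t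
    proof -
      have "((\<lambda>t. \<psi> (s, t)) has_real_derivative D2 \<psi> (s, t)) (at t)" for t
        using has_derivative_D1D2(4)[OF differentiable_has_derivative[OF d[of "(s, t)"]]] by simp
      from diff_square_le[OF this continuous_on_slice(1)[OF c2] that, of c] show ?thesis
        using l by (simp add: z)
    qed
    then have "integral {c..d} (\<lambda>t. (\<psi> (s, t))\<^sup>2)
        \<le> integral {c..d} (\<lambda>_. (d - c) * integral {c..d} (\<lambda>t. (D2 \<psi> (s, t))\<^sup>2))"
      by (intro integral_le slice_integrable sq) auto
    then show ?thesis using l by (simp add: power2_eq_square)
  qed
  then have "iterated_integral a b c d (\<lambda>p. (\<psi> p)\<^sup>2)
      \<le> integral {a..b} (\<lambda>s. (d - c)\<^sup>2 * integral {c..d} (\<lambda>t. (D2 \<psi> (s, t))\<^sup>2))"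
    unfolding iterated_integral_def
    by (intro integral_le slice_integrable integrable_on_mult_right sq)
  then show ?thesis by (simp add: iterated_integral_def)
qed

text \<open>The bridge between the two notions of integral: the energies in the eigenvalue problem
  are Lebesgue integrals over the plane, the cell estimates concern iterated integrals over a
  box.\<close>

lemma lborel_integral_eq_iterated:
  fixes F :: "real \<times> real \<Rightarrow> real"
  assumes "continuous_on UNIV F" "\<And>p. p \<notin> {a..b} \<times> {c..d} \<Longrightarrow> F p = 0"
  shows "integrable lborel F" "(LINT p|lborel. F p) = iterated_integral a b c d F"
proof -
  have e: "F = (\<lambda>p. indicator (cbox (a, c) (b, d)) p *\<^sub>R F p)"
  proof
    fix p show "F p = indicator (cbox (a, c) (b, d)) p *\<^sub>R F p"
      using assms(2)[of p] by (cases "p \<in> {a..b} \<times> {c..d}") (auto simp: cbox_Pair_eq)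
  qed
  have c: "continuous_on (cbox (a, c) (b, d)) F"
    using assms(1) continuous_on_subset by blast
  show i: "integrable lborel F"
    by (subst e, rule borel_integrable_compact) (use c in auto)
  have "(LINT p|lborel. F p) = (LINT p:cbox (a, c) (b, d)|lborel. F p)"
    unfolding set_lebesgue_integral_def using e by metis
  also have "\<dots> = integral (cbox (a, c) (b, d)) F"
    by (rule set_borel_integral_eq_integral)
      (use i e in \<open>auto simp: set_integrable_def\<close>)
  also have "\<dots> = iterated_integral a b c d F"
    unfolding iterated_integral_def using integral_prod_continuous[OF c] by simp
  finally show "(LINT p|lborel. F p) = iterated_integral a b c d F" .
qed

section \<open>Square integrable functions\<close>

definition l2sq :: "(real \<times> real \<Rightarrow> 'b::euclidean_space) \<Rightarrow> real" where
  "l2sq f = (LINT p|lborel. (norm (f p))\<^sup>2)"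

lemma l2sq_nonneg [simp]: "0 \<le> l2sq f"
  by (simp add: l2sq_def)

lemma norm_add_square_le:
  fixes x y :: "'a::real_normed_vector"
  shows "(norm (x + y))\<^sup>2 \<le> 2 * (norm x)\<^sup>2 + 2 * (norm y)\<^sup>2"
proof -
  have "(norm (x + y))\<^sup>2 \<le> (norm x + norm y)\<^sup>2"
    by (intro power_mono norm_triangle_ineq) auto
  also have "\<dots> \<le> 2 * (norm x)\<^sup>2 + 2 * (norm y)\<^sup>2"
    using zero_le_power2[of "norm x - norm y"] by (simp add: power2_eq_square algebra_simps)
  finally show ?thesis .
qed

lemma square_integrable_add:
  assumes "square_integrable f" "square_integrable g"
  shows "square_integrable (\<lambda>p. f p + g p)" "l2sq (\<lambda>p. f p + g p) \<le> 2 * l2sq f + 2 * l2sq g"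
proof -
  have i: "integrable lborel (\<lambda>p. 2 * (norm (f p))\<^sup>2 + 2 * (norm (g p))\<^sup>2)"
    using assms by (auto simp: square_integrable_def)
  have [measurable]: "f \<in> borel_measurable borel" "g \<in> borel_measurable borel"
    using assms by (auto simp: square_integrable_def)
  have j: "integrable lborel (\<lambda>p. (norm (f p + g p))\<^sup>2)"
    by (rule Bochner_Integration.integrable_bound[OF i]) (auto simp: norm_add_square_le)
  then show "square_integrable (\<lambda>p. f p + g p)"
    by (simp add: square_integrable_def)
  have "l2sq (\<lambda>p. f p + g p) \<le> (LINT p|lborel. 2 * (norm (f p))\<^sup>2 + 2 * (norm (g p))\<^sup>2)"
    unfolding l2sq_def by (intro integral_mono i j norm_add_square_le)
  also have "\<dots> = 2 * l2sq f + 2 * l2sq g"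
    using assms by (simp add: l2sq_def square_integrable_def)
  finally show "l2sq (\<lambda>p. f p + g p) \<le> 2 * l2sq f + 2 * l2sq g" .
qed

lemma square_integrable_scaleR:
  assumes "square_integrable f"
  shows "square_integrable (\<lambda>p. c *\<^sub>R f p)" "l2sq (\<lambda>p. c *\<^sub>R f p) = c\<^sup>2 * l2sq f"
  using assms by (auto simp: square_integrable_def l2sq_def power_mult_distrib)

lemma square_integrable_diff:
  assumes "square_integrable f" "square_integrable g"
  shows "square_integrable (\<lambda>p. f p - g p)" "l2sq (\<lambda>p. f p - g p) \<le> 2 * l2sq f + 2 * l2sq g"
  using square_integrable_add[OF assms(1) square_integrable_scaleR(1)[OF assms(2), of "-1"]]
    square_integrable_scaleR(2)[OF assms(2), of "-1"] by auto

text \<open>Cauchy-Schwarz with a bounded weight: \<open>w = 1\<close> serves norms and gradient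
  energies, the potential serves the zero order term. The weighted mean inequality with parameter
  \<open>t\<close> gives integrability at \<open>t = 1\<close> and, after optimising
  \<open>t\<close>, the product of the norms.\<close>

lemma weighted_inner_integrable:
  assumes "square_integrable f" "square_integrable g"
    and w: "w \<in> borel_measurable borel" "\<And>p. \<bar>w p\<bar> \<le> K"
  shows "integrable lborel (\<lambda>p. w p * (f p \<bullet> g p))"
    "\<bar>LINT p|lborel. w p * (f p \<bullet> g p)\<bar> \<le> K * (sqrt (l2sq f) * sqrt (l2sq g))"
proof -
  have K: "K \<ge> 0" using w(2)[of 0] by linarith
  have [measurable]: "f \<in> borel_measurable borel" "g \<in> borel_measurable borel" "w \<in> borel_measurable borel"
    using assms by (auto simp: square_integrable_def)
  have b: "\<bar>w p * (f p \<bullet> g p)\<bar> \<le> K * (t / 2) * (norm (f p))\<^sup>2 + K / (2 * t) * (norm (g p))\<^sup>2"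
    if t: "t > 0" for p and t :: real
  proof -
    have "\<bar>f p \<bullet> g p\<bar> \<le> norm (f p) * norm (g p)"
      by (rule Cauchy_Schwarz_ineq2)
    also have "\<dots> \<le> t / 2 * (norm (f p))\<^sup>2 + 1 / (2 * t) * (norm (g p))\<^sup>2"
      using t zero_le_power2[of "t * norm (f p) - norm (g p)"]
      by (simp add: field_simps power2_eq_square)
    finally have "\<bar>w p\<bar> * \<bar>f p \<bullet> g p\<bar> \<le> K * (t / 2 * (norm (f p))\<^sup>2 + 1 / (2 * t) * (norm (g p))\<^sup>2)"
      by (intro mult_mono w) (use K in auto)
    then show ?thesis by (simp add: abs_mult algebra_simps)
  qed
  have ib: "integrable lborel (\<lambda>p. K * (t / 2) * (norm (f p))\<^sup>2 + K / (2 * t) * (norm (g p))\<^sup>2)" for t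
    using assms by (auto simp: square_integrable_def)
  show i: "integrable lborel (\<lambda>p. w p * (f p \<bullet> g p))"
  proof (rule Bochner_Integration.integrable_bound[OF ib[of 1]])
    show "AE p in lborel. norm (w p * (f p \<bullet> g p))
        \<le> norm (K * (1 / 2) * (norm (f p))\<^sup>2 + K / (2 * 1) * (norm (g p))\<^sup>2)"
    proof (rule AE_I2)
      fix p
      show "norm (w p * (f p \<bullet> g p)) \<le> norm (K * (1 / 2) * (norm (f p))\<^sup>2 + K / (2 * 1) * (norm (g p))\<^sup>2)"
        unfolding real_norm_def by (rule order_trans[OF b[OF zero_less_one] abs_ge_self])
    qed
  qed measurable
  define c where "c = \<bar>LINT p|lborel. w p * (f p \<bullet> g p)\<bar>"
  have c: "c \<le> K * (t / 2) * l2sq f + K / (2 * t) * l2sq g" if t: "t > 0" for t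
  proof -
    have "c \<le> (LINT p|lborel. \<bar>w p * (f p \<bullet> g p)\<bar>)"
      unfolding c_def by (rule integral_abs_bound)
    also have "\<dots> \<le> (LINT p|lborel. K * (t / 2) * (norm (f p))\<^sup>2 + K / (2 * t) * (norm (g p))\<^sup>2)"
      by (intro integral_mono ib b[OF t]) (use i in auto)
    also have "\<dots> = K * (t / 2) * l2sq f + K / (2 * t) * l2sq g"
      using assms unfolding l2sq_def square_integrable_def
      by (subst Bochner_Integration.integral_add) auto
    finally show ?thesis .
  qed
  define A where "A = sqrt (l2sq f)"
  define B where "B = sqrt (l2sq g)"
  have AB: "l2sq f = A\<^sup>2" "l2sq g = B\<^sup>2" "A \<ge> 0" "B \<ge> 0"
    by (auto simp: A_def B_def)
  have "c \<le> K * (A * B) + K * d" if d: "d > 0" for d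
  proof -
    \<comment> \<open>The optimal parameter \<open>B / A\<close> breaks down when a norm vanishes,
      so both norms are shifted by \<eta>, small enough that their product grows by at most
      \<open>d\<close>.\<close>
    define \<eta> where "\<eta> = d / (A + B + d + 1)"
    have \<eta>: "\<eta> > 0" "\<eta> * (A + B) + \<eta>\<^sup>2 \<le> d"
    proof -
      show "\<eta> > 0" using d AB by (simp add: \<eta>_def add_nonneg_pos)
      have s: "A + B + d + 1 > 0" using d AB by linarith
      have e: "\<eta> * (A + B + d + 1) = d" unfolding \<eta>_def using s by simp
      have "\<eta> \<le> 1" unfolding \<eta>_def using s d AB by (simp add: field_simps)
      then have "\<eta>\<^sup>2 \<le> \<eta> * 1" unfolding power2_eq_square using \<open>\<eta> > 0\<close> by (intro mult_left_mono) auto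
      moreover have "\<eta> * d \<ge> 0" using d \<open>\<eta> > 0\<close> by simp
      ultimately show "\<eta> * (A + B) + \<eta>\<^sup>2 \<le> d" using e by (simp add: algebra_simps)
    qed
    define t where "t = (B + \<eta>) / (A + \<eta>)"
    have t: "t > 0" using AB \<eta> by (simp add: t_def add_nonneg_pos)
    have "c \<le> K * (t / 2) * A\<^sup>2 + K / (2 * t) * B\<^sup>2"
      using c[OF t] AB by simp
    also have "\<dots> \<le> K * (t / 2) * (A + \<eta>)\<^sup>2 + K / (2 * t) * (B + \<eta>)\<^sup>2"
      using AB \<eta> t K by (intro add_mono mult_left_mono power_mono) auto
    also have "\<dots> = K * ((A + \<eta>) * (B + \<eta>))"
    proof -
      have "K * (Q / P / 2) * P\<^sup>2 + K / (2 * (Q / P)) * Q\<^sup>2 = K * (P * Q)" if "P > 0" "Q > 0" for P Q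
        using that by (simp add: field_simps power2_eq_square)
      moreover have "A + \<eta> > 0" "B + \<eta> > 0" using AB \<eta> by auto
      ultimately show ?thesis unfolding t_def by blast
    qed
    also have "\<dots> = K * (A * B) + K * (\<eta> * (A + B) + \<eta>\<^sup>2)"
      by (simp add: algebra_simps power2_eq_square)
    also have "\<dots> \<le> K * (A * B) + K * d"
      using \<eta>(2) K by (intro add_left_mono mult_left_mono) auto
    finally show ?thesis .
  qed
  then have d: "c \<le> K * (A * B) + K * d" if "d > 0" for d
    using that by blast
  have "c \<le> K * (A * B)"
  proof (rule field_le_epsilon)
    fix e :: real assume e: "e > 0"
    have "K * (e / (K + 1)) \<le> e"
      using K e by (simp add: field_simps)
    moreover have "e / (K + 1) > 0" using K e by simp
    ultimately show "c \<le> K * (A * B) + e"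
      using d[of "e / (K + 1)"] by linarith
  qed
  then show "\<bar>LINT p|lborel. w p * (f p \<bullet> g p)\<bar> \<le> K * (sqrt (l2sq f) * sqrt (l2sq g))"
    by (simp add: c_def A_def B_def)
qed

lemma weighted_inner_tendsto:
  fixes f :: "real \<times> real \<Rightarrow> 'b::euclidean_space"
  assumes "square_integrable f" "square_integrable g"
    and fn: "\<And>n. square_integrable (fn n)" "\<And>n. square_integrable (gn n)"
    and lim: "(\<lambda>n. l2sq (\<lambda>p. fn n p - f p)) \<longlonglongrightarrow> 0" "(\<lambda>n. l2sq (\<lambda>p. gn n p - g p)) \<longlonglongrightarrow> 0"
    and w: "w \<in> borel_measurable borel" "\<And>p. \<bar>w p\<bar> \<le> K"
  shows "(\<lambda>n. LINT p|lborel. w p * (fn n p \<bullet> gn n p)) \<longlonglongrightarrow> (LINT p|lborel. w p * (f p \<bullet> g p))"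
proof -
  let ?I = "\<lambda>f g. LINT p|lborel. w p * (f p \<bullet> g p)"
  define \<delta> where "\<delta> n = K * (sqrt (l2sq (\<lambda>p. fn n p - f p)) * sqrt (l2sq (\<lambda>p. gn n p - g p)))
      + K * (sqrt (l2sq (\<lambda>p. fn n p - f p)) * sqrt (l2sq g))
      + K * (sqrt (l2sq f) * sqrt (l2sq (\<lambda>p. gn n p - g p)))" for n
  have eq: "?I (fn n) (gn n) - ?I f g = ?I (\<lambda>p. fn n p - f p) (\<lambda>p. gn n p - g p)
      + ?I (\<lambda>p. fn n p - f p) g + ?I f (\<lambda>p. gn n p - g p)" for n
  proof -
    have "?I (fn n) (gn n) - ?I f g = (LINT p|lborel. w p * (fn n p \<bullet> gn n p) - w p * (f p \<bullet> g p))"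
      by (intro Bochner_Integration.integral_diff[symmetric] weighted_inner_integrable(1)[where K = K] assms)
    also have "\<dots> = (LINT p|lborel. (w p * ((fn n p - f p) \<bullet> (gn n p - g p))
        + w p * ((fn n p - f p) \<bullet> g p)) + w p * (f p \<bullet> (gn n p - g p)))"
      by (intro Bochner_Integration.integral_cong refl) (simp add: inner_simps algebra_simps)
    also have "\<dots> = ?I (\<lambda>p. fn n p - f p) (\<lambda>p. gn n p - g p)
      + ?I (\<lambda>p. fn n p - f p) g + ?I f (\<lambda>p. gn n p - g p)"
    proof -
      have 1: "integrable lborel (\<lambda>p. w p * ((fn n p - f p) \<bullet> (gn n p - g p)))"
        by (intro weighted_inner_integrable(1)[where K = K] square_integrable_diff(1) assms)
      have 2: "integrable lborel (\<lambda>p. w p * ((fn n p - f p) \<bullet> g p))"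
        by (intro weighted_inner_integrable(1)[where K = K] square_integrable_diff(1) assms)
      have 3: "integrable lborel (\<lambda>p. w p * (f p \<bullet> (gn n p - g p)))"
        by (intro weighted_inner_integrable(1)[where K = K] square_integrable_diff(1) assms)
      show ?thesis
        by (simp only: Bochner_Integration.integral_add[OF Bochner_Integration.integrable_add[OF 1 2] 3]
            Bochner_Integration.integral_add[OF 1 2])
    qed
    finally show ?thesis .
  qed
  have "\<bar>?I (fn n) (gn n) - ?I f g\<bar> \<le> \<delta> n" for n
  proof -
    have df: "square_integrable (\<lambda>p. fn n p - f p)" and dg: "square_integrable (\<lambda>p. gn n p - g p)"
      by (intro square_integrable_diff(1) assms)+
    note b = weighted_inner_integrable(2)[where w = w and K = K, OF _ _ w]
    have tri: "\<bar>x\<bar> \<le> X \<Longrightarrow> \<bar>y\<bar> \<le> Y \<Longrightarrow> \<bar>z\<bar> \<le> Z \<Longrightarrow> \<bar>x + y + z\<bar> \<le> X + Y + Z" for x y z X Y Z :: real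
      by linarith
    show ?thesis
      unfolding \<delta>_def eq
      by (rule tri[OF b[OF df dg] b[OF df assms(2)] b[OF assms(1) dg]])
  qed
  then have le: "\<forall>\<^sub>F n in sequentially. norm (?I (fn n) (gn n) - ?I f g) \<le> \<delta> n"
    by (intro always_eventually allI) (simp only: real_norm_def)
  have "\<delta> \<longlonglongrightarrow> K * (sqrt 0 * sqrt 0) + K * (sqrt 0 * sqrt (l2sq g)) + K * (sqrt (l2sq f) * sqrt 0)"
    unfolding \<delta>_def by (intro tendsto_intros lim)
  then have "\<delta> \<longlonglongrightarrow> 0"
    by simp
  then have "(\<lambda>n. ?I (fn n) (gn n) - ?I f g) \<longlonglongrightarrow> 0"
    by (rule Lim_null_comparison[OF le])
  then show ?thesis
    by (rule LIM_zero_cancel)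
qed

text \<open>Along a subsequence with \<open>\<parallel>f\<^bsub>i+1\<^esub> - f\<^bsub>i\<^esub>\<parallel>\<^sup>2 \<le> 4\<^bsup>-i\<^esup>\<close> the series \<open>\<Sum> 2\<^sup>i \<bar>f\<^bsub>i+1\<^esub> - f\<^bsub>i\<^esub>\<bar>\<^sup>2\<close> is
  integrable, hence finite almost everywhere, and there the increments decay geometrically.\<close>

lemma l2_complete:
  fixes f :: "nat \<Rightarrow> real \<times> real \<Rightarrow> 'b::euclidean_space"
  assumes f: "\<And>n. square_integrable (f n)"
    and cauchy: "\<And>e. e > 0 \<Longrightarrow> \<exists>N. \<forall>m\<ge>N. \<forall>n\<ge>N. l2sq (\<lambda>p. f m p - f n p) < e"
  obtains g where "square_integrable g" "(\<lambda>n. l2sq (\<lambda>p. f n p - g p)) \<longlonglongrightarrow> 0"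
proof -
  have fm [measurable]: "f n \<in> borel_measurable borel" for n
    using f by (simp add: square_integrable_def)
  have "\<exists>N. \<forall>m\<ge>N. \<forall>n\<ge>N. l2sq (\<lambda>p. f m p - f n p) < (1 / 4) ^ i" for i :: nat
    using cauchy by simp
  then obtain R where R: "\<And>i m n. m \<ge> R i \<Longrightarrow> n \<ge> R i \<Longrightarrow> l2sq (\<lambda>p. f m p - f n p) < (1 / 4) ^ i"
    by metis
  \<comment> \<open>Summing gives monotonicity and dominates \<open>R i\<close>; the extra
    \<open>i\<close> forces \<open>r i\<close> to infinity.\<close>
  define r where "r i = (\<Sum>j\<le>i. R j) + i" for i
  have rR: "r i \<ge> R i" "r i \<ge> i" "r (Suc i) \<ge> r i" for i
    by (auto simp: r_def intro: member_le_sum[of i "{..i}" R, simplified] trans_le_add1)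
  have rS: "r (Suc i) \<ge> R i" for i
    using rR(1)[of i] rR(3)[of i] by linarith
  define h where "h i p = (norm (f (r (Suc i)) p - f (r i) p))\<^sup>2" for i p
  have hi: "integrable lborel (h i)" for i
    unfolding h_def using square_integrable_diff(1)[OF f f] by (simp add: square_integrable_def)
  have hl: "(LINT p|lborel. h i p) \<le> (1 / 4) ^ i" for i
    using less_imp_le[OF R[OF rS rR(1)]] by (simp add: h_def l2sq_def)
  have [measurable]: "h i \<in> borel_measurable borel" for i
    using hi by auto
  have h0: "h i p \<ge> 0" for i p by (simp add: h_def)
  have "(\<integral>\<^sup>+p. (\<Sum>i. ennreal (2 ^ i * h i p)) \<partial>lborel) = (\<Sum>i. (\<integral>\<^sup>+p. ennreal (2 ^ i * h i p) \<partial>lborel))"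
    by (rule nn_integral_suminf) simp
  also have "\<dots> \<le> (\<Sum>i. ennreal ((1 / 2) ^ i))"
  proof (intro suminf_le)
    fix i
    have "(\<integral>\<^sup>+p. ennreal (2 ^ i * h i p) \<partial>lborel) = ennreal (LINT p|lborel. 2 ^ i * h i p)"
      using hi h0 by (intro nn_integral_eq_integral) auto
    also have "(LINT p|lborel. 2 ^ i * h i p) \<le> 2 ^ i * (1 / 4) ^ i"
      using hl[of i] by simp
    also have "(2::real) ^ i * (1 / 4) ^ i = (1 / 2) ^ i"
      by (simp add: power_mult_distrib[symmetric])
    finally show "(\<integral>\<^sup>+p. ennreal (2 ^ i * h i p) \<partial>lborel) \<le> ennreal ((1 / 2) ^ i)"
      by (simp add: ennreal_leI)
  qed auto
  also have "(\<Sum>i. ennreal ((1 / 2) ^ i)) = ennreal (1 / (1 - 1 / 2))"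
    by (intro suminf_ennreal_eq geometric_sums) auto
  also have "\<dots> < \<infinity>"
    by simp
  finally have "AE p in lborel. (\<Sum>i. ennreal (2 ^ i * h i p)) \<noteq> \<infinity>"
    by (intro nn_integral_noteq_infinite) (auto simp: less_top)
  then have "AE p in lborel. convergent (\<lambda>i. f (r i) p)"
  proof eventually_elim
    case (elim p)
    have s: "summable (\<lambda>i. 2 ^ i * h i p)"
      using elim h0 by (intro summable_suminf_not_top) (auto simp: top_unique)
    obtain B where B: "\<And>i. 2 ^ i * h i p \<le> B"
      using summable_imp_Bseq[OF s] unfolding Bseq_def by (metis abs_le_D1 real_norm_def)
    have le: "norm (f (r (Suc i)) p - f (r i) p) \<le> sqrt B * (sqrt (1 / 2)) ^ i" for i
    proof -
      have "h i p \<le> B * (1 / 2) ^ i"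
        using B[of i] by (simp add: field_simps power_divide)
      then have "sqrt (h i p) \<le> sqrt (B * (1 / 2) ^ i)" by simp
      then show ?thesis
        by (simp add: h_def real_sqrt_mult real_sqrt_power)
    qed
    have "summable (\<lambda>i. sqrt B * (sqrt (1 / 2)) ^ i)"
      by (intro summable_mult summable_geometric) (simp add: real_sqrt_divide)
    then have "summable (\<lambda>i. f (r (Suc i)) p - f (r i) p)"
      by (rule summable_comparison_test'[where N = 0]) (use le in auto)
    then have "convergent (\<lambda>n. \<Sum>i<n. f (r (Suc i)) p - f (r i) p)"
      by (simp add: summable_iff_convergent)
    then have "convergent (\<lambda>n. f (r n) p - f (r 0) p)"
      using sum_lessThan_telescope[of "\<lambda>i. f (r i) p"] by simp
    then have "convergent (\<lambda>n. (f (r n) p - f (r 0) p) + f (r 0) p)"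
      by (intro convergent_add convergent_const)
    then show ?case by simp
  qed
  then have conv: "AE p in lborel. (\<lambda>i. f (r i) p) \<longlonglongrightarrow> lim (\<lambda>i. f (r i) p)"
    by eventually_elim (simp add: convergent_LIMSEQ_iff)
  define g where "g p = lim (\<lambda>i. f (r i) p)" for p
  have gm [measurable]: "g \<in> borel_measurable borel"
    unfolding g_def by measurable
  \<comment> \<open>A bound that is uniform along the sequence passes to the pointwise limit. It
    yields both the square integrability of \<open>f n - g\<close> and the convergence.\<close>
  have fatou: "(\<integral>\<^sup>+p. ennreal ((norm (f n p - g p))\<^sup>2) \<partial>lborel) \<le> ennreal e"
    if e: "\<And>m. m \<ge> N \<Longrightarrow> l2sq (\<lambda>p. f n p - f m p) \<le> e" for n N e
  proof -
    have "(\<integral>\<^sup>+p. ennreal ((norm (f n p - g p))\<^sup>2) \<partial>lborel)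
        = (\<integral>\<^sup>+p. liminf (\<lambda>i. ennreal ((norm (f n p - f (r i) p))\<^sup>2)) \<partial>lborel)"
    proof (rule nn_integral_cong_AE)
      show "AE p in lborel. ennreal ((norm (f n p - g p))\<^sup>2) = liminf (\<lambda>i. ennreal ((norm (f n p - f (r i) p))\<^sup>2))"
        using conv
      proof eventually_elim
        case (elim p)
        then have "(\<lambda>i. ennreal ((norm (f n p - f (r i) p))\<^sup>2)) \<longlonglongrightarrow> ennreal ((norm (f n p - g p))\<^sup>2)"
          unfolding g_def by (intro tendsto_intros)
        from lim_imp_Liminf[OF trivial_limit_sequentially this] show ?case
            by simp
      qed
    qed
    also have "\<dots> \<le> liminf (\<lambda>i. (\<integral>\<^sup>+p. ennreal ((norm (f n p - f (r i) p))\<^sup>2) \<partial>lborel))"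
      by (rule nn_integral_liminf) simp
    also have "(\<lambda>i. (\<integral>\<^sup>+p. ennreal ((norm (f n p - f (r i) p))\<^sup>2) \<partial>lborel))
        = (\<lambda>i. ennreal (l2sq (\<lambda>p. f n p - f (r i) p)))"
      unfolding l2sq_def using square_integrable_diff(1)[OF f f]
      by (intro ext nn_integral_eq_integral) (auto simp: square_integrable_def)
    also have "liminf \<dots> \<le> ennreal e"
    proof (rule Liminf_le)
      have "\<forall>\<^sub>F i in sequentially. i \<ge> N" by (rule eventually_ge_at_top)
      then show "\<forall>\<^sub>F i in sequentially. ennreal (l2sq (\<lambda>p. f n p - f (r i) p)) \<le> ennreal e"
        by eventually_elim (use rR(2) e order_trans in \<open>blast intro: ennreal_leI\<close>)
    qed simp
    finally show ?thesis .
  qed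
  have sq: "square_integrable (\<lambda>p. f n p - g p)"
    if "\<And>m. m \<ge> N \<Longrightarrow> l2sq (\<lambda>p. f n p - f m p) \<le> e" for n N e
    unfolding square_integrable_def
    using fatou[of N n e] that
    by (auto intro!: integrableI_nonneg simp: less_top[symmetric] top_unique)
  obtain N0 where N0: "\<forall>m\<ge>N0. \<forall>n\<ge>N0. l2sq (\<lambda>p. f m p - f n p) < 1"
    using cauchy[of 1] by auto
  have "square_integrable (\<lambda>p. f N0 p - g p)"
    by (rule sq[of N0 _ 1]) (use N0 less_imp_le in blast)
  from square_integrable_diff(1)[OF f[of N0] this] have g: "square_integrable g" by simp
  have "(\<lambda>n. l2sq (\<lambda>p. f n p - g p)) \<longlonglongrightarrow> 0"
  proof (rule LIMSEQ_I)
    fix e :: real assume e: "e > 0"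
    obtain N where N: "\<forall>m\<ge>N. \<forall>n\<ge>N. l2sq (\<lambda>p. f m p - f n p) < e / 2"
      using cauchy[of "e / 2"] e by auto
    have "l2sq (\<lambda>p. f n p - g p) \<le> e / 2" if "n \<ge> N" for n
    proof -
      have le: "l2sq (\<lambda>p. f n p - f m p) \<le> e / 2" if "m \<ge> N" for m
        using N \<open>n \<ge> N\<close> that less_imp_le by blast
      have "ennreal (l2sq (\<lambda>p. f n p - g p)) = (\<integral>\<^sup>+p. ennreal ((norm (f n p - g p))\<^sup>2) \<partial>lborel)"
        unfolding l2sq_def using sq[OF le]
        by (intro nn_integral_eq_integral[symmetric]) (auto simp: square_integrable_def)
      also have "\<dots> \<le> ennreal (e / 2)"
        using fatou[OF le] .
      finally show ?thesis using e by (simp add: ennreal_le_iff)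
    qed
    note le = this
    have "norm (l2sq (\<lambda>p. f n p - g p) - 0) < e" if "n \<ge> N" for n
    proof -
      have "l2sq (\<lambda>p. f n p - g p) \<le> e / 2" using that by (rule le)
      then show ?thesis using e by simp
    qed
    then show "\<exists>N. \<forall>n\<ge>N. norm (l2sq (\<lambda>p. f n p - g p) - 0) < e"
      by blast
  qed
  with g show thesis by (rule that)
qed

section \<open>The first Dirichlet eigenvalue\<close>

definition weighted_inner ::
  "(real \<times> real \<Rightarrow> real) \<Rightarrow> (real \<times> real \<Rightarrow> 'b::euclidean_space) \<Rightarrow> (real \<times> real \<Rightarrow> 'b) \<Rightarrow> real" where
  "weighted_inner w f g = (LINT p|lborel. w p * (f p \<bullet> g p))"

lemma weighted_inner_one: "weighted_inner (\<lambda>_. 1) f f = l2sq f"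
  by (simp add: weighted_inner_def l2sq_def dot_square_norm)

lemma weighted_inner_lincomb:
  fixes f g :: "real \<times> real \<Rightarrow> 'b::euclidean_space"
  assumes f: "square_integrable f" and g: "square_integrable g"
    and w: "w \<in> borel_measurable borel" "\<And>p. \<bar>w p\<bar> \<le> K"
  shows "weighted_inner w (\<lambda>p. a *\<^sub>R f p + b *\<^sub>R g p) (\<lambda>p. a *\<^sub>R f p + b *\<^sub>R g p)
    = a\<^sup>2 * weighted_inner w f f + 2 * a * b * weighted_inner w f g + b\<^sup>2 * weighted_inner w g g"
proof -
  have i: "integrable lborel (\<lambda>p. w p * (u p \<bullet> v p))"
    if "square_integrable u" "square_integrable v" for u v :: "real \<times> real \<Rightarrow> 'b"
    by (rule weighted_inner_integrable(1)[OF that w])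
  have "weighted_inner w (\<lambda>p. a *\<^sub>R f p + b *\<^sub>R g p) (\<lambda>p. a *\<^sub>R f p + b *\<^sub>R g p)
      = (LINT p|lborel. (a\<^sup>2 * (w p * (f p \<bullet> f p)) + (2 * a * b) * (w p * (f p \<bullet> g p)))
          + b\<^sup>2 * (w p * (g p \<bullet> g p)))"
    unfolding weighted_inner_def
    by (intro Bochner_Integration.integral_cong refl)
      (simp add: inner_simps inner_commute power2_eq_square algebra_simps)
  also have "\<dots> = a\<^sup>2 * weighted_inner w f f + 2 * a * b * weighted_inner w f g + b\<^sup>2 * weighted_inner w g g"
    unfolding weighted_inner_def using i f g
    by (subst Bochner_Integration.integral_add; (subst Bochner_Integration.integral_add)?) auto
  finally show ?thesis .
qed

context
  fixes \<Omega> :: "(real \<times> real) set" and D :: real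
  assumes D: "D > 0" and box: "\<Omega> \<subseteq> {-D<..<D} \<times> {-D<..<D}"
begin

abbreviation "box_integral \<equiv> iterated_integral (-D) D (-D) D"

lemma test_function_l2:
  assumes "test_function \<Omega> \<psi>"
  shows "square_integrable \<psi>" "square_integrable (grad \<psi>)"
    "l2sq \<psi> = box_integral (\<lambda>p. (\<psi> p)\<^sup>2)"
    "l2sq (grad \<psi>) = box_integral (\<lambda>p. (D1 \<psi> p)\<^sup>2) + box_integral (\<lambda>p. (D2 \<psi> p)\<^sup>2)"
proof -
  note t = test_functionD[OF assms]
  have out: "p \<notin> \<Omega>" if "p \<notin> {-D..D} \<times> {-D..D}" for p
    using that box by fastforce
  have "integrable lborel F \<and> (LINT p|lborel. F p) = box_integral F"
    if "continuous_on UNIV F" "\<And>p. p \<notin> \<Omega> \<Longrightarrow> F p = 0" for F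
    using lborel_integral_eq_iterated[of F "-D" D "-D" D] that out by blast
  from this[of "\<lambda>p. (\<psi> p)\<^sup>2"] this[of "\<lambda>p. (D1 \<psi> p)\<^sup>2"] this[of "\<lambda>p. (D2 \<psi> p)\<^sup>2"]
  have i: "integrable lborel (\<lambda>p. (\<psi> p)\<^sup>2)" "(LINT p|lborel. (\<psi> p)\<^sup>2) = box_integral (\<lambda>p. (\<psi> p)\<^sup>2)"
    "integrable lborel (\<lambda>p. (D1 \<psi> p)\<^sup>2)" "(LINT p|lborel. (D1 \<psi> p)\<^sup>2) = box_integral (\<lambda>p. (D1 \<psi> p)\<^sup>2)"
    "integrable lborel (\<lambda>p. (D2 \<psi> p)\<^sup>2)" "(LINT p|lborel. (D2 \<psi> p)\<^sup>2) = box_integral (\<lambda>p. (D2 \<psi> p)\<^sup>2)"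
    using t by (auto intro!: continuous_intros)
  have n: "(norm (grad \<psi> p))\<^sup>2 = (D1 \<psi> p)\<^sup>2 + (D2 \<psi> p)\<^sup>2" for p
    by (simp add: grad_def norm_Pair)
  have "continuous_on UNIV (grad \<psi>)"
    unfolding grad_def using t by (intro continuous_intros)
  then have m: "\<psi> \<in> borel_measurable lborel" "grad \<psi> \<in> borel_measurable lborel"
    using t(2) borel_measurable_continuous_onI by auto
  show "square_integrable \<psi>" "square_integrable (grad \<psi>)"
    using i m by (auto simp: square_integrable_def n)
  show "l2sq \<psi> = box_integral (\<lambda>p. (\<psi> p)\<^sup>2)"
    using i by (simp add: l2sq_def)
  show "l2sq (grad \<psi>) = box_integral (\<lambda>p. (D1 \<psi> p)\<^sup>2) + box_integral (\<lambda>p. (D2 \<psi> p)\<^sup>2)"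
    using i by (simp add: l2sq_def n)
qed

lemma test_function_Poincare:
  assumes "test_function \<Omega> \<psi>"
  shows "l2sq \<psi> \<le> (2 * D)\<^sup>2 * l2sq (grad \<psi>)"
proof -
  note t = test_functionD[OF assms]
  \<comment> \<open>The box around \<Omega> is open, so its lower edge lies outside
    \<Omega>.\<close>
  have "\<psi> (s, - D) = 0" for s
    using box by (intro t(5)) auto
  then have "box_integral (\<lambda>p. (\<psi> p)\<^sup>2) \<le> (D - - D)\<^sup>2 * box_integral (\<lambda>p. (D2 \<psi> p)\<^sup>2)"
    using t D by (intro planar_Poincare) auto
  also have "\<dots> \<le> (2 * D)\<^sup>2 * (box_integral (\<lambda>p. (D1 \<psi> p)\<^sup>2) + box_integral (\<lambda>p. (D2 \<psi> p)\<^sup>2))"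
  proof (rule mult_mono)
    have "0 \<le> box_integral (\<lambda>p. (D1 \<psi> p)\<^sup>2)" "0 \<le> box_integral (\<lambda>p. (D2 \<psi> p)\<^sup>2)"
      using t by (auto intro!: iterated_integral_nonneg continuous_intros)
    then show "box_integral (\<lambda>p. (D2 \<psi> p)\<^sup>2) \<le> box_integral (\<lambda>p. (D1 \<psi> p)\<^sup>2) + box_integral (\<lambda>p. (D2 \<psi> p)\<^sup>2)"
      "0 \<le> box_integral (\<lambda>p. (D2 \<psi> p)\<^sup>2)" by auto
  qed auto
  finally show ?thesis
    by (simp add: test_function_l2[OF assms])
qed

lemma grad_lincomb:
  assumes "test_function \<Omega> \<phi>" "test_function \<Omega> \<psi>"
  shows "grad (\<lambda>p. a * \<phi> p + b * \<psi> p) = (\<lambda>p. a *\<^sub>R grad \<phi> p + b *\<^sub>R grad \<psi> p)"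
  using assms by (auto simp: fun_eq_iff grad_def D1_D2_lincomb test_functionD)

lemma test_function_minus:
  assumes "test_function \<Omega> \<phi>" "test_function \<Omega> \<psi>"
  shows "test_function \<Omega> (\<lambda>p. \<phi> p - \<psi> p)" "grad (\<lambda>p. \<phi> p - \<psi> p) = (\<lambda>p. grad \<phi> p - grad \<psi> p)"
  using test_function_lincomb[OF assms, of 1 "-1"] grad_lincomb[OF assms, of 1 "-1"] by auto

text \<open>For each mesh the cell integrals are finitely many bounded sequences. If all of them
  converge, the cell sum of a difference becomes small, and the energy term is small because of the
  mesh; so the subsequence is Cauchy.\<close>

lemma Rellich:
  assumes t: "\<And>n. test_function \<Omega> (\<psi> n)" and b: "\<And>n. l2sq (\<psi> n) \<le> 1" "\<And>n. l2sq (grad (\<psi> n)) \<le> G"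
  obtains r where "strict_mono (r :: nat \<Rightarrow> nat)"
    "\<And>e. e > 0 \<Longrightarrow> \<exists>N. \<forall>m\<ge>N. \<forall>n\<ge>N. l2sq (\<lambda>p. \<psi> (r m) p - \<psi> (r n) p) < e"
proof -
  define h where "h N = 2 * D / real (Suc N)" for N
  have h: "h N > 0" "h N \<le> 2 * D" "- D + real (Suc N) * h N = D" for N
    using D by (auto simp: h_def field_simps)
  define c where "c N i j F = iterated_integral (- D + real i * h N) (- D + real i * h N + h N)
     (- D + real j * h N) (- D + real j * h N + h N) F" for N i j F
  note td = test_functionD[OF t]
  have G: "G \<ge> 0" using b(2)[of 0] l2sq_nonneg order_trans by blast
  define S where "S = {(N, i, j). i < Suc N \<and> j < Suc N}"
  have sub: "{- D + real i * h N..- D + real i * h N + h N} \<subseteq> {-D..D}" if "i < Suc N" for i N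
  proof -
    have "(real i + 1) * h N \<le> real (Suc N) * h N"
      using that h(1)[of N] by (intro mult_right_mono) auto
    then have "- D + real i * h N + h N \<le> D"
      using h(3)[of N] by (simp only: distrib_right mult_1)
    moreover have "0 \<le> real i * h N" using h(1)[of N] by simp
    ultimately show ?thesis by auto
  qed
  have cb: "norm (c N i j (\<psi> n)) \<le> 2 * D" if "(N, i, j) \<in> S" for N i j n
  proof -
    have "(c N i j (\<psi> n))\<^sup>2 \<le> h N * h N * c N i j (\<lambda>p. (\<psi> n p)\<^sup>2)"
      unfolding c_def using iterated_integral_square_le[OF _ _ td(2), of "- D + real i * h N" "- D + real i * h N + h N"
          "- D + real j * h N" "- D + real j * h N + h N" n] h(1)[of N] by simp
    also have "c N i j (\<lambda>p. (\<psi> n p)\<^sup>2) \<le> box_integral (\<lambda>p. (\<psi> n p)\<^sup>2)"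
      unfolding c_def using that td(2)
      by (intro iterated_integral_subset sub) (auto simp: S_def intro!: continuous_intros)
    also have "\<dots> \<le> 1"
      using b(1)[of n] test_function_l2(3)[OF t[of n]] by simp
    finally have "(c N i j (\<psi> n))\<^sup>2 \<le> (h N)\<^sup>2"
      using h(1)[of N] by (simp add: power2_eq_square mult_left_mono)
    then have "\<bar>c N i j (\<psi> n)\<bar> \<le> h N"
      using h(1)[of N] by (simp add: abs_le_square_iff[symmetric])
    then show ?thesis using h(2)[of N] by simp
  qed
  \<comment> \<open>A diagonal extraction over the countable set of all cells of all meshes, so that
    the subsequence is fixed before a mesh is selected.\<close>
  obtain r where r: "strict_mono r"
    "\<And>x. x \<in> S \<Longrightarrow> \<exists>l. (\<lambda>n. (case x of (N, i, j) \<Rightarrow> c N i j (\<psi> (r n)))) \<longlonglongrightarrow> l"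
    by (rule function_convergent_subsequence[of S "\<lambda>n x. case x of (N, i, j) \<Rightarrow> c N i j (\<psi> n)" "2 * D"])
      (use cb in auto)
  show thesis
  proof (rule that[OF r(1)])
    fix e :: real assume e: "e > 0"
    \<comment> \<open>The energy of a difference is at most \<open>4 * G\<close>; the mesh is chosen
      first, so that the energy term takes half of \<open>e\<close>.\<close>
    obtain N :: nat where N: "4 * (h N)\<^sup>2 * (4 * G) < e / 2"
    proof -
      have "(\<lambda>N. 4 * (h N)\<^sup>2 * (4 * G)) \<longlonglongrightarrow> 4 * 0\<^sup>2 * (4 * G)"
        unfolding h_def by (intro tendsto_intros LIMSEQ_Suc lim_const_over_n)
      then have "\<forall>\<^sub>F N in sequentially. 4 * (h N)\<^sup>2 * (4 * G) < e / 2"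
        by (rule order_tendstoD) (use e in auto)
      then show thesis using that by (auto simp: eventually_sequentially)
    qed
    have "\<exists>l. (\<lambda>n. c N i j (\<psi> (r n))) \<longlonglongrightarrow> l" if "i < Suc N" "j < Suc N" for i j
      using r(2)[of "(N, i, j)"] that by (auto simp: S_def)
    then obtain l where l: "\<And>i j. i < Suc N \<Longrightarrow> j < Suc N \<Longrightarrow> (\<lambda>n. c N i j (\<psi> (r n))) \<longlonglongrightarrow> l i j"
      by metis
    define s where "s n = 4 / (h N)\<^sup>2 * (\<Sum>j<Suc N. \<Sum>i<Suc N. 2 * (c N i j (\<psi> (r n)) - l i j)\<^sup>2)" for n
    have "s \<longlonglongrightarrow> 4 / (h N)\<^sup>2 * (\<Sum>j<Suc N. \<Sum>i<Suc N. 2 * (l i j - l i j)\<^sup>2)"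
      unfolding s_def by (intro tendsto_intros l) auto
    then have "s \<longlonglongrightarrow> 0" by simp
    then have "\<forall>\<^sub>F n in sequentially. s n < e / 4"
      by (rule order_tendstoD) (use e in auto)
    then obtain M where M: "\<And>n. n \<ge> M \<Longrightarrow> s n < e / 4"
      by (auto simp: eventually_sequentially)
    have "l2sq (\<lambda>p. \<psi> (r m) p - \<psi> (r n) p) < e" if "m \<ge> M" "n \<ge> M" for m n
    proof -
      let ?d = "\<lambda>p. \<psi> (r m) p - \<psi> (r n) p"
      have dt: "test_function \<Omega> ?d" by (intro test_function_minus t)
      note dd = test_functionD[OF dt]
      have "l2sq (grad ?d) \<le> 2 * l2sq (grad (\<psi> (r m))) + 2 * l2sq (grad (\<psi> (r n)))"
        unfolding test_function_minus(2)[OF t t]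
        by (intro square_integrable_diff test_function_l2 t)
      also have "\<dots> \<le> 4 * G" using b(2)[of "r m"] b(2)[of "r n"] by simp
      finally have gd: "l2sq (grad ?d) \<le> 4 * G" .
      have nn: "0 \<le> box_integral (\<lambda>p. (D2 ?d p)\<^sup>2)"
        using dd(4) by (intro iterated_integral_nonneg) (auto intro!: continuous_intros)
      have "l2sq ?d = iterated_integral (- D) (- D + real (Suc N) * h N) (- D) (- D + real (Suc N) * h N) (\<lambda>p. (?d p)\<^sup>2)"
        using test_function_l2(3)[OF dt] h(3) by simp
      also have "\<dots> \<le> 4 / (h N)\<^sup>2 * (\<Sum>j<Suc N. \<Sum>i<Suc N. (c N i j ?d)\<^sup>2)
          + 4 * (h N)\<^sup>2 * box_integral (\<lambda>p. (D1 ?d p)\<^sup>2) + 2 * (h N)\<^sup>2 * box_integral (\<lambda>p. (D2 ?d p)\<^sup>2)"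
        using planar_cells_inequality[OF dd(1,3,4) h(1)[of N], of "-D" "Suc N" "-D"]
        unfolding c_def h(3) .
      also have "\<dots> \<le> 4 / (h N)\<^sup>2 * (\<Sum>j<Suc N. \<Sum>i<Suc N. (c N i j ?d)\<^sup>2) + 4 * (h N)\<^sup>2 * l2sq (grad ?d)"
        using nn by (simp add: test_function_l2(4)[OF dt] algebra_simps mult_right_mono)
      also have "\<dots> \<le> (s m + s n) + 4 * (h N)\<^sup>2 * (4 * G)"
      proof (intro add_mono mult_left_mono gd)
        have "(c N i j ?d)\<^sup>2 \<le> 2 * (c N i j (\<psi> (r m)) - l i j)\<^sup>2 + 2 * (c N i j (\<psi> (r n)) - l i j)\<^sup>2" for i j
        proof -
          have "c N i j ?d = (c N i j (\<psi> (r m)) - l i j) + (l i j - c N i j (\<psi> (r n)))"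
            unfolding c_def by (subst iterated_integral_diff) (use td(2) in auto)
          then show ?thesis
            using norm_add_square_le[of "c N i j (\<psi> (r m)) - l i j" "l i j - c N i j (\<psi> (r n))"]
            by (simp add: power2_commute)
        qed
        then have "(\<Sum>j<Suc N. \<Sum>i<Suc N. (c N i j ?d)\<^sup>2) \<le> (\<Sum>j<Suc N. \<Sum>i<Suc N.
            2 * (c N i j (\<psi> (r m)) - l i j)\<^sup>2 + 2 * (c N i j (\<psi> (r n)) - l i j)\<^sup>2)"
          by (intro sum_mono) auto
        then have "4 / (h N)\<^sup>2 * (\<Sum>j<Suc N. \<Sum>i<Suc N. (c N i j ?d)\<^sup>2) \<le> 4 / (h N)\<^sup>2 * (\<Sum>j<Suc N. \<Sum>i<Suc N.
            2 * (c N i j (\<psi> (r m)) - l i j)\<^sup>2 + 2 * (c N i j (\<psi> (r n)) - l i j)\<^sup>2)"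
          by (rule mult_left_mono) auto
        also have "\<dots> = s m + s n"
          unfolding s_def sum.distrib distrib_left ..
        finally show "4 / (h N)\<^sup>2 * (\<Sum>j<Suc N. \<Sum>i<Suc N. (c N i j ?d)\<^sup>2) \<le> s m + s n" .
      qed auto
      also have "\<dots> < e" using M[OF that(1)] M[OF that(2)] N by linarith
      finally show ?thesis .
    qed
    then show "\<exists>N. \<forall>m\<ge>N. \<forall>n\<ge>N. l2sq (\<lambda>p. \<psi> (r m) p - \<psi> (r n) p) < e"
      by blast
  qed
qed

text \<open>A minimising sequence converges in \<open>L\<^sup>2\<close> by Rellich's theorem. The parallelogram identity then makes
its gradients converge as well, so that no weak compactness is needed.\<close>

theorem first_dirichlet_eigenvalue_exists:
  assumes op: "open \<Omega>" "\<Omega> \<noteq> {}"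
    and a: "continuous_on \<Omega> a" "\<And>p. p \<in> \<Omega> \<Longrightarrow> \<bar>a p\<bar> \<le> K" and K: "K \<ge> 0"
  obtains \<mu> where "first_dirichlet_eigenvalue \<Omega> a \<mu>" "K * (2 * D)\<^sup>2 \<le> 1 \<Longrightarrow> \<mu> \<ge> 0"
proof -
  \<comment> \<open>The potential is arbitrary outside \<Omega>; extended by zero it is measurable
    and bounded on the whole plane.\<close>
  define b where "b p = indicator \<Omega> p *\<^sub>R a p" for p
  have bm: "b \<in> borel_measurable borel"
    unfolding b_def by (rule borel_measurable_continuous_on_indicator) (use op a in auto)
  have bK: "\<bar>b p\<bar> \<le> K" for p
    using a(2) K by (auto simp: b_def indicator_def)
  have om: "(\<lambda>_. 1::real) \<in> borel_measurable borel" "\<And>p :: real \<times> real. \<bar>1::real\<bar> \<le> 1" by auto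
  \<comment> \<open>Function and gradient are separate arguments, because the limit of a minimising
    sequence has a weak gradient \<open>g\<close> in place of \<open>grad\<close>.\<close>
  define Bil where "Bil \<phi> g \<psi> k = weighted_inner (\<lambda>_. 1) g k - weighted_inner b \<phi> \<psi>"
    for \<phi> \<psi> :: "real \<times> real \<Rightarrow> real" and g k :: "real \<times> real \<Rightarrow> real \<times> real"
  define E where "E \<psi> = Bil \<psi> (grad \<psi>) \<psi> (grad \<psi>)" for \<psi>
  let ?T = "test_function \<Omega>"
  have sq: "square_integrable \<psi>" "square_integrable (grad \<psi>)" if "?T \<psi>" for \<psi>
    using test_function_l2[OF that] by auto
  have E_ge: "E \<psi> \<ge> l2sq (grad \<psi>) - K * l2sq \<psi>" if "?T \<psi>" for \<psi>
    using weighted_inner_integrable(2)[OF sq(1)[OF that] sq(1)[OF that] bm bK]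
    unfolding E_def Bil_def weighted_inner_one by (simp add: weighted_inner_def)
  have E_lin: "E (\<lambda>p. s * \<phi> p + t * \<psi> p) = s\<^sup>2 * E \<phi> + 2 * s * t * Bil \<phi> (grad \<phi>) \<psi> (grad \<psi>) + t\<^sup>2 * E \<psi>"
    "l2sq (\<lambda>p. s * \<phi> p + t * \<psi> p) = s\<^sup>2 * l2sq \<phi> + 2 * s * t * weighted_inner (\<lambda>_. 1) \<phi> \<psi> + t\<^sup>2 * l2sq \<psi>"
    if "?T \<phi>" "?T \<psi>" for \<phi> \<psi> s t
    using weighted_inner_lincomb[OF sq(1)[OF that(1)] sq(1)[OF that(2)] bm bK, of s t]
      weighted_inner_lincomb[OF sq(1)[OF that(1)] sq(1)[OF that(2)] om, of s t]
      weighted_inner_lincomb[OF sq(2)[OF that(1)] sq(2)[OF that(2)] om, of s t]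
    unfolding E_def Bil_def grad_lincomb[OF that] weighted_inner_one real_scaleR_def
    by (simp_all add: algebra_simps)
  define \<mu> where "\<mu> = Inf (E ` {\<psi>. ?T \<psi> \<and> l2sq \<psi> = 1})"
  have bdd: "bdd_below (E ` {\<psi>. ?T \<psi> \<and> l2sq \<psi> = 1})"
  proof (rule bdd_belowI[of _ "- K"])
    fix y assume "y \<in> E ` {\<psi>. ?T \<psi> \<and> l2sq \<psi> = 1}"
    then obtain \<psi> where "y = E \<psi>" "?T \<psi>" "l2sq \<psi> = 1" by blast
    moreover from this have "l2sq (grad \<psi>) - K \<le> E \<psi>"
      using E_ge[of \<psi>] by simp
    ultimately show "- K \<le> y"
      using l2sq_nonneg[of "grad \<psi>"] by linarith
  qed
  have scale: "\<exists>s. ?T (\<lambda>p. s * \<psi> p) \<and> l2sq (\<lambda>p. s * \<psi> p) = 1 \<and> E (\<lambda>p. s * \<psi> p) = E \<psi> / l2sq \<psi>"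
    if "?T \<psi>" "l2sq \<psi> > 0" for \<psi>
    using test_function_lincomb[OF that(1) that(1), of "1 / sqrt (l2sq \<psi>)" 0]
      E_lin[OF that(1) that(1), of "1 / sqrt (l2sq \<psi>)" 0] that(2)
    by (intro exI[of _ "1 / sqrt (l2sq \<psi>)"]) (simp add: power_divide)
  have E_mu: "E \<psi> \<ge> \<mu> * l2sq \<psi>" if "?T \<psi>" for \<psi>
  proof (cases "l2sq \<psi> = 0")
    case True
    then have "l2sq (grad \<psi>) \<le> E \<psi>" using E_ge[OF that] by simp
    then show ?thesis using order_trans[OF l2sq_nonneg] True by simp
  next
    case False
    then have pos: "l2sq \<psi> > 0" using l2sq_nonneg[of \<psi>] by linarith
    then obtain s where s: "?T (\<lambda>p. s * \<psi> p)" "l2sq (\<lambda>p. s * \<psi> p) = 1" "E (\<lambda>p. s * \<psi> p) = E \<psi> / l2sq \<psi>"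
      using scale[of \<psi>] \<open>?T \<psi>\<close> by blast
    then have "\<mu> \<le> E \<psi> / l2sq \<psi>"
      unfolding \<mu>_def using cInf_lower[OF _ bdd] by (metis (mono_tags, lifting) image_eqI mem_Collect_eq)
    then show ?thesis using pos by (simp add: field_simps)
  qed
  obtain \<psi>0 where \<psi>0: "?T \<psi>0" "l2sq \<psi>0 = 1"
  proof -
    obtain p0 where p0: "p0 \<in> \<Omega>" using op by auto
    obtain \<psi> where \<psi>: "?T \<psi>" "\<psi> p0 > 0" using ex_test_function[OF op(1) p0] by blast
    \<comment> \<open>A continuous function that vanishes almost everywhere vanishes
      everywhere.\<close>
    have "l2sq \<psi> \<noteq> 0"
    proof
      assume "l2sq \<psi> = 0"
      then have "AE p in lborel. (norm (\<psi> p))\<^sup>2 = 0"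
        using sq(1)[OF \<psi>(1)] unfolding l2sq_def square_integrable_def
        by (subst (asm) integral_nonneg_eq_0_iff_AE) auto
      then have "AE p in lebesgue. p \<in> {p. \<psi> p = 0}"
        by (intro AE_completion) simp
      moreover have "closed {p. \<psi> p = 0}"
        using test_functionD(2)[OF \<psi>(1)] by (intro closed_Collect_eq continuous_intros)
      ultimately have "\<psi> p0 = 0"
        using mem_closed_if_AE_lebesgue by blast
      then show False using \<psi>(2) by simp
    qed
    then have "l2sq \<psi> > 0" using l2sq_nonneg[of \<psi>] by linarith
    then obtain s where "?T (\<lambda>p. s * \<psi> p)" "l2sq (\<lambda>p. s * \<psi> p) = 1"
      using scale[OF \<psi>(1)] by blast
    then show thesis by (rule that)
  qed
  have "\<exists>\<psi>. ?T \<psi> \<and> l2sq \<psi> = 1 \<and> E \<psi> < \<mu> + 1 / real (Suc n)" for n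
  proof -
    have "Inf (E ` {\<psi>. ?T \<psi> \<and> l2sq \<psi> = 1}) < \<mu> + 1 / real (Suc n)"
      by (simp add: \<mu>_def)
    then show ?thesis
      using \<psi>0 by (subst (asm) cInf_less_iff[OF _ bdd]) auto
  qed
  then obtain \<psi>s where \<psi>s: "\<And>n. ?T (\<psi>s n)" "\<And>n. l2sq (\<psi>s n) = 1" "\<And>n. E (\<psi>s n) < \<mu> + 1 / real (Suc n)"
    by metis
  have gb: "l2sq (grad (\<psi>s n)) \<le> \<mu> + 1 + K" for n
  proof -
    have "l2sq (grad (\<psi>s n)) \<le> E (\<psi>s n) + K"
      using E_ge[OF \<psi>s(1)[of n]] \<psi>s(2)[of n] by simp
    also have "E (\<psi>s n) \<le> \<mu> + 1"
      using \<psi>s(3)[of n] by (smt (verit) divide_le_eq_1 of_nat_Suc of_nat_0_le_iff)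
    finally show ?thesis by simp
  qed
  obtain r where r: "strict_mono (r :: nat \<Rightarrow> nat)"
    "\<And>e. e > 0 \<Longrightarrow> \<exists>N. \<forall>m\<ge>N. \<forall>n\<ge>N. l2sq (\<lambda>p. \<psi>s (r m) p - \<psi>s (r n) p) < e"
    by (rule Rellich[where \<psi> = \<psi>s and G = "\<mu> + 1 + K", OF \<psi>s(1) eq_refl[OF \<psi>s(2)] gb]) (rule that)
  define \<psi> where "\<psi> n = \<psi>s (r n)" for n
  have \<psi>: "?T (\<psi> n)" "l2sq (\<psi> n) = 1" for n
    by (auto simp: \<psi>_def \<psi>s)
  have E\<psi>: "(\<lambda>n. E (\<psi> n)) \<longlonglongrightarrow> \<mu>"
  proof (rule tendsto_sandwich)
    show "\<forall>\<^sub>F n in sequentially. \<mu> \<le> E (\<psi> n)"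
      using E_mu[OF \<psi>(1)] \<psi>(2) by simp
    show "\<forall>\<^sub>F n in sequentially. E (\<psi> n) \<le> \<mu> + 1 / real (Suc n)"
    proof (intro always_eventually allI)
      fix n
      have "1 / real (Suc (r n)) \<le> 1 / real (Suc n)"
        using seq_suble[OF r(1), of n] by (intro divide_left_mono) auto
      then show "E (\<psi> n) \<le> \<mu> + 1 / real (Suc n)"
        using \<psi>s(3)[of "r n"] by (simp add: \<psi>_def)
    qed
    have "(\<lambda>n. \<mu> + 1 / real (Suc n)) \<longlonglongrightarrow> \<mu> + 0"
      by (intro tendsto_intros LIMSEQ_Suc lim_const_over_n)
    then show "(\<lambda>n. \<mu> + 1 / real (Suc n)) \<longlonglongrightarrow> \<mu>" by simp
  qed auto
  have cauchy_grad: "\<exists>N. \<forall>m\<ge>N. \<forall>n\<ge>N. l2sq (\<lambda>p. grad (\<psi> m) p - grad (\<psi> n) p) < e" if e: "e > 0" for e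
  proof -
    define e1 where "e1 = e / (2 * (\<bar>\<mu>\<bar> + K + 1))"
    have M0: "\<bar>\<mu>\<bar> + K + 1 > 0" using K by (smt (verit))
    have e1: "e1 > 0" "(\<bar>\<mu>\<bar> + K) * e1 \<le> e / 2"
      unfolding e1_def using e K M0 by (auto simp: field_simps)
    obtain N where N: "\<And>m n. m \<ge> N \<Longrightarrow> n \<ge> N \<Longrightarrow> l2sq (\<lambda>p. \<psi> m p - \<psi> n p) < e1"
      using r(2)[OF e1(1)] unfolding \<psi>_def by blast
    have "\<forall>\<^sub>F n in sequentially. E (\<psi> n) < \<mu> + e / 8"
      by (rule order_tendstoD[OF E\<psi>]) (use e in auto)
    then obtain M where M: "\<And>n. n \<ge> M \<Longrightarrow> E (\<psi> n) < \<mu> + e / 8"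
      by (auto simp: eventually_sequentially)
    have "l2sq (\<lambda>p. grad (\<psi> m) p - grad (\<psi> n) p) < e" if "m \<ge> max M N" "n \<ge> max M N" for m n
    proof -
      let ?d = "\<lambda>p. \<psi> m p - \<psi> n p" and ?s = "\<lambda>p. \<psi> m p + \<psi> n p"
      have T: "?T ?d" "?T ?s"
        using test_function_lincomb[OF \<psi>(1)[of m] \<psi>(1)[of n], of 1 "-1"]
          test_function_lincomb[OF \<psi>(1)[of m] \<psi>(1)[of n], of 1 1] by auto
      \<comment> \<open>Parallelogram identities for the form and for the norm. Since
        \<open>E\<close> of the sum is at least \<mu> times its norm square, near-minimality of both
        terms leaves little for \<open>E\<close> of the difference.\<close>
      have Ed: "E ?d = 2 * E (\<psi> m) + 2 * E (\<psi> n) - E ?s" and ls: "l2sq ?s = 4 - l2sq ?d"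
        using E_lin[OF \<psi>(1)[of m] \<psi>(1)[of n], of 1 "-1"] E_lin[OF \<psi>(1)[of m] \<psi>(1)[of n], of 1 1]
          \<psi>(2)[of m] \<psi>(2)[of n] by auto
      have "E ?s \<ge> \<mu> * l2sq ?s" by (rule E_mu[OF T(2)])
      then have "E ?s \<ge> 4 * \<mu> - \<mu> * l2sq ?d" by (simp only: ls) (simp add: algebra_simps)
      moreover have "E (\<psi> m) < \<mu> + e / 8" "E (\<psi> n) < \<mu> + e / 8" using M that by auto
      ultimately have "E ?d < e / 2 + \<mu> * l2sq ?d"
        using Ed by linarith
      then have "l2sq (grad ?d) < e / 2 + (\<mu> + K) * l2sq ?d"
        using E_ge[OF T(1)] unfolding distrib_right by linarith
      also have "(\<mu> + K) * l2sq ?d \<le> (\<bar>\<mu>\<bar> + K) * e1"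
        using N[of m n] that K by (intro mult_mono) auto
      finally show ?thesis
        using e1(2) by (simp add: test_function_minus(2)[OF \<psi>(1) \<psi>(1)])
    qed
    then show ?thesis by blast
  qed
  obtain \<phi> where \<phi>: "square_integrable \<phi>" "(\<lambda>n. l2sq (\<lambda>p. \<psi> n p - \<phi> p)) \<longlonglongrightarrow> 0"
    by (rule l2_complete[of \<psi>]) (use sq \<psi> r(2) in \<open>auto simp: \<psi>_def\<close>)
  obtain g where g: "square_integrable g" "(\<lambda>n. l2sq (\<lambda>p. grad (\<psi> n) p - g p)) \<longlonglongrightarrow> 0"
    by (rule l2_complete[of "\<lambda>n. grad (\<psi> n)"]) (use sq \<psi> cauchy_grad in auto)
  have const0: "(\<lambda>n. l2sq (\<lambda>p. f p - f p)) \<longlonglongrightarrow> 0" for f :: "real \<times> real \<Rightarrow> 'z::euclidean_space"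
    by (simp add: l2sq_def)
  have Bil_lim: "(\<lambda>n. Bil (\<psi>' n) (grad (\<psi>' n)) \<eta> (grad \<eta>)) \<longlonglongrightarrow> Bil \<phi>' g' \<eta> (grad \<eta>)"
    "(\<lambda>n. weighted_inner (\<lambda>_. 1) (\<psi>' n) \<eta>) \<longlonglongrightarrow> weighted_inner (\<lambda>_. 1) \<phi>' \<eta>"
    "(\<lambda>n. Bil \<phi>' g' (\<psi>' n) (grad (\<psi>' n))) \<longlonglongrightarrow> Bil \<phi>' g' \<phi>' g'"
    "(\<lambda>n. weighted_inner (\<lambda>_. 1) \<phi>' (\<psi>' n)) \<longlonglongrightarrow> l2sq \<phi>'"
    "(\<lambda>n. E (\<psi>' n)) \<longlonglongrightarrow> Bil \<phi>' g' \<phi>' g'" "(\<lambda>n. l2sq (\<psi>' n)) \<longlonglongrightarrow> l2sq \<phi>'"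
    if h: "\<And>n. ?T (\<psi>' n)" "square_integrable \<phi>'" "square_integrable g'" "(\<lambda>n. l2sq (\<lambda>p. \<psi>' n p - \<phi>' p)) \<longlonglongrightarrow> 0"
      "(\<lambda>n. l2sq (\<lambda>p. grad (\<psi>' n) p - g' p)) \<longlonglongrightarrow> 0" "?T \<eta>" for \<psi>' \<phi>' g' \<eta>
    unfolding E_def Bil_def weighted_inner_one[symmetric]
    unfolding weighted_inner_def
    by (intro tendsto_diff weighted_inner_tendsto[where K = K] weighted_inner_tendsto[where K = 1]
        h sq const0 bm bK om)+
  note lim = Bil_lim[OF \<psi>(1) \<phi>(1) g(1) \<phi>(2) g(2)]
  have nphi: "l2sq \<phi> = 1"
    using LIMSEQ_unique[OF lim(6)[OF \<psi>0(1)]] \<psi>(2) by auto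
  have EL: "Bil \<phi> g \<eta> (grad \<eta>) = \<mu> * weighted_inner (\<lambda>_. 1) \<phi> \<eta>" if \<eta>: "?T \<eta>" for \<eta>
  proof -
    define q where "q = Bil \<phi> g \<eta> (grad \<eta>) - \<mu> * weighted_inner (\<lambda>_. 1) \<phi> \<eta>"
    define Q where "Q = E \<eta> - \<mu> * l2sq \<eta>"
    \<comment> \<open>Minimality is known for test functions only, so the variation is taken at
      \<open>\<psi> n\<close> and the limit in \<open>n\<close> afterwards.\<close>
    have "0 \<le> 2 * t * q + t\<^sup>2 * Q" for t
    proof -
      have "0 \<le> (E (\<psi> n) - \<mu>) + 2 * t * (Bil (\<psi> n) (grad (\<psi> n)) \<eta> (grad \<eta>)
          - \<mu> * weighted_inner (\<lambda>_. 1) (\<psi> n) \<eta>) + t\<^sup>2 * Q" for n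
        using E_mu[OF test_function_lincomb[OF \<psi>(1)[of n] \<eta>, of 1 t]] \<psi>(2)[of n]
          E_lin[OF \<psi>(1)[of n] \<eta>, of 1 t]
        by (simp add: Q_def algebra_simps)
      moreover have "(\<lambda>n. (E (\<psi> n) - \<mu>) + 2 * t * (Bil (\<psi> n) (grad (\<psi> n)) \<eta> (grad \<eta>)
          - \<mu> * weighted_inner (\<lambda>_. 1) (\<psi> n) \<eta>) + t\<^sup>2 * Q) \<longlonglongrightarrow> (\<mu> - \<mu>) + 2 * t * q + t\<^sup>2 * Q"
        unfolding q_def by (intro tendsto_intros E\<psi> lim \<eta>)
      ultimately show ?thesis
        using LIMSEQ_le_const by fastforce
    qed
    \<comment> \<open>At this \<open>t\<close> the linear term outweighs the quadratic one unless
      \<open>q = 0\<close>; the summand 1 keeps the denominator positive.\<close>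
    from this[of "- q / (\<bar>Q\<bar> + 1)"] have "q = 0"
    proof (rule contrapos_pp)
      assume "q \<noteq> 0"
      let ?t = "- q / (\<bar>Q\<bar> + 1)"
      have "2 * ?t * q + ?t\<^sup>2 * Q \<le> 2 * ?t * q + ?t\<^sup>2 * (\<bar>Q\<bar> + 1)"
        by (intro add_left_mono mult_left_mono) auto
      also have "\<dots> = - (q\<^sup>2 / (\<bar>Q\<bar> + 1))"
      proof -
        have "2 * (- q / W) * q + (- q / W)\<^sup>2 * W = - (q\<^sup>2 / W)" if "W > 0" for W
          using that by (simp add: field_simps power2_eq_square)
        then show ?thesis by (simp add: add_nonneg_pos)
      qed
      also have "\<dots> < 0" using \<open>q \<noteq> 0\<close> by (simp add: add_nonneg_pos)
      finally show "\<not> 0 \<le> 2 * ?t * q + ?t\<^sup>2 * Q" by simp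
    qed
    then show ?thesis by (simp add: q_def)
  qed
  have set_eq: "(LINT p:\<Omega>|lborel. g' p \<bullet> grad \<eta> p - a p * \<phi>' p * \<eta> p) = Bil \<phi>' g' \<eta> (grad \<eta>)"
    "(LINT p:\<Omega>|lborel. \<phi>' p * \<eta> p) = weighted_inner (\<lambda>_. 1) \<phi>' \<eta>"
    if "?T \<eta>" "square_integrable \<phi>'" "square_integrable g'" for \<eta> \<phi>' g'
  proof -
    have z: "p \<notin> \<Omega> \<Longrightarrow> \<eta> p = 0" "p \<notin> \<Omega> \<Longrightarrow> grad \<eta> p = 0" for p
      using test_functionD(5-7)[OF that(1), of p] by (auto simp: grad_def zero_prod_def)
    have "(LINT p:\<Omega>|lborel. g' p \<bullet> grad \<eta> p - a p * \<phi>' p * \<eta> p)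
        = (LINT p|lborel. 1 * (g' p \<bullet> grad \<eta> p) - b p * (\<phi>' p \<bullet> \<eta> p))"
      unfolding set_lebesgue_integral_def
      by (intro Bochner_Integration.integral_cong refl) (auto simp: b_def indicator_def z)
    also have "\<dots> = Bil \<phi>' g' \<eta> (grad \<eta>)"
      unfolding Bil_def weighted_inner_def
      by (intro Bochner_Integration.integral_diff weighted_inner_integrable(1)[where K = K]
          weighted_inner_integrable(1)[where K = 1] bm bK om that sq)
    finally show "(LINT p:\<Omega>|lborel. g' p \<bullet> grad \<eta> p - a p * \<phi>' p * \<eta> p) = Bil \<phi>' g' \<eta> (grad \<eta>)" .
    show "(LINT p:\<Omega>|lborel. \<phi>' p * \<eta> p) = weighted_inner (\<lambda>_. 1) \<phi>' \<eta>"
      unfolding set_lebesgue_integral_def weighted_inner_def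
      by (intro Bochner_Integration.integral_cong refl) (auto simp: indicator_def z)
  qed
  have not_AE: "\<not> (AE p in lborel. \<phi>' p = 0) \<longleftrightarrow> l2sq \<phi>' > 0" if "square_integrable \<phi>'" for \<phi>' :: "real \<times> real \<Rightarrow> real"
  proof -
    have "l2sq \<phi>' = 0 \<longleftrightarrow> (AE p in lborel. \<phi>' p = 0)"
      using that unfolding l2sq_def square_integrable_def
      by (subst integral_nonneg_eq_0_iff_AE) auto
    then show ?thesis using l2sq_nonneg[of \<phi>'] by linarith
  qed
  have "H10_with_grad \<Omega> \<phi> g"
    unfolding H10_with_grad_def using \<phi> g \<psi>(1) unfolding l2sq_def by blast
  then have "dirichlet_eigenvalue \<Omega> a \<mu>"
    unfolding dirichlet_eigenvalue_def
    using not_AE[OF \<phi>(1)] nphi EL set_eq[OF _ \<phi>(1) g(1)]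
    by (intro exI[of _ \<phi>] exI[of _ g]) simp
  \<comment> \<open>The weak equation admits test functions only. Tested with approximants of the
    eigenfunction itself, it gives in the limit that the quotient of the form by the norm square is
    \<nu>, while the same approximants keep that quotient above \<mu>.\<close>
  moreover have "\<mu> \<le> \<nu>" if ev: "dirichlet_eigenvalue \<Omega> a \<nu>" for \<nu>
  proof -
    obtain \<phi>' g' where h: "H10_with_grad \<Omega> \<phi>' g'" "\<not> (AE p in lborel. \<phi>' p = 0)"
      and eq: "\<And>\<eta>. ?T \<eta> \<Longrightarrow> (LINT p:\<Omega>|lborel. g' p \<bullet> grad \<eta> p - a p * \<phi>' p * \<eta> p) = \<nu> * (LINT p:\<Omega>|lborel. \<phi>' p * \<eta> p)"
      using ev unfolding dirichlet_eigenvalue_def by blast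
    then obtain \<psi>' where h': "square_integrable \<phi>'" "square_integrable g'" "\<And>n. ?T (\<psi>' n)"
      "(\<lambda>n. l2sq (\<lambda>p. \<psi>' n p - \<phi>' p)) \<longlonglongrightarrow> 0" "(\<lambda>n. l2sq (\<lambda>p. grad (\<psi>' n) p - g' p)) \<longlonglongrightarrow> 0"
      unfolding H10_with_grad_def l2sq_def by blast
    note lim' = Bil_lim[OF h'(3,1,2,4,5) \<psi>0(1)]
    have "Bil \<phi>' g' (\<psi>' n) (grad (\<psi>' n)) = \<nu> * weighted_inner (\<lambda>_. 1) \<phi>' (\<psi>' n)" for n
      using eq[OF h'(3)[of n]] set_eq[OF h'(3)[of n] h'(1,2)] by simp
    then have "(\<lambda>n. \<nu> * weighted_inner (\<lambda>_. 1) \<phi>' (\<psi>' n)) \<longlonglongrightarrow> Bil \<phi>' g' \<phi>' g'"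
      using lim'(3) by simp
    then have "Bil \<phi>' g' \<phi>' g' = \<nu> * l2sq \<phi>'"
      by (rule LIMSEQ_unique) (intro tendsto_intros lim'(4))
    moreover have "\<mu> * l2sq \<phi>' \<le> Bil \<phi>' g' \<phi>' g'"
      by (rule LIMSEQ_le[OF tendsto_mult_left[OF lim'(6)] lim'(5)]) (use E_mu h'(3) in blast)
    moreover have "l2sq \<phi>' > 0" using not_AE[OF h'(1)] h(2) by simp
    ultimately show ?thesis by simp
  qed
  ultimately have "first_dirichlet_eigenvalue \<Omega> a \<mu>"
    by (simp add: first_dirichlet_eigenvalue_def)
  moreover have "\<mu> \<ge> 0" if KD: "K * (2 * D)\<^sup>2 \<le> 1"
  proof -
    have "0 \<le> E \<psi>" if "?T \<psi>" for \<psi>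
    proof -
      have "K * l2sq \<psi> \<le> K * ((2 * D)\<^sup>2 * l2sq (grad \<psi>))"
        using test_function_Poincare[OF that] K by (rule mult_left_mono)
      also have "\<dots> \<le> 1 * l2sq (grad \<psi>)"
        unfolding mult.assoc[symmetric] using KD by (intro mult_right_mono) auto
      finally show ?thesis using E_ge[OF that] by simp
    qed
    then show ?thesis
      unfolding \<mu>_def using \<psi>0 by (intro cInf_greatest) auto
  qed
  ultimately show thesis by (rule that)
qed

end

section \<open>The maximum principle and the torsion function\<close>

text \<open>If \<open>m\<close> were positive, \<open>g'\<close> would be positive just to the right
  of its zero \<open>t0\<close>, and the mean value theorem would give larger values of
  \<open>g\<close> there.\<close>

lemma local_max_second_derivative_nonpos:
  fixes g g' :: "real \<Rightarrow> real"
  assumes d: "d > 0" and g: "\<And>t. \<bar>t - t0\<bar> < d \<Longrightarrow> (g has_real_derivative g' t) (at t)"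
    and g': "(g' has_real_derivative m) (at t0)" and max: "\<And>t. \<bar>t - t0\<bar> < d \<Longrightarrow> g t \<le> g t0"
  shows "m \<le> 0"
proof (rule ccontr)
  assume "\<not> m \<le> 0"
  then have "m > 0" by simp
  have "g' t0 = 0"
    by (rule DERIV_local_max[OF g d]) (use d max in \<open>auto simp: abs_minus_commute\<close>)
  obtain d' where d': "d' > 0" "\<And>h. 0 < h \<Longrightarrow> h < d' \<Longrightarrow> g' t0 < g' (t0 + h)"
    using DERIV_pos_inc_right[OF g' \<open>m > 0\<close>] by blast
  define h where "h = min d d' / 2"
  have h: "h > 0" "h < d" "h < d'" using d d' by (auto simp: h_def)
  have "\<exists>z. t0 < z \<and> z < t0 + h \<and> g (t0 + h) - g t0 = (t0 + h - t0) * g' z"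
    by (rule MVT2) (use h in \<open>auto intro: g\<close>)
  then obtain z where z: "t0 < z" "z < t0 + h" "g (t0 + h) - g t0 = h * g' z" by auto
  have "g' z > 0"
    using d'(2)[of "z - t0"] z h \<open>g' t0 = 0\<close> by simp
  then have "h * g' z > 0" using h by simp
  then have "g (t0 + h) > g t0" using z by simp
  then show False using max[of "t0 + h"] h by auto
qed

lemma Ck_on_2_partials:
  assumes "open \<Omega>" "Ck_on 2 w \<Omega>" "p \<in> \<Omega>"
  shows "w differentiable (at p)" "D1 w differentiable (at p)" "D2 w differentiable (at p)"
proof -
  have "Ck_on (Suc (Suc 0)) w \<Omega>" using assms(2) by (simp add: numeral_2_eq_2)
  then show "w differentiable (at p)" "D1 w differentiable (at p)" "D2 w differentiable (at p)"
    using assms(3) by (cases p; simp)+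
qed

lemma local_max_Laplacian_nonpos:
  assumes "open \<Omega>" "Ck_on 2 w \<Omega>" "p \<in> \<Omega>" "\<And>q. q \<in> \<Omega> \<Longrightarrow> w q \<le> w p"
  shows "Laplacian w p \<le> 0"
proof -
  obtain d where d: "d > 0" "ball p d \<subseteq> \<Omega>" using assms(1,3) openE by blast
  have mem: "(t, snd p) \<in> \<Omega>" if "\<bar>t - fst p\<bar> < d" for t
    using that d(2) by (intro subsetD[OF d(2)]) (cases p, simp add: dist_Pair_Pair dist_real_def abs_minus_commute)
  have mem2: "(fst p, t) \<in> \<Omega>" if "\<bar>t - snd p\<bar> < d" for t
    using that d(2) by (intro subsetD[OF d(2)]) (cases p, simp add: dist_Pair_Pair dist_real_def abs_minus_commute)
  note P = Ck_on_2_partials[OF assms(1,2)]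
  note D = has_derivative_D1D2(3,4)[OF differentiable_has_derivative, simplified]
  have "D1 (D1 w) p \<le> 0"
  proof (rule local_max_second_derivative_nonpos[OF d(1)])
    show "((\<lambda>t. w (t, snd p)) has_real_derivative D1 w (t, snd p)) (at t)" if "\<bar>t - fst p\<bar> < d" for t
      using D(1)[OF P(1)[OF mem[OF that]]] by simp
    show "((\<lambda>t. D1 w (t, snd p)) has_real_derivative D1 (D1 w) p) (at (fst p))"
      using D(1)[OF P(2)[OF assms(3)]] by simp
    show "w (t, snd p) \<le> w (fst p, snd p)" if "\<bar>t - fst p\<bar> < d" for t
      using assms(4)[OF mem[OF that]] by simp
  qed
  moreover have "D2 (D2 w) p \<le> 0"
  proof (rule local_max_second_derivative_nonpos[OF d(1)])
    show "((\<lambda>t. w (fst p, t)) has_real_derivative D2 w (fst p, t)) (at t)" if "\<bar>t - snd p\<bar> < d" for t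
      using D(2)[OF P(1)[OF mem2[OF that]]] by simp
    show "((\<lambda>t. D2 w (fst p, t)) has_real_derivative D2 (D2 w) p) (at (snd p))"
      using D(2)[OF P(3)[OF assms(3)]] by simp
    show "w (fst p, t) \<le> w (fst p, snd p)" if "\<bar>t - snd p\<bar> < d" for t
      using assms(4)[OF mem2[OF that]] by simp
  qed
  ultimately show ?thesis by (simp add: Laplacian_def)
qed

text \<open>At an interior maximum the Laplacian is nonpositive, so its positivity pushes the
  maximum to the frontier. The barriers used below leave strict room, which is why this form is the
  one needed.\<close>

lemma strict_maximum_principle:
  assumes \<Omega>: "open \<Omega>" "bounded \<Omega>" and w: "Ck_on 2 w \<Omega>" "continuous_on (closure \<Omega>) w"
    and L: "\<And>p. p \<in> \<Omega> \<Longrightarrow> Laplacian w p > 0" and bd: "\<And>p. p \<in> frontier \<Omega> \<Longrightarrow> w p \<le> 0"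
    and p: "p \<in> \<Omega>"
  shows "w p \<le> 0"
proof -
  have "compact (closure \<Omega>)" using \<Omega>(2) by (simp add: compact_closure)
  then obtain q where q: "q \<in> closure \<Omega>" "\<And>y. y \<in> closure \<Omega> \<Longrightarrow> w y \<le> w q"
    using continuous_attains_sup[OF _ _ w(2)] p closure_subset by (metis empty_iff subsetD)
  have "q \<notin> \<Omega>"
  proof
    assume "q \<in> \<Omega>"
    then have "Laplacian w q \<le> 0"
      using q(2) closure_subset by (intro local_max_Laplacian_nonpos[OF \<Omega>(1) w(1)]) auto
    then show False using L[OF \<open>q \<in> \<Omega>\<close>] by simp
  qed
  then have "q \<in> frontier \<Omega>" using q(1) \<Omega>(1) by (simp add: frontier_def interior_open)
  then show ?thesis
    using bd[of q] q(2)[of p] p closure_subset by fastforce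
qed

lemma Laplacian_lincomb:
  assumes "open \<Omega>" "Ck_on 2 u \<Omega>" "Ck_on 2 v \<Omega>" "p \<in> \<Omega>"
  shows "Laplacian (\<lambda>q. a * u q + b * v q) p = a * Laplacian u p + b * Laplacian v p"
proof -
  note Pu = Ck_on_2_partials[OF assms(1,2)] and Pv = Ck_on_2_partials[OF assms(1,3)]
  have "D1 (D1 (\<lambda>q. a * u q + b * v q)) p = D1 (\<lambda>q. a * D1 u q + b * D1 v q) p"
    by (rule D1_D2_cong(1)[OF assms(1,4)]) (intro D1_D2_lincomb Pu Pv)
  moreover have "D2 (D2 (\<lambda>q. a * u q + b * v q)) p = D2 (\<lambda>q. a * D2 u q + b * D2 v q) p"
    by (rule D1_D2_cong(2)[OF assms(1,4)]) (intro D1_D2_lincomb Pu Pv)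
  ultimately show ?thesis
    by (simp add: Laplacian_def D1_D2_lincomb Pu Pv assms(4) algebra_simps)
qed

text \<open>\<open>U\<close> is the torsion function of the domain, known here in closed form as a
  polynomial. Its multiples have constant Laplacian and zero boundary values, hence are barriers
  from both sides.\<close>

locale torsion_domain =
  fixes \<Omega> :: "(real \<times> real) set" and U :: "real \<times> real \<Rightarrow> real"
  assumes op: "open \<Omega>" and bdd: "bounded \<Omega>" and ne: "\<Omega> \<noteq> {}"
    and poly: "real_polynomial_function U" and Lap: "\<And>p. Laplacian U p = - 1"
    and pos: "\<And>p. p \<in> \<Omega> \<Longrightarrow> U p > 0" and bd0: "\<And>p. p \<in> frontier \<Omega> \<Longrightarrow> U p = 0"
begin

lemma U_Ck: "Ck_on n U S"
  using real_polynomial_function_smooth[OF poly] by (simp add: smooth_fun_on_def)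

lemma U_cont: "continuous_on S U"
  using U_Ck[of 0] by simp

lemma comparison:
  assumes "Ck_on 2 u \<Omega>" "continuous_on (closure \<Omega>) u" "\<And>p. p \<in> frontier \<Omega> \<Longrightarrow> u p = 0" "p \<in> \<Omega>"
  shows "(\<And>p. p \<in> \<Omega> \<Longrightarrow> - Laplacian u p < s) \<Longrightarrow> u p \<le> s * U p"
    "(\<And>p. p \<in> \<Omega> \<Longrightarrow> - Laplacian u p > s) \<Longrightarrow> s * U p \<le> u p"
proof -
  have *: "a * u p + b * U p \<le> 0" if "\<And>p. p \<in> \<Omega> \<Longrightarrow> a * Laplacian u p - b > 0" for a b
  proof (rule strict_maximum_principle[OF op bdd])
    show "Ck_on 2 (\<lambda>p. a * u p + b * U p) \<Omega>"
      using op assms(1) U_Ck by (rule Ck_on_lincomb)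
    show "continuous_on (closure \<Omega>) (\<lambda>p. a * u p + b * U p)"
      by (intro continuous_intros assms U_cont)
    show "0 < Laplacian (\<lambda>p. a * u p + b * U p) p" if "p \<in> \<Omega>" for p
      using Laplacian_lincomb[OF op assms(1) U_Ck that, of a b] \<open>\<And>p. p \<in> \<Omega> \<Longrightarrow> a * Laplacian u p - b > 0\<close>[OF that]
      by (simp add: Lap)
  qed (use assms bd0 in auto)
  show "u p \<le> s * U p" if "\<And>p. p \<in> \<Omega> \<Longrightarrow> - Laplacian u p < s"
    using *[of 1 "- s"] that by fastforce
  show "s * U p \<le> u p" if "\<And>p. p \<in> \<Omega> \<Longrightarrow> - Laplacian u p > s"
    using *[of "-1" s] that by fastforce
qed

text \<open>Two passes of comparison: boundedness of \<open>f\<close> on \<open>{0..C}\<close> first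
  gives that \<open>u\<close> is of order \<open>lam\<close>; then \<open>f (u p)\<close> differs
  from \<open>f 0\<close> by the same order, and a second comparison leaves an error of order
  \<open>lam\<^sup>2\<close>.\<close>

lemma solution_asymptotics:
  assumes f: "\<And>t. t \<ge> 0 \<Longrightarrow> (f has_real_derivative f' t) (at t within {0..})" "continuous_on {0..} f'"
    and C: "C > 0"
  obtains B where "B > 0" "\<And>t. t \<in> {0..C} \<Longrightarrow> \<bar>f' t\<bar> \<le> B"
    "\<And>lam u p. \<lbrakk>lam > 0; classical_solution \<Omega> lam f u; \<forall>p\<in>\<Omega>. \<bar>u p\<bar> \<le> C; p \<in> \<Omega>\<rbrakk>
      \<Longrightarrow> \<bar>u p - lam * f 0 * U p\<bar> \<le> B * lam\<^sup>2"
proof -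
  have "compact (f' ` {0..C})"
    using f(2) by (intro compact_continuous_image continuous_on_subset[OF f(2)]) auto
  then have "bounded (f' ` {0..C})" by (rule compact_imp_bounded)
  then obtain L where L0: "L > 0" "\<forall>y\<in>f' ` {0..C}. norm y \<le> L"
    using bounded_pos by metis
  then have L: "\<bar>f' t\<bar> \<le> L" if "t \<in> {0..C}" for t using that by auto
  have Lip: "\<bar>f t - f 0\<bar> \<le> L * t" if t: "t \<in> {0..C}" for t
  proof (cases "t = 0")
    case False
    then have "\<exists>x\<in>{0<..<t}. f t - f 0 = (*) (f' x) (t - 0)"
      using t f(1) by (intro mvt_simple) (auto simp: has_field_derivative_def intro: has_derivative_subset[where s = "{0..}"])
    then obtain x where "x \<in> {0<..<t}" "f t - f 0 = f' x * t" by auto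
    then show ?thesis
      using L[of x] t by (auto simp: abs_mult intro!: mult_right_mono)
  qed simp
  have "compact (U ` closure \<Omega>)"
    using bdd by (intro compact_continuous_image U_cont) (simp add: compact_closure)
  then have "bounded (U ` closure \<Omega>)" by (rule compact_imp_bounded)
  then obtain V where V0: "V > 0" "\<forall>y\<in>U ` closure \<Omega>. norm y \<le> V"
    using bounded_pos by metis
  then have V: "U p \<le> V" if "p \<in> \<Omega>" for p
    using that closure_subset by fastforce
  \<comment> \<open>An upper bound for \<open>f\<close> on \<open>{0..C}\<close>; the summand 1
    provides the strictness that \<open>comparison\<close> asks for.\<close>
  define M where "M = \<bar>f 0\<bar> + L * C + 1"
  have M: "M > 0" using L0 C by (simp add: M_def add_nonneg_pos)
  \<comment> \<open>The first pass bounds \<open>u\<close> by \<open>lam * M * V\<close>, so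
    \<open>f (u q)\<close> moves by at most \<open>lam * (L * M * V)\<close>; the 1 again gives
    strictness.\<close>
  define \<tau> where "\<tau> = L * M * V + 1"
  have \<tau>: "\<tau> > 0" using L0 M V0 by (simp add: \<tau>_def add_pos_pos)
  define B where "B = max L (\<tau> * V)"
  have "B > 0" using L0 by (simp add: B_def)
  moreover have "\<bar>f' t\<bar> \<le> B" if "t \<in> {0..C}" for t
    using L[OF that] by (simp add: B_def)
  moreover have "\<bar>u p - lam * f 0 * U p\<bar> \<le> B * lam\<^sup>2"
    if lam: "lam > 0" and sol: "classical_solution \<Omega> lam f u" and uC: "\<forall>p\<in>\<Omega>. \<bar>u p\<bar> \<le> C" and p: "p \<in> \<Omega>"
    for lam u p
  proof -
    have u: "Ck_on 2 u \<Omega>" "continuous_on (closure \<Omega>) u" "\<And>p. p \<in> frontier \<Omega> \<Longrightarrow> u p = 0"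
      and eq: "\<And>p. p \<in> \<Omega> \<Longrightarrow> - Laplacian u p = lam * f (u p)" and up: "\<And>p. p \<in> \<Omega> \<Longrightarrow> u p > 0"
      using sol by (auto simp: classical_solution_def)
    have ur: "u p \<in> {0..C}" if "p \<in> \<Omega>" for p
      using up[OF that] uC that by force
    have 1: "u q \<le> lam * M * V" if q: "q \<in> \<Omega>" for q
    proof -
      have "u q \<le> (lam * M) * U q"
      proof (rule comparison(1)[OF u q])
        fix p assume p: "p \<in> \<Omega>"
        have "L * u p \<le> L * C" using ur[OF p] L0 by simp
        then have "f (u p) < M"
          using Lip[OF ur[OF p]] by (simp add: M_def)
        then show "- Laplacian u p < lam * M"
          using eq[OF p] lam by simp
      qed
      also have "\<dots> \<le> lam * M * V"
        using V[OF q] lam M by (intro mult_left_mono) auto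
      finally show ?thesis .
    qed
    have 2: "\<bar>f (u q) - f 0\<bar> < lam * \<tau>" if q: "q \<in> \<Omega>" for q
    proof -
      have "\<bar>f (u q) - f 0\<bar> \<le> L * u q" by (rule Lip[OF ur[OF q]])
      also have "\<dots> \<le> L * (lam * M * V)" using 1[OF q] L0 by simp
      also have "\<dots> < lam * \<tau>" using lam by (simp add: \<tau>_def algebra_simps)
      finally show ?thesis .
    qed
    have "u p \<le> (lam * (f 0 + lam * \<tau>)) * U p"
    proof (rule comparison(1)[OF u p])
      fix q assume q: "q \<in> \<Omega>"
      have "f (u q) < f 0 + lam * \<tau>" using 2[OF q] by linarith
      then show "- Laplacian u q < lam * (f 0 + lam * \<tau>)"
        using eq[OF q] lam by simp
    qed
    moreover have "(lam * (f 0 - lam * \<tau>)) * U p \<le> u p"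
    proof (rule comparison(2)[OF u p])
      fix q assume q: "q \<in> \<Omega>"
      have "f 0 - lam * \<tau> < f (u q)" using 2[OF q] by linarith
      then show "lam * (f 0 - lam * \<tau>) < - Laplacian u q"
        using eq[OF q] lam by simp
    qed
    ultimately have "\<bar>u p - lam * f 0 * U p\<bar> \<le> lam\<^sup>2 * \<tau> * U p"
      by (simp add: abs_le_iff algebra_simps power2_eq_square)
    also have "\<dots> \<le> lam\<^sup>2 * \<tau> * V"
      using V[OF p] \<tau> by (intro mult_left_mono) auto
    also have "\<dots> \<le> lam\<^sup>2 * B"
      by (simp add: B_def mult.assoc mult_left_mono)
    finally show ?thesis by (simp add: mult.commute)
  qed
  ultimately show thesis by (rule that)
qed

end

section \<open>Components of superlevel sets\<close>

text \<open>The projection to the first coordinate of a component is an interval. A component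
  containing two peaks would therefore meet the vertical line between them, where \<open>u\<close>
  does not exceed \<open>c\<close>. Each component then carries its own maximum.\<close>

lemma P1_of_separated_peaks:
  fixes \<xi> m :: "nat \<Rightarrow> real"
  assumes \<Omega>: "open \<Omega>" "bounded \<Omega>" and u: "continuous_on (closure \<Omega>) u"
    and bd: "\<And>p. p \<in> frontier \<Omega> \<Longrightarrow> u p \<le> c" and k: "k \<ge> 1"
    and m: "\<And>j. j \<in> {1..k} \<Longrightarrow> (m j, 0) \<in> \<Omega> \<and> u (m j, 0) > c"
    and \<xi>: "\<And>j p. j \<in> {1..<k} \<Longrightarrow> p \<in> \<Omega> \<Longrightarrow> fst p = \<xi> j \<Longrightarrow> u p \<le> c"
    and sep: "\<And>i j. i \<in> {1..k} \<Longrightarrow> j \<in> {1..k} \<Longrightarrow> i < j \<Longrightarrow> m i < \<xi> i \<and> \<xi> i < m j"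
  shows "P1 k \<Omega> u"
proof -
  define S where "S = {p \<in> \<Omega>. u p > c}"
  define K where "K j = connected_component_set S (m j, 0)" for j
  have "continuous_on \<Omega> u" using u closure_subset continuous_on_subset by blast
  then have opS: "open S"
    using continuous_open_preimage[OF _ \<Omega>(1) open_greaterThan, of u c]
    by (auto simp: S_def vimage_def Int_def conj_commute)
  have mS: "(m j, 0) \<in> S" if "j \<in> {1..k}" for j
    using m[OF that] by (simp add: S_def)
  have KS: "K j \<subseteq> S" "connected (K j)" for j
    by (auto simp: K_def connected_component_subset)
  have mK: "(m j, 0) \<in> K j" if "j \<in> {1..k}" for j
    using mS[OF that] by (simp add: K_def)
  have disj: "K i \<inter> K j = {}" if ij: "i \<in> {1..k}" "j \<in> {1..k}" "i < j" for i j
  proof (rule ccontr)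
    assume "K i \<inter> K j \<noteq> {}"
    then have "K i = K j"
      unfolding K_def by (metis connected_component_nonoverlap)
    then have "(m i, 0) \<in> K i" "(m j, 0) \<in> K i" using mK ij by auto
    then have "m i \<in> fst ` K i" "m j \<in> fst ` K i" by force+
    moreover have "connected (fst ` K i)"
      by (intro connected_continuous_image KS continuous_intros)
    ultimately have "\<xi> i \<in> fst ` K i"
      using sep[OF ij] by (meson connected_contains_Icc atLeastAtMost_iff less_imp_le subsetD)
    then obtain p where "p \<in> S" "fst p = \<xi> i" using KS(1)[of i] by (metis imageE subsetD)
    then show False using \<xi>[of i p] ij by (auto simp: S_def)
  qed
  have injK: "i = j" if "i \<in> {1..k}" "j \<in> {1..k}" "K i \<inter> K j \<noteq> {}" for i j
    using disj[of i j] disj[of j i] that by (metis Int_commute linorder_neqE_nat)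
  have "K ` {1..k} \<subseteq> components S"
    using mS by (auto simp: K_def components_def)
  moreover have "inj_on K {1..k}"
    using injK mK by (intro inj_onI) (metis Int_absorb empty_iff)
  ultimately have "at_least k (components S)"
    unfolding at_least_def by (intro exI[of _ "K ` {1..k}"]) (simp add: card_image)
  moreover have "S \<noteq> {}" using mS[of 1] k by auto
  moreover have "at_least k (local_max_points \<Omega> u)"
  proof -
    have "\<exists>p\<in>K j. p \<in> local_max_points \<Omega> u" if j: "j \<in> {1..k}" for j
    proof -
      have sub: "closure (K j) \<subseteq> closure \<Omega>"
        using KS(1)[of j] by (intro closure_mono) (auto simp: S_def)
      have cK: "compact (closure (K j))"
        using sub \<Omega>(2) by (metis bounded_closure bounded_subset closed_closure compact_eq_bounded_closed)
      have uK: "continuous_on (closure (K j)) u" by (rule continuous_on_subset[OF u sub])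
      have mKc: "(m j, 0) \<in> closure (K j)" by (rule subsetD[OF closure_subset mK[OF j]])
      from mKc have "closure (K j) \<noteq> {}" by (metis empty_iff)
      from continuous_attains_sup[OF cK this uK]
      obtain p where p: "p \<in> closure (K j)" "\<And>q. q \<in> closure (K j) \<Longrightarrow> u q \<le> u p"
        by metis
      have "u p > c" using p(2)[OF mKc] m[OF j] by simp
      then have "p \<in> \<Omega>"
        using bd[of p] p(1) sub \<Omega>(1) by (auto simp: frontier_def interior_open)
      with \<open>u p > c\<close> have pS: "p \<in> S" by (simp add: S_def)
      \<comment> \<open>The maximum is sought on the compact closure of the component. It lies in
        \<open>S\<close>, and adding a closure point keeps the component connected, so by maximality
        the point belongs to it.\<close>
      have "connected (insert p (K j))"
        by (rule connected_intermediate_closure[OF KS(2)]) (use p(1) closure_subset in auto)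
      then have "insert p (K j) \<subseteq> K j"
        unfolding K_def using pS KS(1)[of j] mK[OF j]
        by (intro connected_component_maximal) (auto simp: K_def)
      then have pK: "p \<in> K j" by simp
      have "open (K j)" unfolding K_def by (rule open_connected_component[OF opS])
      then obtain r where "r > 0" "ball p r \<subseteq> K j" using pK openE by blast
      then have "p \<in> local_max_points \<Omega> u"
        unfolding local_max_points_def using \<open>p \<in> \<Omega>\<close> p(2) closure_subset by blast
      with pK show ?thesis by blast
    qed
    then obtain P where P: "\<And>j. j \<in> {1..k} \<Longrightarrow> P j \<in> K j \<and> P j \<in> local_max_points \<Omega> u" by metis
    then have "inj_on P {1..k}"
      using injK by (intro inj_onI) (metis IntI empty_iff)
    then show ?thesis
      unfolding at_least_def using P by (intro exI[of _ "P ` {1..k}"]) (auto simp: card_image)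
  qed
  ultimately show ?thesis
    unfolding P1_def S_def by blast
qed

theorem (in torsion_domain) small_solutions:
  fixes \<xi> m :: "nat \<Rightarrow> real" and f f' :: "real \<Rightarrow> real"
  assumes f: "\<And>t. t \<ge> 0 \<Longrightarrow> (f has_real_derivative f' t) (at t within {0..})" "continuous_on {0..} f'"
    and f0: "f 0 > 0" and C: "C > 0" and k: "k \<ge> 1" and \<eta>: "\<eta> > 0"
    and m: "\<And>j. j \<in> {1..k} \<Longrightarrow> (m j, 0) \<in> \<Omega> \<and> U (m j, 0) \<ge> 1 / 2 + \<eta>"
    and \<xi>: "\<And>j p. j \<in> {1..<k} \<Longrightarrow> p \<in> \<Omega> \<Longrightarrow> fst p = \<xi> j \<Longrightarrow> U p \<le> 1 / 2"
    and sep: "\<And>i j. i \<in> {1..k} \<Longrightarrow> j \<in> {1..k} \<Longrightarrow> i < j \<Longrightarrow> m i < \<xi> i \<and> \<xi> i < m j"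
  shows "\<exists>lam_bar>0. \<forall>lam\<in>{0<..<lam_bar}. \<forall>u.
    classical_solution \<Omega> lam f u \<and> (\<forall>p\<in>\<Omega>. \<bar>u p\<bar> \<le> C) \<longrightarrow> semi_stable \<Omega> lam f' u \<and> P1 k \<Omega> u"
proof -
  obtain B where B: "B > 0" "\<And>t. t \<in> {0..C} \<Longrightarrow> \<bar>f' t\<bar> \<le> B"
    "\<And>lam u p. \<lbrakk>lam > 0; classical_solution \<Omega> lam f u; \<forall>p\<in>\<Omega>. \<bar>u p\<bar> \<le> C; p \<in> \<Omega>\<rbrakk>
      \<Longrightarrow> \<bar>u p - lam * f 0 * U p\<bar> \<le> B * lam\<^sup>2"
    using solution_asymptotics[OF f C] by blast
  obtain R where R: "R > 0" "\<Omega> \<subseteq> ball 0 R"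
    using bounded_subset_ballD[OF bdd] by blast
  have box: "\<Omega> \<subseteq> {-R<..<R} \<times> {-R<..<R}"
  proof
    fix p assume "p \<in> \<Omega>"
    then have "norm p < R" using R(2) by auto
    moreover have "\<bar>fst p\<bar> \<le> norm p" "\<bar>snd p\<bar> \<le> norm p"
      using norm_fst_le[of "fst p" "snd p"] norm_snd_le[of "snd p" "fst p"] by simp_all
    ultimately show "p \<in> {-R<..<R} \<times> {-R<..<R}"
      by (cases p) (auto simp: abs_less_iff)
  qed
  \<comment> \<open>The first bound lets Poincare's inequality absorb the potential; the second
    keeps the asymptotic error below a quarter of the peak excess.\<close>
  define lb where "lb = min (1 / (B * (2 * R)\<^sup>2)) (f 0 * \<eta> / (4 * B))"
  have "lb > 0" using B(1) R(1) f0 \<eta> by (simp add: lb_def)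
  moreover have "semi_stable \<Omega> lam f' u \<and> P1 k \<Omega> u"
    if lam: "lam \<in> {0<..<lb}" and sol: "classical_solution \<Omega> lam f u" and uC: "\<forall>p\<in>\<Omega>. \<bar>u p\<bar> \<le> C" for lam u
  proof
    have l0: "lam > 0" and l1: "lam * B * (2 * R)\<^sup>2 \<le> 1" and l2: "lam * B < f 0 * \<eta> / 4"
      using lam B(1) R(1) by (auto simp: lb_def field_simps)
    have u: "Ck_on 2 u \<Omega>" "continuous_on (closure \<Omega>) u" "\<And>p. p \<in> frontier \<Omega> \<Longrightarrow> u p = 0"
      and up: "\<And>p. p \<in> \<Omega> \<Longrightarrow> u p > 0"
      using sol by (auto simp: classical_solution_def)
    have ur: "u p \<in> {0..C}" if "p \<in> \<Omega>" for p
      using up[OF that] uC that by force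
    have "continuous_on \<Omega> u" using u(2) closure_subset continuous_on_subset by blast
    then have c: "continuous_on \<Omega> (\<lambda>p. lam * f' (u p))"
      by (intro continuous_intros continuous_on_compose2[OF f(2)]) (use ur in auto)
    have b: "\<bar>lam * f' (u p)\<bar> \<le> lam * B" if "p \<in> \<Omega>" for p
      using B(2)[OF ur[OF that]] l0 by (simp add: abs_mult)
    obtain \<mu> where "first_dirichlet_eigenvalue \<Omega> (\<lambda>p. lam * f' (u p)) \<mu>" "lam * B * (2 * R)\<^sup>2 \<le> 1 \<Longrightarrow> \<mu> \<ge> 0"
      using first_dirichlet_eigenvalue_exists[OF R(1) box op ne c b] l0 B(1) by (metis less_imp_le mult_pos_pos)
    then show "semi_stable \<Omega> lam f' u"
      using l1 by (auto simp: semi_stable_def)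
    have asy: "\<bar>u p - lam * f 0 * U p\<bar> \<le> lam * (f 0 * \<eta> / 4)" if "p \<in> \<Omega>" for p
    proof -
      have "\<bar>u p - lam * f 0 * U p\<bar> \<le> lam * (lam * B)"
        using B(3)[OF l0 sol uC that] by (simp add: power2_eq_square mult.commute mult.left_commute)
      also have "\<dots> \<le> lam * (f 0 * \<eta> / 4)" using l0 l2 by (intro mult_left_mono) auto
      finally show ?thesis .
    qed
    \<comment> \<open>Halfway between the height of the separating lines and that of the peaks; the
      error is a quarter of the gap on either side.\<close>
    define c where "c = lam * f 0 * (1 / 2) + lam * (f 0 * \<eta> / 2)"
    have c: "c > 0" using l0 f0 \<eta> by (simp add: c_def add_pos_pos)
    have lf: "lam * f 0 > 0" "lam * (f 0 * \<eta>) > 0" using l0 f0 \<eta> by simp_all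
    show "P1 k \<Omega> u"
    proof (rule P1_of_separated_peaks[OF op bdd u(2) _ k _ _ sep])
      show "u p \<le> c" if "p \<in> frontier \<Omega>" for p using u(3)[OF that] c by simp
      show "u p \<le> c" if "j \<in> {1..<k}" "p \<in> \<Omega>" "fst p = \<xi> j" for j p
      proof -
        have "lam * f 0 * U p \<le> lam * f 0 * (1 / 2)"
          using \<xi>[OF that] lf by (intro mult_left_mono) auto
        then show ?thesis using asy[OF that(2)] lf(2) unfolding c_def abs_le_iff by simp
      qed
      show "(m j, 0) \<in> \<Omega> \<and> c < u (m j, 0)" if "j \<in> {1..k}" for j
      proof -
        have "lam * f 0 * (1 / 2 + \<eta>) \<le> lam * f 0 * U (m j, 0)"
          using m[OF that] lf by (intro mult_left_mono) auto
        then show ?thesis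
          using asy[of "(m j, 0)"] m[OF that] lf(2) unfolding c_def abs_le_iff by (simp add: algebra_simps)
      qed
    qed auto
  qed
  ultimately show ?thesis by blast
qed

section \<open>Curvature of a regular level curve\<close>

text \<open>\<open>B\<close> localises: the positivity set of \<open>U\<close> in the whole plane
  may have other parts, and only the one inside \<open>B\<close> is the domain.\<close>

locale regular_level_domain =
  fixes \<Omega> B :: "(real \<times> real) set" and U Ux Uy Uxx Uxy Uyy :: "real \<times> real \<Rightarrow> real"
  assumes opB: "open B" and \<Omega>_eq: "\<Omega> = {p \<in> B. U p > 0}" and frontier_eq: "frontier \<Omega> = {p \<in> B. U p = 0}"
    and dU: "\<And>p. (U has_derivative (\<lambda>h. Ux p * fst h + Uy p * snd h)) (at p)"
    and dUx: "\<And>p. (Ux has_derivative (\<lambda>h. Uxx p * fst h + Uxy p * snd h)) (at p)"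
    and dUy: "\<And>p. (Uy has_derivative (\<lambda>h. Uxy p * fst h + Uyy p * snd h)) (at p)"
    and cont: "continuous_on UNIV Uxx" "continuous_on UNIV Uxy" "continuous_on UNIV Uyy"
    and regular: "\<And>p. p \<in> frontier \<Omega> \<Longrightarrow> Ux p \<noteq> 0 \<or> Uy p \<noteq> 0"
begin

text \<open>Minus the Hessian of \<open>U\<close> evaluated twice on the tangent vector
  \<open>(Uy p, - Ux p)\<close>.\<close>

definition curv_num :: "real \<times> real \<Rightarrow> real" where
  "curv_num p = - (Uxx p * (Uy p)\<^sup>2 - 2 * Uxy p * Ux p * Uy p + Uyy p * (Ux p)\<^sup>2)"

definition grad_norm :: "real \<times> real \<Rightarrow> real" where
  "grad_norm p = sqrt ((Ux p)\<^sup>2 + (Uy p)\<^sup>2)"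

lemma grad_norm_pos: "p \<in> frontier \<Omega> \<Longrightarrow> grad_norm p > 0"
  using regular[of p] by (auto simp: grad_norm_def sum_power2_gt_zero_iff)

lemma chain:
  assumes F: "\<And>p. (F has_derivative (\<lambda>h. Fx p * fst h + Fy p * snd h)) (at p)"
    and \<gamma>: "(\<gamma> has_vector_derivative v) (at t)"
  shows "((\<lambda>t. F (\<gamma> t)) has_real_derivative Fx (\<gamma> t) * fst v + Fy (\<gamma> t) * snd v) (at t)"
proof -
  have "((\<lambda>t. F (\<gamma> t)) has_derivative (\<lambda>s. Fx (\<gamma> t) * fst (s *\<^sub>R v) + Fy (\<gamma> t) * snd (s *\<^sub>R v))) (at t)"
    by (rule has_derivative_compose[OF \<gamma>[unfolded has_vector_derivative_def] F])
  moreover have "(\<lambda>s. Fx (\<gamma> t) * fst (s *\<^sub>R v) + Fy (\<gamma> t) * snd (s *\<^sub>R v))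
      = (*) (Fx (\<gamma> t) * fst v + Fy (\<gamma> t) * snd v)"
    by (auto simp: fun_eq_iff algebra_simps)
  ultimately show ?thesis by (simp add: has_field_derivative_def)
qed

lemma vector_derivative_fst_snd:
  assumes "((\<gamma> :: real \<Rightarrow> real \<times> real) has_vector_derivative v) (at t)"
  shows "((\<lambda>t. fst (\<gamma> t)) has_real_derivative fst v) (at t)" "((\<lambda>t. snd (\<gamma> t)) has_real_derivative snd v) (at t)"
proof -
  show "((\<lambda>t. fst (\<gamma> t)) has_real_derivative fst v) (at t)"
    using has_derivative_fst[OF assms[unfolded has_vector_derivative_def]]
    by (simp add: has_field_derivative_def mult_commute_abs)
  show "((\<lambda>t. snd (\<gamma> t)) has_real_derivative snd v) (at t)"
    using has_derivative_snd[OF assms[unfolded has_vector_derivative_def]]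
    by (simp add: has_field_derivative_def mult_commute_abs)
qed

text \<open>Differentiating \<open>U (\<gamma> t) = 0\<close> twice determines the normal part of
  the acceleration. The condition that the domain lies to the left fixes the orientation, so every
  admissible parametrisation gives the same value.\<close>

lemma boundary_curvature_unique:
  assumes p: "p \<in> frontier \<Omega>" and c: "has_boundary_curvature \<Omega> p \<kappa>"
  shows "\<kappa> = curv_num p / grad_norm p ^ 3"
proof -
  obtain \<gamma> \<gamma>' \<gamma>'' r where r: "r > 0" and \<gamma>0: "\<gamma> 0 = p" and nz: "\<gamma>' 0 \<noteq> 0"
    and \<gamma>: "\<And>t. t \<in> {-r<..<r} \<Longrightarrow> \<gamma> t \<in> frontier \<Omega>"
    "\<And>t. t \<in> {-r<..<r} \<Longrightarrow> (\<gamma> has_vector_derivative \<gamma>' t) (at t)"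
    "\<And>t. t \<in> {-r<..<r} \<Longrightarrow> (\<gamma>' has_vector_derivative \<gamma>'' t) (at t)"
    and side: "\<forall>\<^sub>F s in at_right 0. p + s *\<^sub>R (- snd (\<gamma>' 0), fst (\<gamma>' 0)) \<in> \<Omega>"
    and \<kappa>: "\<kappa> = (fst (\<gamma>' 0) * snd (\<gamma>'' 0) - snd (\<gamma>' 0) * fst (\<gamma>'' 0)) / norm (\<gamma>' 0) ^ 3"
    using c unfolding has_boundary_curvature_def by blast
  have U0: "U (\<gamma> t) = 0" if "t \<in> {-r<..<r}" for t
    using \<gamma>(1)[OF that] frontier_eq by auto
  have I0: "open {-r<..<r}" "0 \<in> {-r<..<r}" using r by auto
  have constd: "D = 0" if "(f has_real_derivative D) (at t)" "t \<in> {-r<..<r}" "\<And>s. s \<in> {-r<..<r} \<Longrightarrow> f s = 0"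
    for f D t
  proof -
    have "((\<lambda>_. 0) has_real_derivative D) (at t)"
      using has_field_derivative_transform_within_open[OF that(1) I0(1) that(2,3)] by simp
    then show ?thesis using DERIV_const DERIV_unique by blast
  qed
  define z where "z t = Ux (\<gamma> t) * fst (\<gamma>' t) + Uy (\<gamma> t) * snd (\<gamma>' t)" for t
  have z0: "z t = 0" if "t \<in> {-r<..<r}" for t
    using constd[OF chain[OF dU \<gamma>(2)[OF that]] that U0] by (simp add: z_def)
  obtain v1 v2 where v: "\<gamma>' 0 = (v1, v2)" by fastforce
  obtain w1 w2 where w: "\<gamma>'' 0 = (w1, w2)" by fastforce
  have "(z has_real_derivative (Uxx p * v1 + Uxy p * v2) * v1 + w1 * Ux p
      + ((Uxy p * v1 + Uyy p * v2) * v2 + w2 * Uy p)) (at 0)"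
    unfolding z_def
    using DERIV_add[OF DERIV_mult[OF chain[OF dUx \<gamma>(2)[OF I0(2)]] vector_derivative_fst_snd(1)[OF \<gamma>(3)[OF I0(2)]]]
        DERIV_mult[OF chain[OF dUy \<gamma>(2)[OF I0(2)]] vector_derivative_fst_snd(2)[OF \<gamma>(3)[OF I0(2)]]]]
    by (simp add: \<gamma>0 v w)
  from constd[OF this I0(2) z0]
  have 2: "(Uxx p * v1 + Uxy p * v2) * v1 + w1 * Ux p + ((Uxy p * v1 + Uyy p * v2) * v2 + w2 * Uy p) = 0" .
  have 1: "Ux p * v1 + Uy p * v2 = 0" using z0[OF I0(2)] by (simp add: z_def \<gamma>0 v)
  \<comment> \<open>Otherwise \<open>U\<close> would decrease along the left normal, although these
    points lie in the domain.\<close>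
  have 3: "Ux p * (- v2) + Uy p * v1 \<ge> 0"
  proof (rule ccontr)
    assume neg: "\<not> ?thesis"
    have "((\<lambda>s. p + s *\<^sub>R (- v2, v1)) has_vector_derivative (- v2, v1)) (at 0)"
      by (auto intro!: derivative_eq_intros)
    from chain[OF dU this]
    have "((\<lambda>s. U (p + s *\<^sub>R (- v2, v1))) has_real_derivative Ux p * (- v2) + Uy p * v1) (at 0)"
      by (simp add: zero_prod_def[symmetric])
    from DERIV_neg_dec_right[OF this] neg
    obtain d where d: "d > 0" "\<And>h. 0 < h \<Longrightarrow> h < d \<Longrightarrow> U (p + h *\<^sub>R (- v2, v1)) < U p"
      by (auto simp: zero_prod_def[symmetric])
    have "\<forall>\<^sub>F s in at_right (0::real). 0 < s \<and> s < d"
      using d(1) eventually_at_right_less by (auto simp: eventually_at_right)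
    with side have "\<forall>\<^sub>F s in at_right (0::real). False"
    proof eventually_elim
      case (elim s)
      then have "U (p + s *\<^sub>R (- v2, v1)) > 0" "U (p + s *\<^sub>R (- v2, v1)) < U p"
        using d(2)[of s] by (auto simp: \<Omega>_eq v)
      moreover have "U p = 0" using p frontier_eq by auto
      ultimately show ?case by simp
    qed
    then show False by simp
  qed
  have vpos: "v1\<^sup>2 + v2\<^sup>2 > 0" using nz by (auto simp: v zero_prod_def sum_power2_gt_zero_iff)
  \<comment> \<open>The gradient is orthogonal to the velocity, hence \<open>c\<close> times the
    left normal \<open>(- v2, v1)\<close>.\<close>
  define c where "c = (Ux p * (- v2) + Uy p * v1) / (v1\<^sup>2 + v2\<^sup>2)"
  have cn: "c * (v1\<^sup>2 + v2\<^sup>2) = Ux p * (- v2) + Uy p * v1" using vpos by (simp add: c_def)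
  have "(v1\<^sup>2 + v2\<^sup>2) * Ux p = (v1\<^sup>2 + v2\<^sup>2) * (- c * v2)" "(v1\<^sup>2 + v2\<^sup>2) * Uy p = (v1\<^sup>2 + v2\<^sup>2) * (c * v1)"
    using 1 cn by algebra+
  then have Uc: "Ux p = - c * v2" "Uy p = c * v1"
    using mult_left_cancel[OF less_imp_neq[OF vpos, symmetric]] by blast+
  have c0: "c \<ge> 0" using 3 vpos by (simp add: c_def)
  have gp: "grad_norm p > 0" by (rule grad_norm_pos[OF p])
  have gn: "grad_norm p = c * norm (\<gamma>' 0)"
  proof -
    have "(Ux p)\<^sup>2 + (Uy p)\<^sup>2 = c\<^sup>2 * (v1\<^sup>2 + v2\<^sup>2)"
      by (simp add: Uc power_mult_distrib algebra_simps)
    then show ?thesis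
      using c0 by (simp add: grad_norm_def v norm_Pair real_sqrt_mult)
  qed
  then have cpos: "c > 0" using gp c0 by (cases "c = 0") auto
  have "curv_num p = c ^ 3 * (v1 * w2 - v2 * w1)"
    using 2 unfolding curv_num_def Uc by algebra
  then show ?thesis
    using cpos unfolding \<kappa> gn by (simp add: v w power_mult_distrib)
qed

text \<open>The map \<Phi> pairs a tangential coordinate with \<open>U\<close>; its local inverse
  restricted to second coordinate 0 parametrises the boundary. The tangent \<open>(T1, T2)\<close>
  is chosen with the gradient to its left, as the orientation requires.\<close>

lemma boundary_curvature_exists:
  assumes p: "p \<in> frontier \<Omega>"
  shows "\<exists>\<kappa>. has_boundary_curvature \<Omega> p \<kappa>"
proof -
  define T1 where "T1 = Uy p"
  define T2 where "T2 = - Ux p"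
  have pB: "p \<in> B" "U p = 0" using p frontier_eq by auto
  have Tpos: "T1\<^sup>2 + T2\<^sup>2 > 0" using regular[OF p] by (auto simp: T1_def T2_def sum_power2_gt_zero_iff)
  define \<Phi> where "\<Phi> q = (T1 * (fst q - fst p) + T2 * (snd q - snd p), U q)" for q
  define L where "L q h = (T1 * fst h + T2 * snd h, Ux q * fst h + Uy q * snd h)" for q and h :: "real \<times> real"
  have bL: "bounded_linear (L q)" for q
    unfolding L_def by (intro bounded_linear_Pair bounded_linear_add bounded_linear_mult_right
        bounded_linear_fst bounded_linear_snd bounded_linear_compose[OF bounded_linear_mult_right])
  define \<Phi>' where "\<Phi>' q = Blinfun (L q)" for q
  have ap: "blinfun_apply (\<Phi>' q) = L q" for q
    unfolding \<Phi>'_def by (rule bounded_linear_Blinfun_apply[OF bL])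
  have d\<Phi>: "(\<Phi> has_derivative blinfun_apply (\<Phi>' q)) (at q)" for q
    unfolding ap \<Phi>_def L_def
    by (rule has_derivative_Pair[OF _ dU]) (auto intro!: derivative_eq_intros)
  have cg: "continuous_on UNIV U" "continuous_on UNIV Ux" "continuous_on UNIV Uy"
    using dU dUx dUy by (meson continuous_at_imp_continuous_on has_derivative_continuous)+
  have c\<Phi>: "continuous_on UNIV \<Phi>'"
    by (rule continuous_on_blinfun_componentwise)
      (auto simp: ap L_def intro!: continuous_intros cg)
  \<comment> \<open>The Jacobian determinant of \<Phi>; at \<open>p\<close> it is the squared length
    of the gradient.\<close>
  define J where "J q = T1 * Uy q - T2 * Ux q" for q
  define Q where "Q = {q \<in> B. J q \<noteq> 0}"
  have cJ: "continuous_on UNIV J" unfolding J_def by (intro continuous_intros cg)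
  have opQ: "open Q"
    unfolding Q_def using opB cJ by (auto intro!: open_Collect_conj open_Collect_neq continuous_intros simp: Collect_conj_eq)
  have Jp: "J p = T1\<^sup>2 + T2\<^sup>2" by (simp add: J_def T1_def T2_def power2_eq_square)
  have pQ: "p \<in> Q" using pB Tpos unfolding Q_def by (simp only: Jp mem_Collect_eq less_imp_neq[symmetric] simp_thms)
  define M where "M q y = ((Uy q * fst y - T2 * snd y) / J q, (- Ux q * fst y + T1 * snd y) / J q)"
    for q and y :: "real \<times> real"
  have LM: "L q (M q y) = y" "M q (L q y) = y" if "J q \<noteq> 0" for q y
  proof -
    have a: "(a * b + c * d) / e = a * (b / e) + c * (d / e)" for a b c d e :: real
      by (simp add: add_divide_distrib)
    have "T1 * ((Uy q * fst y - T2 * snd y) / J q) + T2 * ((- Ux q * fst y + T1 * snd y) / J q) = J q * fst y / J q"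
      unfolding a[symmetric] by (simp add: J_def algebra_simps)
    moreover have "Ux q * ((Uy q * fst y - T2 * snd y) / J q) + Uy q * ((- Ux q * fst y + T1 * snd y) / J q) = J q * snd y / J q"
      unfolding a[symmetric] by (simp add: J_def algebra_simps)
    ultimately show "L q (M q y) = y" using that by (simp add: L_def M_def)
    have "(Uy q * (T1 * fst y + T2 * snd y) - T2 * (Ux q * fst y + Uy q * snd y)) = J q * fst y"
      "(- Ux q * (T1 * fst y + T2 * snd y) + T1 * (Ux q * fst y + Uy q * snd y)) = J q * snd y"
      by (simp_all add: J_def algebra_simps)
    then show "M q (L q y) = y" using that by (simp add: L_def M_def)
  qed
  have bM: "bounded_linear (M p)"
    unfolding M_def by (intro bounded_linear_Pair bounded_linear_add bounded_linear_sub bounded_linear_mult_right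
        bounded_linear_fst bounded_linear_snd bounded_linear_compose[OF bounded_linear_mult_right]
        bounded_linear_compose[OF bounded_linear_divide])
  have invM: "Blinfun (M p) o\<^sub>L \<Phi>' p = id_blinfun"
    using LM(2) pQ by (intro blinfun_eqI) (simp add: ap bounded_linear_Blinfun_apply[OF bM] Q_def)
  obtain U' V g g' where ift: "open U'" "U' \<subseteq> Q" "p \<in> U'" "open V" "\<Phi> p \<in> V" "homeomorphism U' V \<Phi> g"
    "\<And>y. y \<in> V \<Longrightarrow> (g has_derivative (g' y)) (at y)"
    "\<And>y. y \<in> V \<Longrightarrow> g' y = inv (blinfun_apply (\<Phi>' (g y)))"
    using inverse_function_theorem[OF opQ d\<Phi> continuous_on_subset[OF c\<Phi> subset_UNIV] pQ invM] by metis
  have \<Phi>p: "\<Phi> p = (0, 0)" by (simp add: \<Phi>_def pB)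
  define \<gamma> where "\<gamma> t = g (t, 0)" for t :: real
  have "open ((\<lambda>t. (t, 0)) -` V)" "0 \<in> (\<lambda>t. (t, 0)) -` V"
    using ift(4,5) \<Phi>p by (auto intro!: open_vimage continuous_intros)
  then obtain r where r: "r > 0" "ball 0 r \<subseteq> (\<lambda>t. (t, 0)) -` V"
    using openE by blast
  have tV: "(t, 0) \<in> V" if "t \<in> {-r<..<r}" for t
    using that r(2) by (auto simp: subset_iff dist_real_def abs_less_iff)
  have \<gamma>Q: "\<gamma> t \<in> Q" "\<Phi> (\<gamma> t) = (t, 0)" if "t \<in> {-r<..<r}" for t
    using ift(2,6) tV[OF that] unfolding \<gamma>_def homeomorphism_def by auto
  have \<gamma>0: "\<gamma> 0 = p"
    using ift(3,6) unfolding \<gamma>_def homeomorphism_def \<Phi>p[symmetric] by auto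
  have U\<gamma>: "U (\<gamma> t) = 0" "J (\<gamma> t) \<noteq> 0" "\<gamma> t \<in> B" if "t \<in> {-r<..<r}" for t
    using \<gamma>Q[OF that] by (auto simp: \<Phi>_def Q_def)
  \<comment> \<open>The inverse function theorem gives one derivative of the local inverse. Writing
    it through the partials of \<open>U\<close> makes it differentiable again, with a continuous
    second derivative.\<close>
  define \<gamma>' where "\<gamma>' t = (Uy (\<gamma> t) / J (\<gamma> t), - Ux (\<gamma> t) / J (\<gamma> t))" for t
  have d\<gamma>: "(\<gamma> has_vector_derivative \<gamma>' t) (at t)" if t: "t \<in> {-r<..<r}" for t
  proof -
    have "g' (t, 0) = inv (L (\<gamma> t))" using ift(8)[OF tV[OF t]] by (simp add: ap \<gamma>_def)
    also have "\<dots> = M (\<gamma> t)"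
      using LM[OF U\<gamma>(2)[OF t]] by (intro inv_equality) auto
    finally have g'M: "g' (t, 0) = M (\<gamma> t)" .
    have "(\<gamma> has_derivative (\<lambda>s. g' (t, 0) (s, 0))) (at t)"
      unfolding \<gamma>_def
      by (rule has_derivative_compose[where g = g and f = "\<lambda>t. (t, 0)"])
        (use ift(7)[OF tV[OF t]] in \<open>auto intro!: derivative_eq_intros\<close>)
    then show ?thesis
      unfolding has_vector_derivative_def g'M by (simp add: M_def \<gamma>'_def mult.commute)
  qed
  have dJ: "(J has_derivative (\<lambda>h. (T1 * Uxy q - T2 * Uxx q) * fst h + (T1 * Uyy q - T2 * Uxy q) * snd h)) (at q)" for q
    unfolding J_def by (rule derivative_eq_intros dUx dUy refl)+ (simp add: fun_eq_iff algebra_simps)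
  define \<gamma>'' where "\<gamma>'' t =
     (((Uxy (\<gamma> t) * fst (\<gamma>' t) + Uyy (\<gamma> t) * snd (\<gamma>' t)) * J (\<gamma> t)
        - Uy (\<gamma> t) * ((T1 * Uxy (\<gamma> t) - T2 * Uxx (\<gamma> t)) * fst (\<gamma>' t) + (T1 * Uyy (\<gamma> t) - T2 * Uxy (\<gamma> t)) * snd (\<gamma>' t)))
        / (J (\<gamma> t) * J (\<gamma> t)),
      (- (Uxx (\<gamma> t) * fst (\<gamma>' t) + Uxy (\<gamma> t) * snd (\<gamma>' t)) * J (\<gamma> t)
        - (- Ux (\<gamma> t)) * ((T1 * Uxy (\<gamma> t) - T2 * Uxx (\<gamma> t)) * fst (\<gamma>' t) + (T1 * Uyy (\<gamma> t) - T2 * Uxy (\<gamma> t)) * snd (\<gamma>' t)))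
        / (J (\<gamma> t) * J (\<gamma> t)))" for t
  have d\<gamma>': "(\<gamma>' has_vector_derivative \<gamma>'' t) (at t)" if t: "t \<in> {-r<..<r}" for t
  proof -
    note c = chain[OF dUx d\<gamma>[OF t]] chain[OF dUy d\<gamma>[OF t]] chain[OF dJ d\<gamma>[OF t]]
    have "((\<lambda>t. Uy (\<gamma> t) / J (\<gamma> t)) has_vector_derivative fst (\<gamma>'' t)) (at t)"
      "((\<lambda>t. - Ux (\<gamma> t) / J (\<gamma> t)) has_vector_derivative snd (\<gamma>'' t)) (at t)"
      using DERIV_divide[OF c(2,3) U\<gamma>(2)[OF t]] DERIV_divide[OF DERIV_minus[OF c(1)] c(3) U\<gamma>(2)[OF t]]
      by (auto simp: \<gamma>''_def has_real_derivative_iff_has_vector_derivative)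
    then show ?thesis
      using has_vector_derivative_Pair unfolding \<gamma>'_def by fastforce
  qed
  have c\<gamma>: "continuous_on {-r<..<r} \<gamma>" "continuous_on {-r<..<r} \<gamma>'"
    using has_vector_derivative_continuous[OF d\<gamma>] has_vector_derivative_continuous[OF d\<gamma>']
    by (blast intro: continuous_at_imp_continuous_on)+
  have comp: "continuous_on {-r<..<r} (\<lambda>t. F (\<gamma> t))" if "continuous_on UNIV F" for F :: "real \<times> real \<Rightarrow> real"
    by (rule continuous_on_compose2[OF that c\<gamma>(1)]) auto
  have c\<gamma>'': "continuous_on {-r<..<r} \<gamma>''"
    unfolding \<gamma>''_def by (intro continuous_intros comp c\<gamma> cont cg cJ) (use U\<gamma> in auto)
  have \<gamma>'0: "\<gamma>' 0 = (Uy p / J p, - Ux p / J p)" by (simp add: \<gamma>'_def \<gamma>0)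
  have "\<gamma>' 0 \<noteq> 0" using regular[OF p] pQ by (auto simp: \<gamma>'0 zero_prod_def Q_def)
  moreover have "\<forall>\<^sub>F s in at_right 0. p + s *\<^sub>R (- snd (\<gamma>' 0), fst (\<gamma>' 0)) \<in> \<Omega>"
  proof -
    define n where "n = (- snd (\<gamma>' 0), fst (\<gamma>' 0))"
    have dn: "((\<lambda>s. p + s *\<^sub>R n) has_vector_derivative n) (at 0)"
      by (auto intro!: derivative_eq_intros)
    have "fst n = Ux p / J p" "snd n = Uy p / J p" by (simp_all add: n_def \<gamma>'0)
    then have "Ux p * fst n + Uy p * snd n = (Ux p * Ux p + Uy p * Uy p) / J p"
      by (simp add: add_divide_distrib)
    moreover have "Ux p * Ux p + Uy p * Uy p = J p"
      by (simp add: J_def T1_def T2_def)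
    moreover have "J p \<noteq> 0" using pQ by (simp add: Q_def)
    ultimately have "Ux p * fst n + Uy p * snd n = 1" by simp
    then have "((\<lambda>s. U (p + s *\<^sub>R n)) has_real_derivative 1) (at 0)"
      using chain[OF dU dn] by simp
    from DERIV_pos_inc_right[OF this] pB(2)
    obtain d where d: "d > 0" "\<And>h. 0 < h \<Longrightarrow> h < d \<Longrightarrow> U (p + h *\<^sub>R n) > 0" by auto
    have "\<forall>\<^sub>F s in at_right (0::real). 0 < s \<and> s < d"
      using d(1) eventually_at_right_less by (auto simp: eventually_at_right)
    moreover have "((\<lambda>s. p + s *\<^sub>R n) \<longlongrightarrow> p + 0 *\<^sub>R n) (at_right 0)"
      by (intro tendsto_intros)
    then have "\<forall>\<^sub>F s in at_right (0::real). p + s *\<^sub>R n \<in> B"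
      by (rule topological_tendstoD) (use opB pB in auto)
    ultimately show ?thesis
      unfolding n_def[symmetric] by eventually_elim (use d(2) in \<open>auto simp: \<Omega>_eq\<close>)
  qed
  ultimately have "has_boundary_curvature \<Omega> p
      ((fst (\<gamma>' 0) * snd (\<gamma>'' 0) - snd (\<gamma>' 0) * fst (\<gamma>'' 0)) / norm (\<gamma>' 0) ^ 3)"
    unfolding has_boundary_curvature_def
    using r(1) \<gamma>0 d\<gamma> d\<gamma>' c\<gamma>'' U\<gamma> frontier_eq
    by (intro exI[of _ \<gamma>] exI[of _ \<gamma>'] exI[of _ \<gamma>''] exI[of _ r]) auto
  then show ?thesis by blast
qed

lemma Curv_eq: "p \<in> frontier \<Omega> \<Longrightarrow> Curv \<Omega> p = curv_num p / grad_norm p ^ 3"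
  unfolding Curv_def
  using boundary_curvature_exists boundary_curvature_unique by (metis the_equality)

lemma Curv_attains_min:
  assumes "compact (frontier \<Omega>)" "frontier \<Omega> \<noteq> {}"
  shows "\<exists>q\<in>frontier \<Omega>. \<forall>p\<in>frontier \<Omega>. Curv \<Omega> q \<le> Curv \<Omega> p"
proof -
  have "continuous_on UNIV Ux" "continuous_on UNIV Uy"
    using dUx dUy by (meson continuous_at_imp_continuous_on has_derivative_continuous)+
  then have c: "continuous_on (frontier \<Omega>) Ux" "continuous_on (frontier \<Omega>) Uy"
    "continuous_on (frontier \<Omega>) Uxx" "continuous_on (frontier \<Omega>) Uxy" "continuous_on (frontier \<Omega>) Uyy"
    using cont continuous_on_subset by blast+
  have "continuous_on (frontier \<Omega>) (\<lambda>p. curv_num p / grad_norm p ^ 3)"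
    unfolding curv_num_def grad_norm_def
    by (intro continuous_intros c) (use regular in \<open>auto simp: add_nonneg_eq_0_iff\<close>)
  from continuous_attains_inf[OF assms this] show ?thesis
    by (simp add: Curv_eq)
qed

end

section \<open>Estimates for the perturbed strip\<close>

lemma abs_mult_le:
  fixes a b :: real
  shows "\<bar>a\<bar> \<le> x \<Longrightarrow> \<bar>b\<bar> \<le> y \<Longrightarrow> \<bar>a * b\<bar> \<le> x * y"
  by (simp add: abs_mult mult_mono')

text \<open>In the application \<open>V\<^sub>j + i W\<^sub>j\<close> is the \<open>j\<close>-th derivative of the polynomial \<open>F\<close> of degree \<open>N + 4\<close>,
  \<open>e = \<epsilon>\<^bsup>3/2\<^esup>\<close>, and the domain is confined to the box \<open>\<bar>x\<bar> < \<tau> - 1\<close>, \<open>\<bar>y\<bar> < 2\<close>; \<open>s\<close> measures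
  smallness.\<close>

locale strip =
  fixes N :: nat and B \<epsilon> e \<tau> s :: real and V0 V1 V2 V3 W1 W2 W3 :: "real \<times> real \<Rightarrow> real"
  assumes B: "B \<ge> 1"
    and dV0: "\<And>p. (V0 has_derivative (\<lambda>h. V1 p * fst h - W1 p * snd h)) (at p)"
    and dV1: "\<And>p. (V1 has_derivative (\<lambda>h. V2 p * fst h - W2 p * snd h)) (at p)"
    and dV2: "\<And>p. (V2 has_derivative (\<lambda>h. V3 p * fst h - W3 p * snd h)) (at p)"
    and dW1: "\<And>p. (W1 has_derivative (\<lambda>h. W2 p * fst h + V2 p * snd h)) (at p)"
    and dW2: "\<And>p. (W2 has_derivative (\<lambda>h. W3 p * fst h + V3 p * snd h)) (at p)"
    and bV0: "\<And>x y. \<bar>y\<bar> \<le> 2 \<Longrightarrow> \<bar>V0 (x, y) + (1 + \<bar>x\<bar>) ^ (N + 4)\<bar> \<le> B * (1 + \<bar>x\<bar>) ^ (N + 3)"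
    and bV1: "\<And>x y. \<bar>y\<bar> \<le> 2 \<Longrightarrow>
      \<bar>V1 (x, y) + (real N + 4) * sgn x * (1 + \<bar>x\<bar>) ^ (N + 3)\<bar> \<le> B * (1 + \<bar>x\<bar>) ^ (N + 2)"
    and bV2: "\<And>x y. \<bar>y\<bar> \<le> 2 \<Longrightarrow>
      \<bar>V2 (x, y) + (real N + 4) * (real N + 3) * (1 + \<bar>x\<bar>) ^ (N + 2)\<bar> \<le> B * (1 + \<bar>x\<bar>) ^ (N + 1)"
    and bV3: "\<And>x y. \<bar>y\<bar> \<le> 2 \<Longrightarrow>
      \<bar>V3 (x, y) + (real N + 4) * (real N + 3) * (real N + 2) * sgn x * (1 + \<bar>x\<bar>) ^ (N + 1)\<bar>
        \<le> B * (1 + \<bar>x\<bar>) ^ N"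
    and bW1: "\<And>x y. \<bar>y\<bar> \<le> 2 \<Longrightarrow> \<bar>W1 (x, y)\<bar> \<le> B * (1 + \<bar>x\<bar>) ^ (N + 2)"
    and bW2: "\<And>x y. \<bar>y\<bar> \<le> 2 \<Longrightarrow> \<bar>W2 (x, y)\<bar> \<le> B * (1 + \<bar>x\<bar>) ^ (N + 1)"
    and bW3: "\<And>x y. \<bar>y\<bar> \<le> 2 \<Longrightarrow> \<bar>W3 (x, y)\<bar> \<le> B * (1 + \<bar>x\<bar>) ^ N"
    and pos: "\<epsilon> > 0" "e > 0" "s > 0" and e_le: "e \<le> s * \<epsilon>" and e\<tau>: "e * \<tau> ^ (N + 4) = 4"
    and \<epsilon>\<tau>: "\<epsilon> * \<tau>\<^sup>2 \<le> s" and s\<tau>: "1 \<le> s * \<tau>" and \<tau>2: "\<tau> \<ge> 2"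
    and s_small: "1000 * (12 + 4 * ((real N + 4) * (real N + 3)) + 4 * B
        + 4 * ((real N + 4) * (real N + 3) * (real N + 2))) ^ 3 * s \<le> 1"
    and s_small': "s * (2 * B) ^ (N + 2) * (12 + 4 * ((real N + 4) * (real N + 3)) + 4 * B
        + 4 * ((real N + 4) * (real N + 3) * (real N + 2))) \<le> 1"
begin

section \<open>Derivatives of the defining function and of its curvature numerator\<close>

definition "c1 = real N + 4"
definition "c2 = (real N + 4) * (real N + 3)"
definition "c3 = (real N + 4) * (real N + 3) * (real N + 2)"
text \<open>One constant that dominates all those arising in the estimates. The last two assumptions
  of the locale are \<open>1000 * A ^ 3 * s \<le> 1\<close> and
  \<open>s * (2 * B) ^ (N + 2) * A \<le> 1\<close>.\<close>

definition "A = 12 + 4 * c2 + 4 * B + 4 * c3"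

definition "U p = 1 / 2 - (snd p)\<^sup>2 / 2 + \<epsilon> * (snd p ^ 3 - 3 * (fst p)\<^sup>2 * snd p) + e * V0 p"
definition "Ux p = - 6 * \<epsilon> * fst p * snd p + e * V1 p"
definition "Uy p = - snd p + 3 * \<epsilon> * ((snd p)\<^sup>2 - (fst p)\<^sup>2) - e * W1 p"
definition "Uxx p = - 6 * \<epsilon> * snd p + e * V2 p"
definition "Uxy p = - 6 * \<epsilon> * fst p - e * W2 p"
definition "Uyy p = - 1 + 6 * \<epsilon> * snd p - e * V2 p"
definition "G p = - (Uxx p * (Uy p)\<^sup>2 - 2 * Uxy p * Ux p * Uy p + Uyy p * (Ux p)\<^sup>2)"
text \<open>The third partials of \<open>U\<close> in the order xxx, xxy, xyy, yyy are
  \<open>e * V3\<close>, \<open>- 6 * \<epsilon> - e * W3\<close>, \<open>- (e * V3)\<close> and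
  \<open>6 * \<epsilon> + e * W3\<close>; the two terms of \<open>Gx\<close> with
  \<open>Uxx * Uxy * Uy\<close> cancel.\<close>

definition "Gx p = - (e * V3 p) * (Uy p)\<^sup>2 + 2 * (- 6 * \<epsilon> - e * W3 p) * Ux p * Uy p + 2 * (Uxy p)\<^sup>2 * Ux p
   + (e * V3 p) * (Ux p)\<^sup>2 - 2 * Uyy p * Ux p * Uxx p"
definition "Gy p = (6 * \<epsilon> + e * W3 p) * (Uy p)\<^sup>2 - 2 * Uxx p * Uy p * Uyy p - 2 * (e * V3 p) * Ux p * Uy p
   + 2 * (Uxy p)\<^sup>2 * Uy p - (6 * \<epsilon> + e * W3 p) * (Ux p)\<^sup>2"

lemma U_derivatives:
  "(U has_derivative (\<lambda>h. Ux p * fst h + Uy p * snd h)) (at p)"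
  "(Ux has_derivative (\<lambda>h. Uxx p * fst h + Uxy p * snd h)) (at p)"
  "(Uy has_derivative (\<lambda>h. Uxy p * fst h + Uyy p * snd h)) (at p)"
  "(Uxx has_derivative (\<lambda>h. (e * V3 p) * fst h + (- 6 * \<epsilon> - e * W3 p) * snd h)) (at p)"
  "(Uxy has_derivative (\<lambda>h. (- 6 * \<epsilon> - e * W3 p) * fst h + (- (e * V3 p)) * snd h)) (at p)"
  "(Uyy has_derivative (\<lambda>h. (- (e * V3 p)) * fst h + (6 * \<epsilon> + e * W3 p) * snd h)) (at p)"
  unfolding U_def Ux_def Uy_def Uxx_def Uxy_def Uyy_def
  by (rule derivative_eq_intros dV0 dV1 dV2 dW1 dW2 refl |
      simp add: fun_eq_iff algebra_simps power2_eq_square power3_eq_cube)+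

lemma G_derivative: "(G has_derivative (\<lambda>h. Gx p * fst h + Gy p * snd h)) (at p)"
  unfolding G_def
  by (rule derivative_eq_intros U_derivatives refl)+
    (simp add: fun_eq_iff Gx_def Gy_def algebra_simps power2_eq_square)

section \<open>Size of the terms inside the box\<close>

definition "T p = 1 + \<bar>fst (p :: real \<times> real)\<bar>"
text \<open>A scale for the derivatives: \<open>e\<close> times \<open>F\<close> and its first three
  derivatives have real parts of leading size \<open>Q 4\<close>, \<open>Q 3\<close>,
  \<open>Q 2\<close>, \<open>Q 1\<close>, up to constants and signs, with errors one index
  lower.\<close>

definition "Q j p = e * T p ^ (N + j)"
text \<open>The bound \<open>\<tau> - 1\<close> is the abscissa at which \<open>T\<close> reaches
  \<tau>, that is, \<open>Q 4\<close> reaches 4.\<close>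

definition "obox = {p :: real \<times> real. \<bar>fst p\<bar> < \<tau> - 1 \<and> \<bar>snd p\<bar> < 2}"
definition "kbox = {p :: real \<times> real. \<bar>fst p\<bar> \<le> \<tau> - 1 \<and> \<bar>snd p\<bar> \<le> 2}"

lemma T_ge: "T p \<ge> 1" by (simp add: T_def)

lemma Q_step: "Q (Suc j) p = Q j p * T p"
  by (simp add: Q_def)

lemma Q_pos: "Q j p > 0"
  using pos T_ge[of p] by (simp add: Q_def)

lemma Q_mono: "Q j p \<le> Q (Suc j) p"
  using Q_pos[of j p] T_ge[of p] unfolding Q_step by simp

lemma Q_steps: "Q 1 p = Q 0 p * T p" "Q 2 p = Q 1 p * T p" "Q 3 p = Q 2 p * T p" "Q 4 p = Q 2 p * (T p)\<^sup>2"
  by (simp_all add: Q_def numeral_eq_Suc)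

lemma Q_monos: "Q 0 p \<le> Q 1 p" "Q 1 p \<le> Q 2 p" "Q 2 p \<le> Q 3 p"
  using Q_mono[of 0 p] Q_mono[of 1 p] Q_mono[of 2 p] by (simp_all add: numeral_eq_Suc)

lemma const_bounds: "c2 \<ge> 12" "c3 \<ge> 24" "c2 \<ge> c1" "c1 \<ge> 4" "A \<ge> 160" "B \<le> A" "A > 0" "c2 + B \<le> A / 4"
proof -
  have "(real N + 4) * (real N + 3) \<ge> 4 * 3" by (intro mult_mono) auto
  then show 1: "c2 \<ge> 12" by (simp add: c2_def)
  have "c2 * (real N + 2) \<ge> 12 * 2" using 1 by (intro mult_mono) auto
  then show 2: "c3 \<ge> 24" by (simp add: c2_def c3_def)
  show "c1 \<ge> 4" by (simp add: c1_def)
  have "c1 * 1 \<le> c1 * (real N + 3)" by (intro mult_left_mono) (auto simp: c1_def)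
  then show "c2 \<ge> c1" by (simp add: c1_def c2_def)
  show "A \<ge> 160" "B \<le> A" "A > 0" "c2 + B \<le> A / 4" using 1 2 B by (auto simp: A_def)
qed

lemma s_A: "1000 * A ^ 3 * s \<le> 1" "A\<^sup>2 * s \<le> 1 / 100000" "A * s \<le> 1 / 10000000" "s \<le> 1 / 1000000000"
proof -
  show 1: "1000 * A ^ 3 * s \<le> 1" using s_small by (simp add: A_def c2_def c3_def)
  have *: "160 * x \<le> A * x" if "x \<ge> 0" for x
    using const_bounds(5) that by (rule mult_right_mono)
  have "160 * (A\<^sup>2 * s) \<le> A * (A\<^sup>2 * s)" "160 * (A * s) \<le> A * (A * s)" "160 * s \<le> A * s"
    using pos const_bounds by (intro *; simp)+
  then show "A\<^sup>2 * s \<le> 1 / 100000" "A * s \<le> 1 / 10000000" "s \<le> 1 / 1000000000"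
    using 1 by (auto simp: power2_eq_square power3_eq_cube mult.assoc)
qed

lemma box_bounds:
  assumes "p \<in> kbox"
  shows "T p \<le> \<tau>" "Q 4 p \<le> 4" "Q 3 p \<le> 4 * s" "Q 2 p \<le> 4 * s" "\<epsilon> * (T p)\<^sup>2 \<le> s" "\<epsilon> * T p \<le> s" "\<epsilon> \<le> s"
proof -
  show T: "T p \<le> \<tau>" using assms by (simp add: T_def kbox_def)
  note T1 = T_ge[of p]
  have "T p ^ (N + 4) \<le> \<tau> ^ (N + 4)" using T T1 by (intro power_mono) auto
  then show "Q 4 p \<le> 4" using pos e\<tau> unfolding Q_def by (metis mult_left_mono less_imp_le)
  have "T p ^ (N + 3) \<le> \<tau> ^ (N + 3)" using T T1 by (intro power_mono) auto
  \<comment> \<open>The missing power of \<tau> is supplied by \<open>1 \<le> s * \<tau>\<close>, at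
    the price of the factor \<open>s\<close>.\<close>
  then have "Q 3 p * 1 \<le> (e * \<tau> ^ (N + 3)) * (s * \<tau>)"
    unfolding Q_def using pos s\<tau> T T1 by (intro mult_mono) auto
  also have "\<dots> = (e * \<tau> ^ (N + 4)) * s" by (simp add: numeral_eq_Suc)
  finally show Q3: "Q 3 p \<le> 4 * s" by (simp add: e\<tau>)
  then show "Q 2 p \<le> 4 * s" using Q_monos(3)[of p] by simp
  have "(T p)\<^sup>2 \<le> \<tau>\<^sup>2" using T T1 by (intro power_mono) auto
  then have "\<epsilon> * (T p)\<^sup>2 \<le> \<epsilon> * \<tau>\<^sup>2" using pos by simp
  then show 1: "\<epsilon> * (T p)\<^sup>2 \<le> s" using \<epsilon>\<tau> by simp
  have "T p * 1 \<le> T p * T p" using T1 by (intro mult_left_mono) auto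
  then have 2: "\<epsilon> * T p \<le> \<epsilon> * (T p)\<^sup>2" "\<epsilon> * 1 \<le> \<epsilon> * T p"
    using pos T1 by (auto simp: power2_eq_square)
  then show "\<epsilon> * T p \<le> s" "\<epsilon> \<le> s" using 1 by linarith+
qed

lemma scaled_bounds:
  assumes "\<bar>snd p\<bar> \<le> 2"
  shows "\<bar>e * V0 p + Q 4 p\<bar> \<le> B * Q 3 p"
    "\<bar>e * V1 p + c1 * sgn (fst p) * Q 3 p\<bar> \<le> B * Q 2 p"
    "\<bar>e * V2 p + c2 * Q 2 p\<bar> \<le> B * Q 1 p"
    "\<bar>e * V3 p + c3 * sgn (fst p) * Q 1 p\<bar> \<le> B * Q 0 p"
    "\<bar>e * W1 p\<bar> \<le> B * Q 2 p" "\<bar>e * W2 p\<bar> \<le> B * Q 1 p" "\<bar>e * W3 p\<bar> \<le> B * Q 0 p"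
proof -
  obtain x y where p: "p = (x, y)" by (cases p)
  have y: "\<bar>y\<bar> \<le> 2" using assms p by simp
  have m: "\<bar>e * v\<bar> \<le> e * b" if "\<bar>v\<bar> \<le> b" for v b
    using that pos by (simp add: abs_mult)
  show "\<bar>e * V0 p + Q 4 p\<bar> \<le> B * Q 3 p"
    using m[OF bV0[OF y, of x]] by (simp add: p Q_def T_def algebra_simps)
  show "\<bar>e * V1 p + c1 * sgn (fst p) * Q 3 p\<bar> \<le> B * Q 2 p"
    using m[OF bV1[OF y, of x]] by (simp add: p Q_def T_def c1_def algebra_simps)
  show "\<bar>e * V2 p + c2 * Q 2 p\<bar> \<le> B * Q 1 p"
    using m[OF bV2[OF y, of x]] by (simp add: p Q_def T_def c2_def algebra_simps)
  show "\<bar>e * V3 p + c3 * sgn (fst p) * Q 1 p\<bar> \<le> B * Q 0 p"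
    using m[OF bV3[OF y, of x]] by (simp add: p Q_def T_def c3_def algebra_simps)
  show "\<bar>e * W1 p\<bar> \<le> B * Q 2 p"
    using m[OF bW1[OF y, of x]] by (simp add: p Q_def T_def algebra_simps)
  show "\<bar>e * W2 p\<bar> \<le> B * Q 1 p"
    using m[OF bW2[OF y, of x]] by (simp add: p Q_def T_def algebra_simps)
  show "\<bar>e * W3 p\<bar> \<le> B * Q 0 p"
    using m[OF bW3[OF y, of x]] by (simp add: p Q_def T_def algebra_simps)
qed

lemma sgn_bound: "a \<ge> 0 \<Longrightarrow> \<bar>a * sgn x * b\<bar> \<le> a * \<bar>b\<bar>" for a x b :: real
  by (cases "x = 0") (auto simp: abs_mult abs_sgn_eq)

lemma cubic_bound:
  assumes "p \<in> kbox"
  shows "\<bar>\<epsilon> * (snd p ^ 3 - 3 * (fst p)\<^sup>2 * snd p)\<bar> \<le> 14 * (\<epsilon> * (T p)\<^sup>2)"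
proof -
  have y: "\<bar>snd p\<bar> \<le> 2" using assms by (simp add: kbox_def)
  have x: "(fst p)\<^sup>2 \<le> (T p)\<^sup>2" "1 \<le> (T p)\<^sup>2"
    by (auto simp: T_def abs_le_square_iff[symmetric] power2_eq_square algebra_simps)
  have "\<bar>snd p ^ 3\<bar> \<le> 2 ^ 3" unfolding power_abs using y by (intro power_mono) auto
  moreover have "\<bar>3 * (fst p)\<^sup>2 * snd p\<bar> \<le> 3 * (T p)\<^sup>2 * 2"
    using y x by (intro abs_mult_le) auto
  ultimately have "\<bar>snd p ^ 3 - 3 * (fst p)\<^sup>2 * snd p\<bar> \<le> 14 * (T p)\<^sup>2"
    using x(2) abs_triangle_ineq4[of "snd p ^ 3" "3 * (fst p)\<^sup>2 * snd p"] by simp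
  then have "\<epsilon> * \<bar>snd p ^ 3 - 3 * (fst p)\<^sup>2 * snd p\<bar> \<le> \<epsilon> * (14 * (T p)\<^sup>2)"
    using pos by (intro mult_left_mono) auto
  then show ?thesis using pos by (simp add: abs_mult)
qed

lemma Ux_bound:
  assumes "p \<in> kbox"
  shows "\<bar>Ux p\<bar> \<le> 12 * (\<epsilon> * T p) + (c1 + B) * Q 3 p"
proof -
  have y: "\<bar>snd p\<bar> \<le> 2" "\<bar>fst p\<bar> \<le> T p" using assms by (auto simp: kbox_def T_def)
  have "\<bar>6 * \<epsilon> * fst p * snd p\<bar> \<le> 6 * \<epsilon> * T p * 2"
    using y pos by (intro abs_mult_le) auto
  moreover have "\<bar>e * V1 p\<bar> \<le> (c1 + B) * Q 3 p"
  proof -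
    have "\<bar>c1 * sgn (fst p) * Q 3 p\<bar> \<le> c1 * Q 3 p"
      using sgn_bound[of c1 "fst p" "Q 3 p"] Q_pos[of 3 p] const_bounds by simp
    moreover have "B * Q 2 p \<le> B * Q 3 p"
      using Q_monos(3) B by (intro mult_left_mono) auto
    ultimately show ?thesis
      using scaled_bounds(2)[OF y(1)] unfolding distrib_right abs_le_iff by linarith
  qed
  ultimately show ?thesis by (simp add: Ux_def)
qed

lemma Uy_bound:
  assumes "p \<in> kbox"
  shows "\<bar>Uy p + snd p\<bar> \<le> A * s"
proof -
  have y: "\<bar>snd p\<bar> \<le> 2" using assms by (simp add: kbox_def)
  have x: "(fst p)\<^sup>2 \<le> (T p)\<^sup>2" "1 \<le> (T p)\<^sup>2"
    by (auto simp: T_def abs_le_square_iff[symmetric] power2_eq_square algebra_simps)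
  have "(snd p)\<^sup>2 \<le> 2\<^sup>2" using y abs_le_square_iff[of "snd p" 2] by simp
  then have "(snd p)\<^sup>2 \<le> 4" by simp
  then have "\<bar>(snd p)\<^sup>2 - (fst p)\<^sup>2\<bar> \<le> 4 * (T p)\<^sup>2"
    using x zero_le_power2[of "fst p"] zero_le_power2[of "snd p"] unfolding abs_le_iff
    by (intro conjI; linarith)
  then have "\<bar>3 * \<epsilon> * ((snd p)\<^sup>2 - (fst p)\<^sup>2)\<bar> \<le> 3 * \<epsilon> * (4 * (T p)\<^sup>2)"
    using pos by (intro abs_mult_le) auto
  also have "\<dots> \<le> 12 * s" using box_bounds(5)[OF assms] by simp
  finally have 1: "\<bar>3 * \<epsilon> * ((snd p)\<^sup>2 - (fst p)\<^sup>2)\<bar> \<le> 12 * s" .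
  have "B * Q 2 p \<le> B * (4 * s)" using box_bounds(4)[OF assms] B by (intro mult_left_mono) auto
  then have 2: "\<bar>e * W1 p\<bar> \<le> B * (4 * s)"
    using scaled_bounds(5)[OF y] by linarith
  have "\<bar>Uy p + snd p\<bar> \<le> (12 + 4 * B) * s"
    using 1 2 unfolding Uy_def by (simp add: algebra_simps)
  also have "\<dots> \<le> A * s" using pos const_bounds by (intro mult_right_mono) (auto simp: A_def)
  finally show ?thesis .
qed

lemma eV2_bound:
  assumes "p \<in> kbox"
  shows "\<bar>e * V2 p\<bar> \<le> (c2 + B) * Q 2 p"
proof -
  have y: "\<bar>snd p\<bar> \<le> 2" using assms by (simp add: kbox_def)
  have "B * Q 1 p \<le> B * Q 2 p" using Q_monos(2) B by (intro mult_left_mono) auto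
  moreover have "c2 * Q 2 p \<ge> 0" using Q_pos[of 2 p] const_bounds by simp
  ultimately show ?thesis using scaled_bounds(3)[OF y] by (simp add: algebra_simps)
qed

lemma Uyy_bound:
  assumes "p \<in> kbox"
  shows "\<bar>Uyy p + 1\<bar> \<le> A * s"
proof -
  have y: "\<bar>snd p\<bar> \<le> 2" using assms by (simp add: kbox_def)
  have "\<bar>6 * \<epsilon> * snd p\<bar> \<le> 6 * \<epsilon> * 2" using y pos by (intro abs_mult_le) auto
  then have "\<bar>6 * \<epsilon> * snd p\<bar> \<le> 12 * s" using box_bounds(7)[OF assms] by linarith
  moreover have "(c2 + B) * Q 2 p \<le> (c2 + B) * (4 * s)"
    using box_bounds(4)[OF assms] const_bounds B by (intro mult_left_mono) auto
  ultimately have "\<bar>Uyy p + 1\<bar> \<le> (12 + 4 * c2 + 4 * B) * s"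
    using eV2_bound[OF assms] unfolding Uyy_def by (simp add: algebra_simps)
  also have "\<dots> \<le> A * s" using pos const_bounds by (intro mult_right_mono) (auto simp: A_def)
  finally show ?thesis .
qed

lemma Uxy_bound:
  assumes "p \<in> kbox"
  shows "\<bar>Uxy p\<bar> \<le> 6 * (\<epsilon> * T p) + B * Q 1 p"
proof -
  have y: "\<bar>snd p\<bar> \<le> 2" "\<bar>fst p\<bar> \<le> T p" using assms by (auto simp: kbox_def T_def)
  have "\<bar>6 * \<epsilon> * fst p\<bar> \<le> 6 * \<epsilon> * T p"
    using y pos by (intro abs_mult_le) auto
  then show ?thesis using scaled_bounds(6)[OF y(1)] by (simp add: Uxy_def)
qed

text \<open>Whether \<open>Q 2 = e T\<^bsup>N+2\<^esup>\<close> is large or small compared with \<open>\<epsilon>\<close> decides whether \<open>F\<close> or the cubic term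
governs the second derivative in \<open>x\<close>.\<close>

lemma T_large:
  assumes "\<epsilon> < A * Q 2 p"
  shows "T p > 2 * B"
proof (rule ccontr)
  assume "\<not> T p > 2 * B"
  then have "T p ^ (N + 2) \<le> (2 * B) ^ (N + 2)"
    using T_ge[of p] by (intro power_mono) auto
  then have "Q 2 p \<le> e * (2 * B) ^ (N + 2)" using pos by (simp add: Q_def)
  also have "\<dots> \<le> (s * \<epsilon>) * (2 * B) ^ (N + 2)" using e_le B by (intro mult_right_mono) auto
  finally have "A * Q 2 p \<le> A * ((s * \<epsilon>) * (2 * B) ^ (N + 2))"
    using const_bounds by (intro mult_left_mono) auto
  also have "\<dots> = \<epsilon> * (s * (2 * B) ^ (N + 2) * A)" by (simp add: mult_ac)
  also have "\<dots> \<le> \<epsilon> * 1"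
    using s_small' pos by (intro mult_left_mono) (auto simp: A_def c2_def c3_def)
  finally show False using assms by simp
qed

text \<open>Once \<open>T p\<close> exceeds \<open>2 * B\<close>, a remainder carrying
  \<open>B\<close> and one index less is at most half of the leading power.\<close>

lemma BQ_small:
  assumes "\<epsilon> < A * Q 2 p"
  shows "B * Q 1 p \<le> Q 2 p / 2" "B * Q 2 p \<le> Q 3 p / 2" "B * Q 0 p \<le> Q 1 p / 2"
proof -
  have "B \<le> T p / 2" using T_large[OF assms] by simp
  then have "B * Q j p \<le> T p / 2 * Q j p" for j
    using Q_pos[of j p] by (intro mult_right_mono) auto
  from this[of 1] this[of 2] this[of 0]
  show "B * Q 1 p \<le> Q 2 p / 2" "B * Q 2 p \<le> Q 3 p / 2" "B * Q 0 p \<le> Q 1 p / 2"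
    unfolding Q_steps(1-3) by (simp_all add: mult.commute)
qed

section \<open>Monotonicity in x and positive curvature away from the lower arc\<close>

lemma outer_large: "4 * \<epsilon> \<le> Q 2 p \<Longrightarrow> \<epsilon> < A * Q 2 p"
proof -
  assume "4 * \<epsilon> \<le> Q 2 p"
  moreover have "1 * Q 2 p \<le> A * Q 2 p" using const_bounds Q_pos[of 2 p] by (intro mult_right_mono) auto
  ultimately show "\<epsilon> < A * Q 2 p" using pos by linarith
qed

text \<open>A bound for the remainder of the second derivative in both regimes: either
  \<open>T p\<close> is large and the half of \<open>Q 2\<close> absorbs it, or it is below
  \<open>\<epsilon>\<close>.\<close>

lemma BQ1_le: "B * Q 1 p \<le> Q 2 p / 2 + \<epsilon>"
proof (cases "\<epsilon> < A * Q 2 p")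
  case True
  then show ?thesis using BQ_small(1)[OF True] pos by linarith
next
  case False
  have "B * Q 1 p \<le> A * Q 2 p"
    using Q_monos(2) const_bounds Q_pos[of 1 p] by (intro mult_mono) auto
  then show ?thesis using False Q_pos[of 2 p] by linarith
qed

text \<open>Here the cubic term contributes at most \<open>3 * Q 3 p\<close>, the remainder at most
  half of \<open>Q 3 p\<close>, and the leading part of \<open>e * V1\<close> at least
  \<open>4 * Q 3 p\<close> towards the axis. The threshold \<open>4 * \<epsilon>\<close> makes this
  balance work.\<close>

lemma outer_Ux:
  assumes "p \<in> kbox" "4 * \<epsilon> \<le> Q 2 p"
  shows "sgn (fst p) * Ux p < 0"
proof -
  have y: "\<bar>snd p\<bar> \<le> 2" "\<bar>fst p\<bar> \<le> T p" using assms by (auto simp: kbox_def T_def)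
  note L = outer_large[OF assms(2)]
  have "fst p \<noteq> 0"
    using T_large[OF L] B by (auto simp: T_def)
  then have sg: "sgn (fst p) * sgn (fst p) = 1" "\<bar>sgn (fst p)\<bar> = 1"
    by (auto simp: sgn_if)
  have "\<bar>6 * \<epsilon> * fst p * snd p\<bar> \<le> 6 * \<epsilon> * T p * 2"
    using y pos by (intro abs_mult_le) auto
  moreover have "4 * \<epsilon> * T p \<le> Q 3 p"
    unfolding Q_steps(3) using assms(2) T_ge[of p] by (intro mult_right_mono) auto
  ultimately have 1: "\<bar>sgn (fst p) * (6 * \<epsilon> * fst p * snd p)\<bar> \<le> 3 * Q 3 p"
    using sg by (simp add: abs_mult)
  have "\<bar>sgn (fst p) * (e * V1 p + c1 * sgn (fst p) * Q 3 p)\<bar> \<le> 1 * (B * Q 2 p)"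
    using scaled_bounds(2)[OF y(1)] sg by (intro abs_mult_le) auto
  moreover have "sgn (fst p) * (e * V1 p + c1 * sgn (fst p) * Q 3 p) = sgn (fst p) * (e * V1 p) + c1 * Q 3 p"
    using sg(1) by (simp add: distrib_left mult.left_commute)
  ultimately have "sgn (fst p) * (e * V1 p) \<le> - c1 * Q 3 p + Q 3 p / 2"
    using BQ_small(2)[OF L] by linarith
  moreover have "4 * Q 3 p \<le> c1 * Q 3 p" using const_bounds Q_pos[of 3 p] by (intro mult_right_mono) auto
  moreover have "sgn (fst p) * Ux p = - (sgn (fst p) * (6 * \<epsilon> * fst p * snd p)) + sgn (fst p) * (e * V1 p)"
    by (simp add: Ux_def algebra_simps)
  ultimately show ?thesis using 1 Q_pos[of 3 p] unfolding abs_le_iff by linarith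
qed

text \<open>\<open>G\<close> is minus a quadratic form in the gradient with diagonal coefficients at
  least \<alpha> and 7/8. The square of \<open>Uxy\<close> is at most \<open>\<alpha> / 8\<close>,
  so the mixed term costs a quarter of the first and 1/2 of the second coefficient.\<close>

lemma G_pos:
  assumes p: "p \<in> kbox" and xx: "- Uxx p \<ge> \<epsilon> + Q 2 p" and nz: "Ux p \<noteq> 0 \<or> Uy p \<noteq> 0"
  shows "G p > 0"
proof -
  define \<alpha> where "\<alpha> = \<epsilon> + Q 2 p"
  have \<alpha>: "\<alpha> > 0" using pos Q_pos[of 2 p] by (simp add: \<alpha>_def)
  have "(Uxy p)\<^sup>2 \<le> (6 * (\<epsilon> * T p) + B * Q 1 p)\<^sup>2"
    using Uxy_bound[OF p] by (simp add: abs_le_square_iff[symmetric])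
  also have "\<dots> \<le> 2 * (6 * (\<epsilon> * T p))\<^sup>2 + 2 * (B * Q 1 p)\<^sup>2"
    using norm_add_square_le[of "6 * (\<epsilon> * T p)" "B * Q 1 p"] by simp
  also have "(6 * (\<epsilon> * T p))\<^sup>2 = 36 * (\<epsilon> * (\<epsilon> * (T p)\<^sup>2))" by (simp add: power2_eq_square)
  also have "\<epsilon> * (\<epsilon> * (T p)\<^sup>2) \<le> \<epsilon> * s" using box_bounds(5)[OF p] pos by (intro mult_left_mono) auto
  also have "(B * Q 1 p)\<^sup>2 \<le> B\<^sup>2 * (Q 2 p * (4 * s))"
  proof -
    have "Q 1 p * Q 1 p \<le> Q 2 p * (4 * s)"
      using Q_monos(2)[of p] box_bounds(4)[OF p] Q_pos[of 1 p] Q_pos[of 2 p] by (intro mult_mono) auto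
    then have "B\<^sup>2 * (Q 1 p * Q 1 p) \<le> B\<^sup>2 * (Q 2 p * (4 * s))"
      by (rule mult_left_mono) simp
    then show ?thesis by (simp only: power_mult_distrib power2_eq_square[of "Q 1 p"])
  qed
  finally have "(Uxy p)\<^sup>2 \<le> 72 * s * \<epsilon> + 8 * B\<^sup>2 * s * Q 2 p" by (simp add: mult_ac)
  also have "\<dots> \<le> (A\<^sup>2 * s) * \<epsilon> + (A\<^sup>2 * s) * Q 2 p"
  proof (intro add_mono mult_right_mono)
    have "160\<^sup>2 \<le> A\<^sup>2" using const_bounds by (intro power_mono) auto
    then show "72 \<le> A\<^sup>2" by simp
    have "(4 * B)\<^sup>2 \<le> A\<^sup>2" using const_bounds B by (intro power_mono) (auto simp: A_def)
    then have "16 * B\<^sup>2 \<le> A\<^sup>2" by simp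
    then show "8 * B\<^sup>2 \<le> A\<^sup>2" using zero_le_power2[of B] by linarith
  qed (use pos Q_pos[of 2 p] in auto)
  also have "\<dots> = (A\<^sup>2 * s) * \<alpha>" by (simp add: \<alpha>_def algebra_simps)
  also have "\<dots> \<le> 1 / 8 * \<alpha>" using s_A(2) \<alpha> by (intro mult_right_mono) auto
  finally have xy: "(Uxy p)\<^sup>2 \<le> \<alpha> / 8" by simp
  have yy: "- Uyy p \<ge> 7 / 8" using Uyy_bound[OF p] s_A(3) by linarith
  have "\<bar>2 * Uxy p * Ux p * Uy p\<bar> \<le> 1 / 2 * (Ux p)\<^sup>2 + 2 * ((Uxy p)\<^sup>2 * (Uy p)\<^sup>2)"
    using zero_le_power2[of "Ux p + 2 * (Uxy p * Uy p)"] zero_le_power2[of "Ux p - 2 * (Uxy p * Uy p)"]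
    unfolding abs_le_iff by (simp add: power2_eq_square algebra_simps)
  moreover have "(Uxy p)\<^sup>2 * (Uy p)\<^sup>2 \<le> \<alpha> / 8 * (Uy p)\<^sup>2" using xy by (intro mult_right_mono) auto
  moreover have "\<alpha> * (Uy p)\<^sup>2 \<le> - Uxx p * (Uy p)\<^sup>2" using xx by (intro mult_right_mono) (auto simp: \<alpha>_def)
  moreover have "7 / 8 * (Ux p)\<^sup>2 \<le> - Uyy p * (Ux p)\<^sup>2" using yy by (intro mult_right_mono) auto
  ultimately have "G p \<ge> 3 / 4 * (\<alpha> * (Uy p)\<^sup>2) + 3 / 8 * (Ux p)\<^sup>2"
    unfolding G_def abs_le_iff by simp
  moreover have "3 / 4 * (\<alpha> * (Uy p)\<^sup>2) + 3 / 8 * (Ux p)\<^sup>2 > 0"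
    using nz
  proof
    assume "Ux p \<noteq> 0"
    then have "0 < 3 / 8 * (Ux p)\<^sup>2" by simp
    moreover have "0 \<le> \<alpha> * (Uy p)\<^sup>2" using \<alpha> by simp
    ultimately show ?thesis by linarith
  next
    assume "Uy p \<noteq> 0"
    then have "0 < \<alpha> * (Uy p)\<^sup>2" using \<alpha> by simp
    moreover have "0 \<le> (Ux p)\<^sup>2" by simp
    ultimately show ?thesis by linarith
  qed
  ultimately show ?thesis by linarith
qed

lemma minus_Uxx_ge: "p \<in> kbox \<Longrightarrow> - Uxx p \<ge> 6 * \<epsilon> * snd p + c2 * Q 2 p - B * Q 1 p"
  using scaled_bounds(3)[of p] unfolding Uxx_def kbox_def abs_le_iff by simp

lemma outer_G_pos:
  assumes p: "p \<in> kbox" and o: "4 * \<epsilon> \<le> Q 2 p"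
  shows "G p > 0"
proof (rule G_pos[OF p])
  have "6 * \<epsilon> * snd p \<ge> 6 * \<epsilon> * (- 2)" using p pos by (intro mult_left_mono) (auto simp: kbox_def)
  moreover have "12 * Q 2 p \<le> c2 * Q 2 p" using const_bounds Q_pos[of 2 p] by (intro mult_right_mono) auto
  ultimately show "\<epsilon> + Q 2 p \<le> - Uxx p"
    using minus_Uxx_ge[OF p] BQ_small(1)[OF outer_large[OF o]] o pos(1) by linarith
  show "Ux p \<noteq> 0 \<or> Uy p \<noteq> 0" using outer_Ux[OF p o] by auto
qed

text \<open>For positive heights the cubic term has the favourable sign: it contributes at least
  \<open>3 * \<epsilon>\<close>, which pays for the \<open>\<epsilon>\<close> in
  \<open>BQ1_le\<close>.\<close>

lemma top_G_pos:
  assumes p: "p \<in> kbox" and y: "snd p \<ge> 1 / 2"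
  shows "G p > 0"
proof (rule G_pos[OF p])
  have "6 * \<epsilon> * snd p \<ge> 6 * \<epsilon> * (1 / 2)" using y pos by (intro mult_left_mono) auto
  moreover have "12 * Q 2 p \<le> c2 * Q 2 p" using const_bounds Q_pos[of 2 p] by (intro mult_right_mono) auto
  ultimately show "\<epsilon> + Q 2 p \<le> - Uxx p"
    using minus_Uxx_ge[OF p] BQ1_le[of p] Q_pos[of 2 p] pos(1) by linarith
  show "Ux p \<noteq> 0 \<or> Uy p \<noteq> 0" using Uy_bound[OF p] s_A(3) y by auto
qed

text \<open>In the inner region \<open>Q 4 p = Q 2 p * (T p)\<^sup>2\<close> is at most
  \<open>4 * s\<close>, so the polynomial and the cubic perturbation are both of order
  \<open>s\<close>.\<close>

lemma U_inner_approx: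
  assumes p: "p \<in> kbox" and q: "Q 2 p \<le> 4 * \<epsilon>"
  shows "\<bar>U p - (1 / 2 - (snd p)\<^sup>2 / 2)\<bar> \<le> A * s"
proof -
  have y: "\<bar>snd p\<bar> \<le> 2" using p by (simp add: kbox_def)
  have "B * Q 3 p \<le> B * Q 4 p"
    using B Q_mono[of 3 p] by (intro mult_left_mono) (auto simp: numeral_eq_Suc)
  then have "\<bar>e * V0 p\<bar> \<le> (1 + B) * Q 4 p"
    using scaled_bounds(1)[OF y] Q_pos[of 4 p] by (simp add: algebra_simps)
  also have "\<dots> \<le> (1 + B) * (4 * s)"
  proof (intro mult_left_mono)
    have "Q 4 p \<le> 4 * \<epsilon> * (T p)\<^sup>2" unfolding Q_steps(4) using q by (intro mult_right_mono) auto
    then show "Q 4 p \<le> 4 * s" using box_bounds(5)[OF p] by simp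
  qed (use B in auto)
  finally have "\<bar>U p - (1 / 2 - (snd p)\<^sup>2 / 2)\<bar> \<le> (18 + 4 * B) * s"
    using cubic_bound[OF p] box_bounds(5)[OF p] unfolding U_def by (simp add: algebra_simps)
  also have "\<dots> \<le> A * s" using pos const_bounds by (intro mult_right_mono) (auto simp: A_def)
  finally show ?thesis .
qed

section \<open>Connectedness and boundary of the positivity set\<close>

definition "\<Omega>' = {p \<in> obox. U p > 0}"

lemma cont: "continuous_on S U" "continuous_on S Ux" "continuous_on S Uy" "continuous_on S Uxx"
  "continuous_on S Uxy" "continuous_on S Uyy" "continuous_on S G"
  using U_derivatives G_derivative
  by (meson continuous_at_imp_continuous_on has_derivative_continuous)+

lemma obox_props: "open obox" "obox \<subseteq> kbox" "closed kbox" "bounded obox" "closure obox \<subseteq> kbox"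
proof -
  show "open obox" unfolding obox_def by (intro open_Collect_conj open_Collect_less continuous_intros)
  show 1: "obox \<subseteq> kbox" by (auto simp: obox_def kbox_def)
  show 2: "closed kbox" unfolding kbox_def by (intro closed_Collect_conj closed_Collect_le continuous_intros)
  show "closure obox \<subseteq> kbox" using 1 2 by (rule closure_minimal)
  have "obox \<subseteq> {- \<tau>..\<tau>} \<times> {-2..2}" by (auto simp: obox_def)
  moreover have "bounded ({- \<tau>..\<tau>} \<times> {-2..2::real})" by (intro bounded_Times) auto
  ultimately show "bounded obox" by (rule bounded_subset[rotated])
qed

lemma U_upper:
  assumes p: "p \<in> kbox"
  shows "U p \<le> 1 / 2 - (snd p)\<^sup>2 / 2 - Q 4 p + A * s"
proof -
  have y: "\<bar>snd p\<bar> \<le> 2" using p by (simp add: kbox_def)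
  have "B * Q 3 p \<le> B * (4 * s)" using box_bounds(3)[OF p] B by (intro mult_left_mono) auto
  then have "e * V0 p \<le> - Q 4 p + B * (4 * s)"
    using scaled_bounds(1)[OF y] unfolding abs_le_iff by linarith
  then have "U p \<le> 1 / 2 - (snd p)\<^sup>2 / 2 - Q 4 p + (14 + 4 * B) * s"
    using cubic_bound[OF p] box_bounds(5)[OF p] unfolding U_def abs_le_iff by (simp add: algebra_simps)
  moreover have "(14 + 4 * B) * s \<le> A * s" using pos const_bounds by (intro mult_right_mono) (auto simp: A_def)
  ultimately show ?thesis by linarith
qed

text \<open>The origin of the two box constants: at height 2 the parabola is at -3/2, and at
  \<open>T p = \<tau>\<close> the term \<open>Q 4\<close> equals 4; either beats the error
  \<open>A * s\<close>.\<close>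

lemma U_neg_rim:
  assumes p: "p \<in> kbox" "p \<notin> obox"
  shows "U p < 0"
proof -
  have "\<bar>snd p\<bar> = 2 \<or> \<bar>fst p\<bar> = \<tau> - 1" using p by (auto simp: kbox_def obox_def)
  then show ?thesis
  proof
    assume "\<bar>snd p\<bar> = 2"
    then have "(snd p)\<^sup>2 = 4" by (metis power2_abs power2_eq_square mult_2 numeral_Bit0)
    then show ?thesis using U_upper[OF p(1)] Q_pos[of 4 p] s_A(3) by linarith
  next
    assume "\<bar>fst p\<bar> = \<tau> - 1"
    then have "Q 4 p = 4" using e\<tau> by (simp add: Q_def T_def)
    then show ?thesis using U_upper[OF p(1)] s_A(3) zero_le_power2[of "snd p"] by linarith
  qed
qed

lemma zero_in_obox: "p \<in> kbox \<Longrightarrow> U p \<ge> 0 \<Longrightarrow> p \<in> obox"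
  by (metis U_neg_rim not_le)

lemma inner_zero_height:
  assumes p: "p \<in> kbox" and q: "Q 2 p \<le> 4 * \<epsilon>" and z: "U p = 0"
  shows "3 / 4 \<le> \<bar>snd p\<bar>" "\<bar>snd p\<bar> \<le> 5 / 4"
proof -
  have "\<bar>0 - (1 / 2 - (snd p)\<^sup>2 / 2)\<bar> \<le> A * s"
    using U_inner_approx[OF p q] unfolding z .
  then have "9 / 16 \<le> (snd p)\<^sup>2" "(snd p)\<^sup>2 \<le> 25 / 16"
    using s_A(3) unfolding abs_le_iff by linarith+
  then have "(3 / 4)\<^sup>2 \<le> (snd p)\<^sup>2" "(snd p)\<^sup>2 \<le> (5 / 4)\<^sup>2"
    by (simp_all add: power_divide)
  then show "3 / 4 \<le> \<bar>snd p\<bar>" "\<bar>snd p\<bar> \<le> 5 / 4"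
    using abs_le_square_iff[of "3 / 4" "snd p"] abs_le_square_iff[of "snd p" "5 / 4"] by auto
qed

lemma zero_regular:
  assumes p: "p \<in> kbox" and z: "U p = 0"
  shows "Ux p \<noteq> 0 \<or> Uy p \<noteq> 0"
proof (cases "4 * \<epsilon> \<le> Q 2 p")
  case True
  then show ?thesis using outer_Ux[OF p True] by auto
next
  case False
  then show ?thesis using inner_zero_height(1)[OF p _ z] Uy_bound[OF p] s_A(3) by fastforce
qed

lemma T_Q_mono: "\<bar>fst p\<bar> \<le> \<bar>fst q\<bar> \<Longrightarrow> T p \<le> T q \<and> Q j p \<le> Q j q"
  using pos T_ge[of p] by (auto simp: T_def Q_def intro!: mult_left_mono power_mono)

lemma axis_pos:
  assumes "p \<in> kbox" "Q 2 p \<le> 4 * \<epsilon>" "snd p = 0"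
  shows "U p > 0"
  using U_inner_approx[OF assms(1,2)] assms(3) s_A(3) by (simp add: abs_le_iff)

lemma e_le_\<epsilon>: "e \<le> \<epsilon>"
proof -
  have "s * \<epsilon> \<le> 1 * \<epsilon>" using s_A(4) pos by (intro mult_right_mono) auto
  then show ?thesis using e_le by linarith
qed

text \<open>Locates the interface between the inner and the outer region; at \<open>t = 0\<close>
  the left side is \<open>e\<close>, which is below \<open>4 * \<epsilon>\<close>.\<close>

lemma ex_Q2_eq:
  assumes "4 * \<epsilon> \<le> e * (1 + b) ^ (N + 2)" "b \<ge> 0"
  obtains t where "0 \<le> t" "t \<le> b" "e * (1 + t) ^ (N + 2) = 4 * \<epsilon>"
proof -
  have "e \<le> 4 * \<epsilon>"
    using e_le_\<epsilon> pos by linarith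
  then have "\<exists>t. 0 \<le> t \<and> t \<le> b \<and> e * (1 + t) ^ (N + 2) = 4 * \<epsilon>"
    using assms by (intro IVT') (auto intro!: continuous_intros)
  then show thesis using that by blast
qed

lemma origin_in: "(0, 0) \<in> \<Omega>'"
proof -
  have o: "(0, 0) \<in> obox" using \<tau>2 by (simp add: obox_def)
  have "e \<le> 4 * \<epsilon>"
    using e_le_\<epsilon> pos by linarith
  then have "U (0, 0) > 0"
    using o obox_props(2) by (intro axis_pos) (auto simp: Q_def T_def)
  then show ?thesis using o by (simp add: \<Omega>'_def)
qed

text \<open>By concavity in y the vertical segment down or up to the axis stays in the set, because
  its axis endpoint is positive; from there one follows the axis to the origin.\<close>

lemma inner_connected_origin:
  assumes p: "p \<in> \<Omega>'" and q: "Q 2 p \<le> 4 * \<epsilon>"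
  shows "connected_component \<Omega>' p (0, 0)"
proof -
  obtain x y where xy: "p = (x, y)" by (cases p)
  have pk: "p \<in> obox" "U p > 0" using p by (auto simp: \<Omega>'_def)
  have ax: "(t, 0) \<in> \<Omega>'" if "\<bar>t\<bar> \<le> \<bar>x\<bar>" for t
  proof -
    have "(t, 0) \<in> obox" using that pk by (auto simp: obox_def xy)
    moreover from this have "U (t, 0) > 0"
      using T_Q_mono[of "(t, 0)" p 2] that q obox_props(2) by (intro axis_pos) (auto simp: xy)
    ultimately show ?thesis by (simp add: \<Omega>'_def)
  qed
  have "convex_on {-2..2} (\<lambda>t. - U (x, t))"
  proof (rule f''_ge0_imp_convex)
    show "((\<lambda>t. - U (x, t)) has_real_derivative - Uy (x, t)) (at t)" for t
      using has_derivative_D1D2(4)[OF U_derivatives(1)[of "(x, t)"]] by (auto intro: DERIV_minus)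
    show "((\<lambda>t. - Uy (x, t)) has_real_derivative - Uyy (x, t)) (at t)" for t
      using has_derivative_D1D2(4)[OF U_derivatives(3)[of "(x, t)"]] by (auto intro: DERIV_minus)
    show "- Uyy (x, t) \<ge> 0" if "t \<in> {-2..2}" for t
    proof -
      have "(x, t) \<in> kbox" using that pk by (auto simp: kbox_def obox_def xy)
      then show ?thesis using Uyy_bound[of "(x, t)"] s_A(3) by (auto simp: abs_le_iff)
    qed
  qed auto
  then have cv: "- U (x, (1 - t) *\<^sub>R y + t *\<^sub>R 0) \<le> (1 - t) * (- U (x, y)) + t * (- U (x, 0))"
    if "0 \<le> t" "t \<le> 1" for t
    using that pk by (intro convex_onD) (auto simp: obox_def xy)
  have seg1: "closed_segment p (x, 0) \<subseteq> \<Omega>'"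
  proof
    fix z assume "z \<in> closed_segment p (x, 0)"
    then obtain t where t: "0 \<le> t" "t \<le> 1" "z = (1 - t) *\<^sub>R p + t *\<^sub>R (x, 0)"
      by (auto simp: in_segment)
    then have z: "z = (x, (1 - t) * y)" by (simp add: xy algebra_simps)
    have "\<bar>(1 - t) * y\<bar> \<le> 1 * \<bar>y\<bar>" unfolding abs_mult using t by (intro mult_right_mono) auto
    then have "z \<in> obox" using pk by (simp add: obox_def z xy)
    moreover have "(1 - t) * U (x, y) + t * U (x, 0) > 0"
    proof (cases "t = 1")
      case True
      then show ?thesis using ax[of x] by (simp add: \<Omega>'_def)
    next
      case False
      then have "(1 - t) * U (x, y) > 0" "t * U (x, 0) \<ge> 0"
        using t pk ax[of x] by (auto simp: xy \<Omega>'_def)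
      then show ?thesis by linarith
    qed
    then have "U z > 0" using cv[OF t(1,2)] by (simp add: z)
    ultimately show "z \<in> \<Omega>'" by (simp add: \<Omega>'_def)
  qed
  have seg2: "closed_segment (x, 0) (0, 0) \<subseteq> \<Omega>'"
  proof
    fix z :: "real \<times> real" assume "z \<in> closed_segment (x, 0) (0, 0)"
    then obtain t where t: "0 \<le> t" "t \<le> 1" "z = (1 - t) *\<^sub>R (x, 0) + t *\<^sub>R (0, 0)"
      by (auto simp: in_segment)
    then have z: "z = ((1 - t) * x, 0)" by simp
    have "\<bar>(1 - t) * x\<bar> \<le> 1 * \<bar>x\<bar>" unfolding abs_mult using t by (intro mult_right_mono) auto
    then show "z \<in> \<Omega>'" using ax by (simp add: z)
  qed
  have "connected_component \<Omega>' p (x, 0)" "connected_component \<Omega>' (x, 0) (0, 0)"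
    using seg1 seg2 unfolding connected_component_def by (blast intro: connected_segment)+
  then show ?thesis by (rule connected_component_trans)
qed

text \<open>Moving horizontally towards the axis increases \<open>U\<close> as long as the point is
  in the outer region, so the path stays in the set until it reaches the interface.\<close>

lemma outer_connected_inner:
  assumes p: "p \<in> \<Omega>'" and q: "4 * \<epsilon> \<le> Q 2 p"
  shows "\<exists>p'. connected_component \<Omega>' p p' \<and> Q 2 p' \<le> 4 * \<epsilon>"
proof -
  obtain x y where xy: "p = (x, y)" by (cases p)
  have pk: "p \<in> obox" "U p > 0" using p by (auto simp: \<Omega>'_def)
  obtain b where b: "0 \<le> b" "b \<le> \<bar>x\<bar>" "e * (1 + b) ^ (N + 2) = 4 * \<epsilon>"
    using ex_Q2_eq[of "\<bar>x\<bar>"] q by (auto simp: Q_def T_def xy)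
  define \<sigma> where "\<sigma> = sgn x"
  have "x \<noteq> 0" using T_large[OF outer_large[OF q]] B by (auto simp: T_def xy)
  then have \<sigma>: "\<sigma> * \<bar>x\<bar> = x" "\<bar>\<sigma>\<bar> = 1" "\<sigma> * \<sigma> = 1" by (auto simp: \<sigma>_def sgn_if)
  have b0: "b > 0"
  proof (rule ccontr)
    assume "\<not> b > 0"
    then have "b = 0" using b by simp
    then have "e = 4 * \<epsilon>" using b(3) by simp
    then show False using e_le_\<epsilon> pos by linarith
  qed
  have mem: "(\<sigma> * t, y) \<in> kbox \<and> 4 * \<epsilon> \<le> Q 2 (\<sigma> * t, y) \<and> sgn (\<sigma> * t) = \<sigma>"
    if "b \<le> t" "t \<le> \<bar>x\<bar>" for t
  proof -
    have a: "\<bar>\<sigma> * t\<bar> = t" using \<sigma> that b by (simp add: abs_mult)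
    have "e * (1 + b) ^ (N + 2) \<le> e * (1 + t) ^ (N + 2)"
      using that b pos by (intro mult_left_mono power_mono) auto
    then have "4 * \<epsilon> \<le> Q 2 (\<sigma> * t, y)" using b(3) a by (simp add: Q_def T_def)
    moreover have "(\<sigma> * t, y) \<in> kbox" using pk that a by (auto simp: kbox_def obox_def xy)
    moreover have "sgn (\<sigma> * t) = \<sigma>" using that b0 by (simp add: sgn_mult \<sigma>_def)
    ultimately show ?thesis by simp
  qed
  have der: "((\<lambda>t. U (\<sigma> * t, y)) has_real_derivative \<sigma> * Ux (\<sigma> * t, y)) (at t)" for t
  proof -
    have "((\<lambda>x. U (x, y)) has_real_derivative Ux (\<sigma> * t, y)) (at (\<sigma> * t))"
      using has_derivative_D1D2(3)[OF U_derivatives(1)[of "(\<sigma> * t, y)"]] by simp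
    moreover have "((\<lambda>t. \<sigma> * t) has_real_derivative \<sigma>) (at t)"
      by (auto intro!: derivative_eq_intros)
    ultimately show ?thesis
      by (rule DERIV_cong[OF DERIV_chain2]) (rule mult.commute)
  qed
  have dec: "U (\<sigma> * t, y) \<ge> U (x, y)" if t: "b \<le> t" "t \<le> \<bar>x\<bar>" for t
  proof -
    have "U (\<sigma> * \<bar>x\<bar>, y) \<le> U (\<sigma> * t, y)"
    proof (rule DERIV_nonpos_imp_nonincreasing[OF t(2)])
      fix r assume r: "t \<le> r" "r \<le> \<bar>x\<bar>"
      then have "\<sigma> * Ux (\<sigma> * r, y) < 0"
        using mem[of r] t outer_Ux[of "(\<sigma> * r, y)"] by auto
      then show "\<exists>d. ((\<lambda>t. U (\<sigma> * t, y)) has_real_derivative d) (at r) \<and> d \<le> 0"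
        using der[of r] less_imp_le by blast
    qed
    then show ?thesis by (simp add: \<sigma>)
  qed
  have im: "(\<lambda>t. (\<sigma> * t, y)) ` {b..\<bar>x\<bar>} \<subseteq> \<Omega>'"
  proof
    fix z assume "z \<in> (\<lambda>t. (\<sigma> * t, y)) ` {b..\<bar>x\<bar>}"
    then obtain t where t: "b \<le> t" "t \<le> \<bar>x\<bar>" "z = (\<sigma> * t, y)" by auto
    have "U z > 0" using dec[OF t(1,2)] pk by (simp add: t(3) xy)
    then show "z \<in> \<Omega>'" using zero_in_obox[of z] mem[OF t(1,2)] by (simp add: \<Omega>'_def t(3))
  qed
  have "connected ((\<lambda>t. (\<sigma> * t, y)) ` {b..\<bar>x\<bar>})"
    by (intro connected_continuous_image continuous_intros) auto
  moreover have "p \<in> (\<lambda>t. (\<sigma> * t, y)) ` {b..\<bar>x\<bar>}" "(\<sigma> * b, y) \<in> (\<lambda>t. (\<sigma> * t, y)) ` {b..\<bar>x\<bar>}"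
    using b(2) \<sigma>(1) by (auto simp: xy intro: image_eqI[where x = "\<bar>x\<bar>"] image_eqI[where x = b])
  ultimately have "connected_component \<Omega>' p (\<sigma> * b, y)"
    using im unfolding connected_component_def by blast
  moreover have "\<bar>\<sigma> * b\<bar> = b" using \<sigma> b by (simp add: abs_mult)
  then have "Q 2 (\<sigma> * b, y) \<le> 4 * \<epsilon>" using b(3) by (simp add: Q_def T_def)
  ultimately show ?thesis by blast
qed

lemma \<Omega>'_connected: "connected \<Omega>'"
proof -
  have c: "connected_component \<Omega>' p (0, 0)" if p: "p \<in> \<Omega>'" for p
  proof (cases "Q 2 p \<le> 4 * \<epsilon>")
    case True
    then show ?thesis by (rule inner_connected_origin[OF p])
  next
    case False
    then obtain p' where p': "connected_component \<Omega>' p p'" "Q 2 p' \<le> 4 * \<epsilon>"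
      using outer_connected_inner[OF p] by auto
    then show ?thesis
      using inner_connected_origin[of p'] connected_component_trans connected_component_in by blast
  qed
  then show ?thesis
    unfolding connected_iff_connected_component
    using connected_component_trans connected_component_sym by blast
qed

text \<open>A connected set of positivity cannot leave the box, since on the frontier of the box
  \<open>U\<close> is negative. This is what ties the explicit set to the connected component that
  defines the domain.\<close>

lemma component_eq:
  assumes "a \<in> \<Omega>'"
  shows "connected_component_set {p. U p > 0} a = \<Omega>'"
proof
  show "\<Omega>' \<subseteq> connected_component_set {p. U p > 0} a"
    by (rule connected_component_maximal[OF assms \<Omega>'_connected]) (auto simp: \<Omega>'_def)
  let ?K = "connected_component_set {p. U p > 0} a"
  have K: "connected ?K" "?K \<subseteq> {p. U p > 0}"
    by (rule connected_connected_component) (rule connected_component_subset)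
  have "a \<in> ?K" using assms by (simp add: \<Omega>'_def)
  have "?K \<subseteq> obox"
  proof (rule ccontr)
    assume "\<not> ?K \<subseteq> obox"
    then have "?K - obox \<noteq> {}" by blast
    moreover have "a \<in> ?K \<inter> obox" using assms \<open>a \<in> ?K\<close> by (simp add: \<Omega>'_def)
    then have "?K \<inter> obox \<noteq> {}" by blast
    ultimately have "?K \<inter> frontier obox \<noteq> {}"
      by (intro connected_Int_frontier K)
    then obtain z where z: "z \<in> ?K" "z \<in> frontier obox" by blast
    then have "z \<in> kbox" "z \<notin> obox"
      using obox_props by (auto simp: frontier_def interior_open)
    then show False using U_neg_rim[of z] z(1) K(2) by force
  qed
  then show "?K \<subseteq> \<Omega>'" using K(2) by (auto simp: \<Omega>'_def)
qed

lemma \<Omega>'_open: "open \<Omega>'"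
proof -
  have "\<Omega>' = obox \<inter> {p. U p > 0}" by (auto simp: \<Omega>'_def)
  then show ?thesis
    using obox_props(1) cont(1)[of UNIV] by (auto intro!: open_Int open_Collect_less continuous_intros)
qed

lemma frontier_\<Omega>': "frontier \<Omega>' = {p \<in> obox. U p = 0}"
proof
  have "closure \<Omega>' \<subseteq> kbox \<inter> {p. U p \<ge> 0}"
  proof (rule closure_minimal)
    show "\<Omega>' \<subseteq> kbox \<inter> {p. 0 \<le> U p}" using obox_props(2) by (auto simp: \<Omega>'_def)
    show "closed (kbox \<inter> {p. 0 \<le> U p})"
      using obox_props(3) cont(1)[of UNIV] by (auto intro!: closed_Int closed_Collect_le continuous_intros)
  qed
  then show "frontier \<Omega>' \<subseteq> {p \<in> obox. U p = 0}"
    using zero_in_obox \<Omega>'_open by (fastforce simp: frontier_def interior_open \<Omega>'_def)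
  show "{p \<in> obox. U p = 0} \<subseteq> frontier \<Omega>'"
  proof
    fix p assume p: "p \<in> {p \<in> obox. U p = 0}"
    \<comment> \<open>A zero away from the closure would be a local maximum of \<open>U\<close>,
      hence critical, against regularity.\<close>
    have "p \<in> closure \<Omega>'"
    proof (rule ccontr)
      assume "p \<notin> closure \<Omega>'"
      then have "p \<in> - closure \<Omega>' \<inter> obox" using p by auto
      moreover have "open (- closure \<Omega>' \<inter> obox)" using obox_props(1) by auto
      ultimately obtain d where d: "d > 0" "ball p d \<subseteq> - closure \<Omega>' \<inter> obox" using openE by blast
      have "U q \<le> U p" if "q \<in> ball p d" for q
        using that d(2) p closure_subset[of \<Omega>'] by (force simp: \<Omega>'_def)
      from differential_zero_maxmin[OF _ open_ball[of p d] U_derivatives(1)[of p]] this d(1)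
      have "(\<lambda>h. Ux p * fst h + Uy p * snd h) = (\<lambda>v. 0)" by auto
      from fun_cong[OF this, of "(1, 0)"] fun_cong[OF this, of "(0, 1)"]
      show False using zero_regular[of p] p obox_props(2) by auto
    qed
    then show "p \<in> frontier \<Omega>'"
      using p \<Omega>'_open by (auto simp: frontier_def interior_open \<Omega>'_def)
  qed
qed

sublocale lvl: regular_level_domain \<Omega>' obox U Ux Uy Uxx Uxy Uyy
proof
  show "open obox" by (rule obox_props)
  show "frontier \<Omega>' = {p \<in> obox. U p = 0}" by (rule frontier_\<Omega>')
  show "Ux p \<noteq> 0 \<or> Uy p \<noteq> 0" if "p \<in> frontier \<Omega>'" for p
    using that zero_regular[of p] obox_props(2) by (auto simp: frontier_\<Omega>')
qed (use U_derivatives cont in \<open>auto simp: \<Omega>'_def\<close>)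

lemma curv_num_eq: "lvl.curv_num = G"
  by (auto simp: fun_eq_iff lvl.curv_num_def G_def)

lemma frontier_\<Omega>'_compact: "compact (frontier \<Omega>')"
  using obox_props(4) by (intro compact_frontier_bounded bounded_subset[OF obox_props(4)]) (auto simp: \<Omega>'_def)

end

lemma planar_mean_value:
  fixes F Fx Fy :: "real \<times> real \<Rightarrow> real"
  assumes "\<And>p. (F has_derivative (\<lambda>h. Fx p * fst h + Fy p * snd h)) (at p)"
  obtains \<xi> where "\<xi> \<in> closed_segment p q"
    "F q - F p = Fx \<xi> * (fst q - fst p) + Fy \<xi> * (snd q - snd p)"
proof -
  define c where "c t = p + t *\<^sub>R (q - p)" for t
  have d: "((\<lambda>t. F (c t)) has_derivative
      (\<lambda>h. Fx (c t) * fst (h *\<^sub>R (q - p)) + Fy (c t) * snd (h *\<^sub>R (q - p)))) (at t within S)" for t S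
    unfolding c_def
    by (rule has_derivative_compose[OF _ assms]) (auto intro!: derivative_eq_intros)
  obtain t where t: "t \<in> {0<..<1::real}"
    "F (c 1) - F (c 0) = Fx (c t) * fst ((1 - 0) *\<^sub>R (q - p)) + Fy (c t) * snd ((1 - 0) *\<^sub>R (q - p))"
    using mvt_simple[OF _ d, of 0 1] by auto
  have "c t \<in> closed_segment p q"
    using t(1) by (auto simp: in_segment c_def algebra_simps intro!: exI[of _ t])
  then show thesis
    using t(2) by (intro that[of "c t"]) (auto simp: c_def)
qed

section \<open>The lower arc: zeros and minimum of the curvature\<close>

context strip
begin

text \<open>A convex neighbourhood of the inner part of the lower arc, so that mean value arguments
  along chords stay inside it. The heights come from \<open>inner_zero_height\<close>.\<close>

definition "bottom = {p \<in> kbox. Q 2 p \<le> 4 * \<epsilon> \<and> snd p \<in> {- 5 / 4..- 3 / 4}}"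

lemma bottom_bounds:
  assumes b: "p \<in> bottom"
  shows "\<bar>Ux p\<bar> \<le> A * (\<epsilon> * T p)" "1 / 2 \<le> Uy p" "\<bar>Uy p\<bar> \<le> 3 / 2" "\<bar>Uxx p\<bar> \<le> A * \<epsilon>"
    "\<bar>Uxy p\<bar> \<le> A * (\<epsilon> * T p)" "\<bar>Uyy p\<bar> \<le> 2" "\<bar>e * V3 p\<bar> \<le> A * \<epsilon>" "\<bar>6 * \<epsilon> + e * W3 p\<bar> \<le> A * \<epsilon>"
proof -
  have p: "p \<in> kbox" and q: "Q 2 p \<le> 4 * \<epsilon>" and y: "snd p \<le> - 3 / 4" "- 5 / 4 \<le> snd p" "\<bar>snd p\<bar> \<le> 2"
    using b by (auto simp: bottom_def)
  have T1: "T p \<ge> 1" by (rule T_ge)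
  have Q1: "B * Q 1 p \<le> B * (4 * \<epsilon>)" "B * Q 0 p \<le> B * (4 * \<epsilon>)"
    using Q_monos[of p] q B by (auto intro!: mult_left_mono)
  have \<epsilon>T: "\<epsilon> \<le> \<epsilon> * T p" using T1 pos by simp
  have c: "c1 \<le> c2" "0 \<le> c3" using const_bounds by auto
  have "Q 3 p \<le> 4 * \<epsilon> * T p" unfolding Q_steps(3) using q T1 by (intro mult_right_mono) auto
  then have "(c1 + B) * Q 3 p \<le> (c1 + B) * (4 * \<epsilon> * T p)"
    using const_bounds B by (intro mult_left_mono) auto
  then have "\<bar>Ux p\<bar> \<le> (12 + 4 * c1 + 4 * B) * (\<epsilon> * T p)"
    using Ux_bound[OF p] by (simp add: algebra_simps)
  also have "\<dots> \<le> A * (\<epsilon> * T p)"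
    using pos T1 c by (intro mult_right_mono) (auto simp: A_def)
  finally show "\<bar>Ux p\<bar> \<le> A * (\<epsilon> * T p)" .
  show "1 / 2 \<le> Uy p" "\<bar>Uy p\<bar> \<le> 3 / 2"
    using Uy_bound[OF p] s_A(3) y unfolding abs_le_iff by linarith+
  have e6: "\<bar>6 * \<epsilon> * snd p\<bar> \<le> 6 * \<epsilon> * 2" using y pos by (intro abs_mult_le) auto
  have "(c2 + B) * Q 2 p \<le> (c2 + B) * (4 * \<epsilon>)"
    using q const_bounds B by (intro mult_left_mono) auto
  then have "\<bar>Uxx p\<bar> \<le> (12 + 4 * c2 + 4 * B) * \<epsilon>"
    using eV2_bound[OF p] e6 unfolding Uxx_def by (simp add: algebra_simps)
  also have "\<dots> \<le> A * \<epsilon>" using pos c by (intro mult_right_mono) (auto simp: A_def)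
  finally show "\<bar>Uxx p\<bar> \<le> A * \<epsilon>" .
  have "B * (4 * \<epsilon>) \<le> B * (4 * (\<epsilon> * T p))" using \<epsilon>T B by (intro mult_left_mono) auto
  then have "\<bar>Uxy p\<bar> \<le> (6 + 4 * B) * (\<epsilon> * T p)"
    using Uxy_bound[OF p] Q1(1) by (simp add: algebra_simps)
  also have "\<dots> \<le> A * (\<epsilon> * T p)" using pos T1 const_bounds by (intro mult_right_mono) (auto simp: A_def)
  finally show "\<bar>Uxy p\<bar> \<le> A * (\<epsilon> * T p)" .
  show "\<bar>Uyy p\<bar> \<le> 2" using Uyy_bound[OF p] s_A(3) unfolding abs_le_iff by linarith
  have "\<bar>c3 * sgn (fst p) * Q 1 p\<bar> \<le> c3 * (4 * \<epsilon>)"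
  proof -
    have "c3 * \<bar>Q 1 p\<bar> \<le> c3 * (4 * \<epsilon>)"
      using Q_monos(2)[of p] q Q_pos[of 1 p] c by (intro mult_left_mono) auto
    then show ?thesis using sgn_bound[OF c(2), of "fst p" "Q 1 p"] by linarith
  qed
  then have "\<bar>e * V3 p\<bar> \<le> (4 * c3 + 4 * B) * \<epsilon>"
    using scaled_bounds(4)[OF y(3)] Q1(2) unfolding abs_le_iff by (simp add: algebra_simps)
  also have "\<dots> \<le> A * \<epsilon>" using pos const_bounds by (intro mult_right_mono) (auto simp: A_def)
  finally show "\<bar>e * V3 p\<bar> \<le> A * \<epsilon>" .
  have "\<bar>6 * \<epsilon> + e * W3 p\<bar> \<le> (6 + 4 * B) * \<epsilon>"
    using scaled_bounds(7)[OF y(3)] Q1(2) pos unfolding abs_le_iff by (simp add: algebra_simps)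
  also have "\<dots> \<le> A * \<epsilon>" using pos const_bounds by (intro mult_right_mono) (auto simp: A_def)
  finally show "\<bar>6 * \<epsilon> + e * W3 p\<bar> \<le> A * \<epsilon>" .
qed

lemma bottom_small:
  assumes "p \<in> bottom"
  shows "(A * (\<epsilon> * T p))\<^sup>2 \<le> A\<^sup>2 * s * \<epsilon>" "A * (\<epsilon> * T p) \<le> A * s"
proof -
  have p: "p \<in> kbox" using assms by (simp add: bottom_def)
  have "(A * (\<epsilon> * T p))\<^sup>2 = A\<^sup>2 * (\<epsilon> * (T p)\<^sup>2) * \<epsilon>" by (simp add: power2_eq_square)
  also have "\<dots> \<le> A\<^sup>2 * s * \<epsilon>"
    using box_bounds(5)[OF p] pos by (intro mult_right_mono mult_left_mono) auto
  finally show "(A * (\<epsilon> * T p))\<^sup>2 \<le> A\<^sup>2 * s * \<epsilon>" .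
  show "A * (\<epsilon> * T p) \<le> A * s"
    using box_bounds(6)[OF p] const_bounds by (intro mult_left_mono) auto
qed

text \<open>Both terms are quadratic in quantities of size \<open>A * \<epsilon> * T p\<close>, and
  \<open>\<epsilon> * (T p)\<^sup>2\<close> is at most \<open>s\<close>; so they are small against
  \<epsilon>, the scale of the remaining term of \<open>G\<close>.\<close>

lemma bottom_squares:
  assumes b: "p \<in> bottom"
  shows "\<bar>2 * Uxy p * Ux p * Uy p\<bar> \<le> \<epsilon> / 10" "\<bar>Uyy p * (Ux p)\<^sup>2\<bar> \<le> \<epsilon> / 10"
proof -
  note bb = bottom_bounds[OF b]
  have sq: "(A * (\<epsilon> * T p))\<^sup>2 \<le> \<epsilon> / 100000"
    using order_trans[OF bottom_small(1)[OF b] mult_right_mono[OF s_A(2), of \<epsilon>]] pos by simp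
  have "\<bar>2 * Uxy p * Ux p * Uy p\<bar> \<le> 2 * (A * (\<epsilon> * T p)) * (A * (\<epsilon> * T p)) * (3 / 2)"
    by (intro abs_mult_le bb) auto
  also have "\<dots> = 3 * (A * (\<epsilon> * T p))\<^sup>2" by (simp add: power2_eq_square)
  also have "\<dots> \<le> \<epsilon> / 10" using sq pos by simp
  finally show "\<bar>2 * Uxy p * Ux p * Uy p\<bar> \<le> \<epsilon> / 10" .
  have "\<bar>Uyy p * (Ux p * Ux p)\<bar> \<le> 2 * ((A * (\<epsilon> * T p)) * (A * (\<epsilon> * T p)))"
    by (intro abs_mult_le bb)
  also have "\<dots> = 2 * (A * (\<epsilon> * T p))\<^sup>2" by (simp add: power2_eq_square)
  also have "\<dots> \<le> \<epsilon> / 10" using sq pos by simp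
  finally show "\<bar>Uyy p * (Ux p)\<^sup>2\<bar> \<le> \<epsilon> / 10" by (simp add: power2_eq_square)
qed

lemma bottom_G_bound:
  assumes b: "p \<in> bottom"
  shows "\<bar>G p\<bar> \<le> 4 * (A * \<epsilon>)"
proof -
  note bb = bottom_bounds[OF b]
  have "\<bar>Uxx p * (Uy p * Uy p)\<bar> \<le> A * \<epsilon> * ((3 / 2) * (3 / 2))"
    by (intro abs_mult_le bb)
  moreover have "160 * \<epsilon> \<le> A * \<epsilon>" using const_bounds pos by (intro mult_right_mono) auto
  ultimately show ?thesis
    using bottom_squares[OF b] pos unfolding G_def power2_eq_square[of "Uy p"] abs_le_iff
    by (intro conjI; linarith)
qed

text \<open>At height below -3/4 the cubic term gives \<open>Uxx\<close> at least 9/2 times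
  \<epsilon>, and the hypothesis lets \<open>F\<close> take away at most \<epsilon>. With
  \<open>Uy\<close> at least 1/2 the main term outweighs the squares.\<close>

lemma inner_G_neg:
  assumes b: "p \<in> bottom" and i: "(c2 + B) * Q 2 p \<le> \<epsilon>"
  shows "G p < 0"
proof -
  note bb = bottom_bounds[OF b]
  have p: "p \<in> kbox" and y: "snd p \<le> - 3 / 4" using b by (auto simp: bottom_def)
  have "6 * \<epsilon> * snd p \<le> 6 * \<epsilon> * (- 3 / 4)" using y pos by (intro mult_left_mono) auto
  then have xx: "Uxx p \<ge> 7 / 2 * \<epsilon>"
    using eV2_bound[OF p] i unfolding Uxx_def abs_le_iff by simp
  have "(1 / 2) * (1 / 2) \<le> Uy p * Uy p" using bb(2) by (intro mult_mono) auto
  then have "7 / 2 * \<epsilon> * (1 / 4) \<le> Uxx p * (Uy p)\<^sup>2"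
    using xx pos by (intro mult_mono) (auto simp: power2_eq_square)
  then show ?thesis
    using bottom_squares[OF b] pos unfolding G_def abs_le_iff by linarith
qed

text \<open>The term \<open>e * V3 * (Uy)\<^sup>2\<close> has a definite sign and size
  \<open>Q 1\<close>; multiplied by \<open>T p\<close> it becomes \<open>Q 2\<close>, which the
  hypothesis compares with \<epsilon>. The remaining terms each contain a factor
  \<open>Ux\<close>.\<close>

lemma middle_Gx:
  assumes b: "p \<in> bottom" and m: "\<epsilon> < (c2 + B) * Q 2 p"
  shows "\<epsilon> / (8 * A) \<le> T p * (sgn (fst p) * Gx p)"
proof -
  note bb = bottom_bounds[OF b]
  have p: "p \<in> kbox" and y: "\<bar>snd p\<bar> \<le> 2" using b by (auto simp: bottom_def)
  have T1: "T p \<ge> 1" by (rule T_ge)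
  have "(c2 + B) * Q 2 p \<le> A / 4 * Q 2 p"
    using const_bounds(8) Q_pos[of 2 p] by (intro mult_right_mono) auto
  then have AQ: "4 * \<epsilon> < A * Q 2 p" using m by simp
  then have L: "\<epsilon> < A * Q 2 p" using pos by linarith
  have "fst p \<noteq> 0" using T_large[OF L] B by (auto simp: T_def)
  then have sg: "sgn (fst p) * sgn (fst p) = 1" "\<bar>sgn (fst p)\<bar> = 1"
    by (auto simp: sgn_if)
  define \<sigma> where "\<sigma> = sgn (fst p)"
  have "\<bar>\<sigma> * (e * V3 p + c3 * \<sigma> * Q 1 p)\<bar> \<le> 1 * (B * Q 0 p)"
    using scaled_bounds(4)[OF y] sg unfolding \<sigma>_def by (intro abs_mult_le) auto
  moreover have "\<sigma> * (e * V3 p + c3 * \<sigma> * Q 1 p) = \<sigma> * (e * V3 p) + c3 * Q 1 p"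
    using sg(1) unfolding \<sigma>_def by (simp add: distrib_left mult.left_commute)
  moreover have "24 * Q 1 p \<le> c3 * Q 1 p" using const_bounds Q_pos[of 1 p] by (intro mult_right_mono) auto
  ultimately have v3: "Q 1 p \<le> - (\<sigma> * (e * V3 p))"
    using BQ_small(3)[OF L] Q_pos[of 1 p] unfolding abs_le_iff by linarith
  have "(1 / 2) * (1 / 2) \<le> Uy p * Uy p" using bb(2) by (intro mult_mono) auto
  then have "Q 1 p * (1 / 4) \<le> - (\<sigma> * (e * V3 p)) * (Uy p)\<^sup>2"
    using v3 Q_pos[of 1 p] by (intro mult_mono) (auto simp: power2_eq_square)
  then have "T p * (Q 1 p * (1 / 4)) \<le> T p * (- (\<sigma> * (e * V3 p)) * (Uy p)\<^sup>2)"
    using T1 by (intro mult_left_mono) auto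
  moreover have "T p * (Q 1 p * (1 / 4)) = Q 2 p / 4" by (simp add: Q_steps(2) mult.commute)
  moreover have "\<epsilon> / A \<le> Q 2 p / 4" using AQ const_bounds by (simp add: field_simps)
  ultimately have main: "\<epsilon> / A \<le> T p * (- (\<sigma> * (e * V3 p)) * (Uy p)\<^sup>2)" by linarith
  \<comment> \<open>A common bound for \<open>Ux\<close> and \<open>Uxy\<close>; since also
    \<open>T p * (A * \<epsilon>) = a\<close>, the remaining terms times \<open>T p\<close> are of
    order \<open>a\<^sup>2\<close>.\<close>
  define a where "a = A * (\<epsilon> * T p)"
  have a0: "a \<ge> 0" using const_bounds pos T1 by (simp add: a_def)
  have w: "\<bar>- 6 * \<epsilon> - e * W3 p\<bar> \<le> A * \<epsilon>" using bb(8) unfolding abs_le_iff by linarith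
  have r1: "\<bar>2 * (- 6 * \<epsilon> - e * W3 p) * Ux p * Uy p\<bar> \<le> 2 * (A * \<epsilon>) * a * (3 / 2)"
    unfolding a_def by (intro abs_mult_le bb w) auto
  have r2: "\<bar>2 * (Uxy p * Uxy p) * Ux p\<bar> \<le> 2 * (a * a) * a"
    unfolding a_def by (intro abs_mult_le bb) auto
  have r3: "\<bar>(e * V3 p) * (Ux p * Ux p)\<bar> \<le> (A * \<epsilon>) * (a * a)"
    unfolding a_def by (intro abs_mult_le bb)
  have r4: "\<bar>2 * Uyy p * Ux p * Uxx p\<bar> \<le> 2 * 2 * a * (A * \<epsilon>)"
    unfolding a_def by (intro abs_mult_le bb) auto
  define rest where "rest = 2 * (- 6 * \<epsilon> - e * W3 p) * Ux p * Uy p + 2 * (Uxy p * Uxy p) * Ux p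
    + (e * V3 p) * (Ux p * Ux p) - 2 * Uyy p * Ux p * Uxx p"
  have rb: "\<bar>rest\<bar> \<le> 7 * (A * \<epsilon>) * a + 2 * a * a * a + (A * \<epsilon>) * a * a"
    using r1 r2 r3 r4 unfolding rest_def abs_le_iff by (simp add: algebra_simps)
  have Aea: "A * \<epsilon> \<le> a" unfolding a_def using const_bounds pos T1 by simp
  have asmall: "a \<le> 1" using bottom_small(2)[OF b] s_A(3) by (simp add: a_def)
  have "2 * a * a * a \<le> 2 * a * a * 1" using asmall a0 by (intro mult_left_mono) auto
  moreover have "(A * \<epsilon>) * a * a \<le> (A * \<epsilon>) * a * 1"
    using asmall a0 const_bounds pos by (intro mult_left_mono) auto
  moreover have Ta: "T p * (A * \<epsilon>) = a" by (simp add: a_def)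
  ultimately have "T p * \<bar>rest\<bar> \<le> T p * (8 * (A * \<epsilon>) * a + 2 * a * a * a)"
    using rb T1 by (intro mult_left_mono) auto
  also have "\<dots> = 8 * a * a + 2 * (T p * a) * a * a"
    by (simp add: Ta[symmetric] algebra_simps)
  also have "(T p * a) = A * (\<epsilon> * (T p)\<^sup>2)" by (simp add: a_def power2_eq_square)
  also have "2 * (A * (\<epsilon> * (T p)\<^sup>2)) * a * a \<le> 2 * (1 / 10000000) * a * a"
  proof (intro mult_right_mono mult_left_mono)
    have "A * (\<epsilon> * (T p)\<^sup>2) \<le> A * s"
      using box_bounds(5)[OF p] const_bounds by (intro mult_left_mono) auto
    then show "A * (\<epsilon> * (T p)\<^sup>2) \<le> 1 / 10000000" using s_A(3) by linarith
  qed (use a0 in auto)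
  finally have "T p * \<bar>rest\<bar> \<le> 8 * a * a + 2 * (1 / 10000000) * a * a" by simp
  also have "\<dots> = (8 + 2 / 10000000) * a\<^sup>2" by (simp only: power2_eq_square distrib_right mult.assoc)
  also have "\<dots> \<le> 9 * a\<^sup>2" by (intro mult_right_mono) auto
  also have "\<dots> \<le> 9 * (A\<^sup>2 * s * \<epsilon>)" using bottom_small(1)[OF b] by (simp add: a_def)
  \<comment> \<open>The main term is only of order \<open>\<epsilon> / A\<close>, so a third factor
    \<open>A\<close> must be absorbed: hence the cube in \<open>s_A(1)\<close>.\<close>
  also have "\<dots> \<le> \<epsilon> / (2 * A)"
  proof -
    have "18 * (A ^ 3 * s) \<le> 1" using s_A(1) pos const_bounds by (simp add: zero_le_mult_iff)
    then have "18 * (A ^ 3 * s) * \<epsilon> \<le> 1 * \<epsilon>" using pos by (intro mult_right_mono) auto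
    then show ?thesis using const_bounds by (simp add: field_simps power2_eq_square power3_eq_cube)
  qed
  finally have rT: "T p * \<bar>rest\<bar> \<le> \<epsilon> / (2 * A)" .
  have "\<bar>T p * (\<sigma> * rest)\<bar> = T p * \<bar>rest\<bar>" using T1 sg(2) by (simp add: abs_mult \<sigma>_def)
  then have "T p * (\<sigma> * rest) \<ge> - (\<epsilon> / (2 * A))" using rT unfolding abs_le_iff by linarith
  moreover have "T p * (\<sigma> * Gx p) = T p * (- (\<sigma> * (e * V3 p)) * (Uy p)\<^sup>2) + T p * (\<sigma> * rest)"
    by (simp add: Gx_def rest_def power2_eq_square algebra_simps)
  moreover have "\<epsilon> / A = 2 * (\<epsilon> / (2 * A))" "\<epsilon> / (8 * A) \<le> \<epsilon> / (2 * A)"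
    using const_bounds pos by (auto simp: field_simps)
  ultimately show ?thesis using main unfolding \<sigma>_def by linarith
qed

lemma bottom_Gy:
  assumes b: "p \<in> bottom"
  shows "\<bar>Gy p\<bar> \<le> 10 * (A * \<epsilon>)"
proof -
  note bb = bottom_bounds[OF b]
  define a where "a = A * (\<epsilon> * T p)"
  have a0: "a \<ge> 0" using const_bounds pos T_ge[of p] by (simp add: a_def)
  have as: "a \<le> 1 / 100" using bottom_small(2)[OF b] s_A(3) by (simp add: a_def)
  have aa: "a * a \<le> \<epsilon> / 100"
    using order_trans[OF bottom_small(1)[OF b] mult_right_mono[OF s_A(2), of \<epsilon>]] pos
    unfolding a_def power2_eq_square[of "A * (\<epsilon> * T p)"] by linarith
  have Ae: "A * \<epsilon> > 0" "\<epsilon> \<le> A * \<epsilon>" using const_bounds pos by auto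
  have "\<bar>(6 * \<epsilon> + e * W3 p) * (Uy p * Uy p)\<bar> \<le> (A * \<epsilon>) * ((3 / 2) * (3 / 2))"
    by (intro abs_mult_le bb)
  moreover have "\<bar>2 * Uxx p * Uy p * Uyy p\<bar> \<le> 2 * (A * \<epsilon>) * (3 / 2) * 2"
    by (intro abs_mult_le bb) auto
  moreover have "\<bar>2 * (e * V3 p) * Ux p * Uy p\<bar> \<le> 2 * (A * \<epsilon>) * a * (3 / 2)"
    unfolding a_def by (intro abs_mult_le bb) auto
  moreover have "2 * (A * \<epsilon>) * a * (3 / 2) \<le> 2 * (A * \<epsilon>) * (1 / 100) * (3 / 2)"
    using Ae as by (intro mult_right_mono mult_left_mono) auto
  moreover have "\<bar>2 * (Uxy p * Uxy p) * Uy p\<bar> \<le> 2 * (a * a) * (3 / 2)"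
    unfolding a_def by (intro abs_mult_le bb) auto
  moreover have "\<bar>(6 * \<epsilon> + e * W3 p) * (Ux p * Ux p)\<bar> \<le> (A * \<epsilon>) * (a * a)"
    unfolding a_def by (intro abs_mult_le bb)
  moreover have "(A * \<epsilon>) * (a * a) \<le> (A * \<epsilon>) * 1"
    using Ae as a0 mult_mono[of a 1 a 1] by (intro mult_left_mono) auto
  ultimately show ?thesis
    using aa Ae unfolding Gy_def power2_eq_square abs_le_iff by linarith
qed

lemma bottom_segment:
  assumes b: "p \<in> bottom" "q \<in> bottom" and \<xi>: "\<xi> \<in> closed_segment p q"
  shows "\<xi> \<in> bottom" "T \<xi> \<le> max (T p) (T q)"
proof -
  obtain t where t: "0 \<le> t" "t \<le> 1" "\<xi> = (1 - t) *\<^sub>R p + t *\<^sub>R q"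
    using \<xi> by (auto simp: in_segment)
  have f: "fst \<xi> = (1 - t) * fst p + t * fst q" "snd \<xi> = (1 - t) * snd p + t * snd q"
    by (simp_all add: t(3))
  have "\<bar>(1 - t) * fst p\<bar> = (1 - t) * \<bar>fst p\<bar>" "\<bar>t * fst q\<bar> = t * \<bar>fst q\<bar>"
    using t by (auto simp: abs_mult)
  then have "\<bar>fst \<xi>\<bar> \<le> (1 - t) * \<bar>fst p\<bar> + t * \<bar>fst q\<bar>"
    unfolding f by linarith
  also have "\<dots> \<le> max \<bar>fst p\<bar> \<bar>fst q\<bar>"
    using t by (intro convex_bound_le) auto
  finally have m: "\<bar>fst \<xi>\<bar> \<le> max \<bar>fst p\<bar> \<bar>fst q\<bar>" .
  then show "T \<xi> \<le> max (T p) (T q)" by (auto simp: T_def)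
  have "Q 2 \<xi> \<le> 4 * \<epsilon>" "\<bar>fst \<xi>\<bar> \<le> \<tau> - 1"
    using m b T_Q_mono[of \<xi> p 2] T_Q_mono[of \<xi> q 2] unfolding bottom_def kbox_def max_def
    by (auto split: if_splits)
  moreover have "snd \<xi> \<le> - 3 / 4"
    unfolding f using b t by (intro convex_bound_le) (auto simp: bottom_def)
  moreover have "- snd \<xi> \<le> 5 / 4"
    using convex_bound_le[of "- snd p" "5 / 4" "- snd q" "1 - t" t] b t unfolding f
    by (auto simp: bottom_def)
  ultimately show "\<xi> \<in> bottom" by (auto simp: bottom_def kbox_def)
qed

text \<open>The mean value theorem for \<open>U\<close> along the chord: both values vanish,
  \<open>Uy\<close> is at least 1/2 and \<open>Ux\<close> is small, so the zero set is a flat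
  Lipschitz graph.\<close>

lemma bottom_graph:
  assumes b: "p \<in> bottom" "q \<in> bottom" and z: "U p = 0" "U q = 0"
  shows "\<bar>snd q - snd p\<bar> \<le> 2 * (A * (\<epsilon> * max (T p) (T q))) * \<bar>fst q - fst p\<bar>"
proof -
  obtain \<xi> where \<xi>: "\<xi> \<in> closed_segment p q"
    "U q - U p = Ux \<xi> * (fst q - fst p) + Uy \<xi> * (snd q - snd p)"
    using planar_mean_value[OF U_derivatives(1)] .
  note s = bottom_segment[OF b \<xi>(1)]
  note bb = bottom_bounds[OF s(1)]
  have "\<bar>Uy \<xi> * (snd q - snd p)\<bar> = \<bar>Ux \<xi> * (fst q - fst p)\<bar>"
    using \<xi>(2) z by (simp add: add_eq_0_iff)
  also have "\<dots> \<le> A * (\<epsilon> * max (T p) (T q)) * \<bar>fst q - fst p\<bar>"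
  proof (rule abs_mult_le)
    have "A * (\<epsilon> * T \<xi>) \<le> A * (\<epsilon> * max (T p) (T q))"
      using s(2) pos const_bounds by (intro mult_left_mono) auto
    then show "\<bar>Ux \<xi>\<bar> \<le> A * (\<epsilon> * max (T p) (T q))" using bb(1) by linarith
  qed simp
  finally have "Uy \<xi> * \<bar>snd q - snd p\<bar> \<le> A * (\<epsilon> * max (T p) (T q)) * \<bar>fst q - fst p\<bar>"
    using bb(2) by (simp add: abs_mult)
  moreover have "1 / 2 * \<bar>snd q - snd p\<bar> \<le> Uy \<xi> * \<bar>snd q - snd p\<bar>"
    using bb(2) by (intro mult_right_mono) auto
  ultimately have "1 / 2 * \<bar>snd q - snd p\<bar> \<le> A * (\<epsilon> * max (T p) (T q)) * \<bar>fst q - fst p\<bar>"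
    by (rule order_trans[rotated])
  then show ?thesis by simp
qed

lemma frontier_cases:
  assumes "p \<in> frontier \<Omega>'"
  shows "G p > 0 \<or> p \<in> bottom"
proof -
  have p: "p \<in> kbox" "U p = 0" using assms obox_props(2) by (auto simp: frontier_\<Omega>')
  show ?thesis
  proof (cases "4 * \<epsilon> \<le> Q 2 p \<or> snd p \<ge> 1 / 2")
    case True
    then show ?thesis using outer_G_pos[OF p(1)] top_G_pos[OF p(1)] by blast
  next
    case False
    then have "p \<in> bottom" using inner_zero_height[OF p(1) _ p(2)] p(1) by (auto simp: bottom_def)
    then show ?thesis by simp
  qed
qed

text \<open>Between two zeros on the same side, \<open>U = 0\<close> forces \<open>\<bar>\<Delta>y\<bar> \<le> C \<epsilon> T \<bar>\<Delta>x\<bar>\<close>, whereas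
\<open>\<bar>Gx\<bar> \<ge> c \<epsilon> / T\<close> and \<open>\<bar>Gy\<bar> \<le> C \<epsilon>\<close>; as \<open>\<epsilon> T\<^sup>2\<close> is small, \<open>G\<close> cannot vanish at both.\<close>

lemma G_zero_unique:
  assumes p: "p \<in> frontier \<Omega>'" "G p = 0" and q: "q \<in> frontier \<Omega>'" "G q = 0" and sg: "sgn (fst p) = sgn (fst q)"
  shows "p = q"
  using p q sg
proof (induction "\<bar>fst p\<bar>" "\<bar>fst q\<bar>" arbitrary: p q rule: linorder_wlog)
  case le
  have bot: "p \<in> bottom" "q \<in> bottom" "U p = 0" "U q = 0"
    using frontier_cases le by (fastforce simp: frontier_\<Omega>')+
  \<comment> \<open>Closer to the axis \<open>G\<close> is negative, so a zero must lie in the zone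
    where \<open>Gx\<close> is controlled.\<close>
  have mid: "\<epsilon> < (c2 + B) * Q 2 p" using inner_G_neg[OF bot(1)] le(3) by force
  have Tpq: "T p \<le> T q" using le(1) by (simp add: T_def)
  obtain \<eta> where \<eta>: "\<eta> \<in> closed_segment p q"
    "G q - G p = Gx \<eta> * (fst q - fst p) + Gy \<eta> * (snd q - snd p)"
    using planar_mean_value[OF G_derivative] .
  note s = bottom_segment[OF bot(1,2) \<eta>(1)]
  have T\<eta>: "T \<eta> \<le> T q" using s(2) Tpq by simp
  have "fst p \<noteq> 0"
  proof
    assume "fst p = 0"
    then have "(c2 + B) * Q 2 p = (c2 + B) * e" by (simp add: Q_def T_def)
    also have "\<dots> \<le> A * (s * \<epsilon>)"
      using const_bounds e_le pos B by (intro mult_mono) auto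
    also have "\<dots> \<le> 1 * \<epsilon>" using mult_right_mono[of "A * s" 1 \<epsilon>] s_A(3) pos by (simp add: mult.assoc)
    finally show False using mid by simp
  qed
  obtain t where t: "0 \<le> t" "t \<le> 1" "\<eta> = (1 - t) *\<^sub>R p + t *\<^sub>R q"
    using \<eta>(1) by (auto simp: in_segment)
  have f: "fst \<eta> = fst p + t * (fst q - fst p)" by (simp add: t(3) algebra_simps)
  \<comment> \<open>Since both abscissas have the same sign and that of \<open>p\<close> is the
    smaller in modulus, the intermediate point is at least as far out as \<open>p\<close> and
    inherits the lower bound on \<open>Q 2\<close>.\<close>
  have \<eta>s: "\<bar>fst p\<bar> \<le> \<bar>fst \<eta>\<bar> \<and> sgn (fst \<eta>) = sgn (fst p)"
  proof (cases "fst p > 0")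
    case True
    then have "fst q \<ge> fst p" using le(1,6) by (auto simp: sgn_if split: if_splits)
    then have "0 \<le> t * (fst q - fst p)" using t by simp
    then show ?thesis using True f by auto
  next
    case False
    then have "fst p < 0" "fst q \<le> fst p" using le(1,6) \<open>fst p \<noteq> 0\<close> by (auto simp: sgn_if split: if_splits)
    then have "t * (fst q - fst p) \<le> 0" using t by (simp add: mult_nonneg_nonpos)
    then show ?thesis using \<open>fst p < 0\<close> f by auto
  qed
  have "Q 2 p \<le> Q 2 \<eta>" using T_Q_mono \<eta>s by blast
  then have "(c2 + B) * Q 2 p \<le> (c2 + B) * Q 2 \<eta>" using const_bounds B by (intro mult_left_mono) auto
  then have "\<epsilon> < (c2 + B) * Q 2 \<eta>" using mid by linarith
  note gx1 = middle_Gx[OF s(1) this]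
  have "sgn (fst \<eta>) * Gx \<eta> \<le> \<bar>Gx \<eta>\<bar>" by (auto simp: sgn_if)
  then have "T \<eta> * (sgn (fst \<eta>) * Gx \<eta>) \<le> T \<eta> * \<bar>Gx \<eta>\<bar>"
    using T_ge[of \<eta>] by (intro mult_left_mono) auto
  with gx1 have gx: "\<epsilon> / (8 * A) \<le> T \<eta> * \<bar>Gx \<eta>\<bar>" by linarith
  define \<Delta> where "\<Delta> = \<bar>fst q - fst p\<bar>"
  define \<delta> where "\<delta> = \<bar>snd q - snd p\<bar>"
  have d: "\<delta> \<le> 2 * (A * (\<epsilon> * T q)) * \<Delta>"
    using bottom_graph[OF bot] Tpq by (simp add: \<Delta>_def \<delta>_def max_def)
  have "\<bar>Gx \<eta>\<bar> * \<Delta> = \<bar>Gy \<eta>\<bar> * \<delta>"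
    using \<eta>(2) le(3,5) unfolding \<Delta>_def \<delta>_def abs_mult[symmetric] by (simp add: add_eq_0_iff)
  also have "\<dots> \<le> 10 * (A * \<epsilon>) * (2 * (A * (\<epsilon> * T q)) * \<Delta>)"
    using bottom_Gy[OF s(1)] d pos const_bounds by (intro mult_mono) (auto simp: \<delta>_def)
  finally have gd: "\<bar>Gx \<eta>\<bar> * \<Delta> \<le> 10 * (A * \<epsilon>) * (2 * (A * (\<epsilon> * T q)) * \<Delta>)" .
  have "T \<eta> * (\<bar>Gx \<eta>\<bar> * \<Delta>) \<le> T q * (10 * (A * \<epsilon>) * (2 * (A * (\<epsilon> * T q)) * \<Delta>))"
    using T_ge[of q] by (intro mult_mono[OF T\<eta> gd]) (auto simp: \<Delta>_def)
  also have "\<dots> = 20 * A\<^sup>2 * \<epsilon> * (\<epsilon> * (T q)\<^sup>2) * \<Delta>" by (simp add: power2_eq_square)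
  also have "\<dots> \<le> 20 * A\<^sup>2 * \<epsilon> * s * \<Delta>"
    using box_bounds(5)[of q] bot(2) pos by (intro mult_right_mono mult_left_mono) (auto simp: bottom_def \<Delta>_def)
  finally have "T \<eta> * \<bar>Gx \<eta>\<bar> * \<Delta> \<le> 20 * A\<^sup>2 * \<epsilon> * s * \<Delta>" by (simp add: mult.assoc)
  moreover have "\<epsilon> / (8 * A) * \<Delta> \<le> T \<eta> * \<bar>Gx \<eta>\<bar> * \<Delta>" using gx by (intro mult_right_mono) (auto simp: \<Delta>_def)
  ultimately have le1: "\<epsilon> / (8 * A) * \<Delta> \<le> 20 * A\<^sup>2 * \<epsilon> * s * \<Delta>" by linarith
  \<comment> \<open>Clearing denominators gives the factor 160, well below the 1000 guaranteed by
    \<open>s_A\<close>.\<close>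
  have lt: "20 * A\<^sup>2 * \<epsilon> * s < \<epsilon> / (8 * A)"
  proof -
    have "160 * (A ^ 3 * s) < 1"
    proof -
      have "A ^ 3 * s > 0" using pos const_bounds by simp
      moreover have "1000 * (A ^ 3 * s) \<le> 1" using s_A(1) by (simp add: mult.assoc)
      ultimately show ?thesis by linarith
    qed
    then have "160 * (A ^ 3 * s) * \<epsilon> < 1 * \<epsilon>" using pos by (intro mult_strict_right_mono) auto
    then show ?thesis using const_bounds by (simp add: field_simps power2_eq_square power3_eq_cube)
  qed
  have "\<Delta> = 0"
  proof (rule ccontr)
    assume "\<Delta> \<noteq> 0"
    then have "\<Delta> > 0" by (simp add: \<Delta>_def)
    then show False using mult_strict_right_mono[OF lt] le1 by fastforce
  qed
  then have "\<delta> = 0" using d by (simp add: \<delta>_def)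
  then show "p = q" using \<open>\<Delta> = 0\<close> by (simp add: \<Delta>_def \<delta>_def prod_eq_iff)
next
  case (sym p q)
  then show ?case by metis
qed

lemma ex_bottom_zero:
  assumes "\<bar>x\<bar> \<le> \<tau> - 1" "e * (1 + \<bar>x\<bar>) ^ (N + 2) \<le> 4 * \<epsilon>"
  shows "\<exists>y. (x, y) \<in> bottom \<and> U (x, y) = 0"
proof -
  have k: "(x, y) \<in> kbox \<and> Q 2 (x, y) \<le> 4 * \<epsilon>" if "\<bar>y\<bar> \<le> 2" for y
    using assms that by (simp add: kbox_def Q_def T_def)
  have 1: "U (x, - 5 / 4) < 0" "U (x, - 3 / 4) > 0"
    using U_inner_approx[of "(x, - 5 / 4)"] U_inner_approx[of "(x, - 3 / 4)"] k[of "- 5 / 4"] k[of "- 3 / 4"] s_A(3)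
    unfolding abs_le_iff by (simp_all add: power2_eq_square)
  have "continuous_on {- 5 / 4..- 3 / 4} (\<lambda>y. U (x, y))"
    by (rule continuous_on_compose2[OF cont(1)[of UNIV]]) (auto intro!: continuous_intros)
  then have "\<exists>y\<ge>- 5 / 4. y \<le> - 3 / 4 \<and> U (x, y) = 0"
    using 1 by (intro IVT') auto
  then obtain y where y: "- 5 / 4 \<le> y" "y \<le> - 3 / 4" "U (x, y) = 0" by blast
  then have "\<bar>y\<bar> \<le> 2" by simp
  from k[OF this] y show ?thesis by (auto simp: bottom_def)
qed

lemma bottom_zero_frontier: "p \<in> bottom \<Longrightarrow> U p = 0 \<Longrightarrow> p \<in> frontier \<Omega>'"
  using zero_in_obox[of p] by (auto simp: frontier_\<Omega>' bottom_def)

text \<open>The lower arc over \<open>{0..b}\<close> is a graph, and \<open>b\<close> is the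
  interface: \<open>G\<close> is negative at abscissa 0 and positive at the interface, where the
  outer estimate already applies.\<close>

lemma G_zero_exists:
  assumes \<sigma>: "\<sigma> = 1 \<or> \<sigma> = - 1"
  shows "\<exists>p\<in>frontier \<Omega>'. G p = 0 \<and> sgn (fst p) = \<sigma>" "\<exists>p\<in>frontier \<Omega>'. G p < 0" "\<exists>p\<in>frontier \<Omega>'. G p > 0"
proof -
  have "4 * \<epsilon> * \<tau>\<^sup>2 \<le> e * \<tau> ^ (N + 2) * \<tau>\<^sup>2"
  proof -
    have "e * \<tau> ^ (N + 2) * \<tau>\<^sup>2 = 4" using e\<tau> by (simp add: power_add power2_eq_square power4_eq_xxxx mult_ac)
    then show ?thesis using \<epsilon>\<tau> s_A(4) by simp
  qed
  then have "4 * \<epsilon> \<le> e * (1 + (\<tau> - 1)) ^ (N + 2)" using \<tau>2 by simp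
  then obtain b where b: "0 \<le> b" "b \<le> \<tau> - 1" "e * (1 + b) ^ (N + 2) = 4 * \<epsilon>"
    using ex_Q2_eq[of "\<tau> - 1"] \<tau>2 by auto
  have "\<exists>y. (\<sigma> * t, y) \<in> bottom \<and> U (\<sigma> * t, y) = 0" if "t \<in> {0..b}" for t
  proof (rule ex_bottom_zero)
    have a: "\<bar>\<sigma> * t\<bar> = t" using that \<sigma> by auto
    show "\<bar>\<sigma> * t\<bar> \<le> \<tau> - 1" using a that b by simp
    have "e * (1 + t) ^ (N + 2) \<le> e * (1 + b) ^ (N + 2)"
      using that pos by (intro mult_left_mono power_mono) auto
    then show "e * (1 + \<bar>\<sigma> * t\<bar>) ^ (N + 2) \<le> 4 * \<epsilon>" using a b(3) by simp
  qed
  then obtain Y where Y: "\<And>t. t \<in> {0..b} \<Longrightarrow> (\<sigma> * t, Y t) \<in> bottom \<and> U (\<sigma> * t, Y t) = 0" by metis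
  \<comment> \<open>\<open>Y\<close> is merely a pointwise choice of zeros; the estimate between any
    two zeros in \<open>bottom\<close> makes it continuous.\<close>
  have "1-lipschitz_on {0..b} Y"
  proof (rule lipschitz_onI)
    fix t u assume t: "t \<in> {0..b}" "u \<in> {0..b}"
    let ?p = "(\<sigma> * t, Y t)" and ?q = "(\<sigma> * u, Y u)"
    have pb: "?p \<in> bottom" "?q \<in> bottom" using Y t by auto
    have "A * (\<epsilon> * max (T ?p) (T ?q)) \<le> A * s"
      using bottom_small(2)[OF pb(1)] bottom_small(2)[OF pb(2)] by (simp add: max_def)
    then have "2 * (A * (\<epsilon> * max (T ?p) (T ?q))) \<le> 1" using s_A(3) by linarith
    then have "2 * (A * (\<epsilon> * max (T ?p) (T ?q))) * \<bar>\<sigma> * u - \<sigma> * t\<bar> \<le> 1 * \<bar>\<sigma> * u - \<sigma> * t\<bar>"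
      by (intro mult_right_mono) auto
    moreover have "\<bar>\<sigma> * u - \<sigma> * t\<bar> = \<bar>t - u\<bar>" using \<sigma> by auto
    ultimately show "dist (Y t) (Y u) \<le> 1 * dist t u"
      using bottom_graph[OF pb] Y[OF t(1)] Y[OF t(2)] by (simp add: dist_real_def abs_minus_commute[of "Y t"])
  qed simp
  then have cY: "continuous_on {0..b} Y" by (rule lipschitz_on_continuous_on)
  define H where "H t = G (\<sigma> * t, Y t)" for t
  have cH: "continuous_on {0..b} H"
    unfolding H_def by (rule continuous_on_compose2[OF cont(7)[of UNIV]]) (auto intro!: continuous_intros cY)
  have 0: "0 \<in> {0..b}" "b \<in> {0..b}" using b by auto
  have "(c2 + B) * Q 2 (\<sigma> * 0, Y 0) \<le> A * (s * \<epsilon>)"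
    using const_bounds e_le pos B by (intro mult_mono) (auto simp: Q_def T_def)
  also have "\<dots> \<le> 1 * \<epsilon>" using mult_right_mono[of "A * s" 1 \<epsilon>] s_A(3) pos by (simp add: mult.assoc)
  finally have H0: "H 0 < 0" unfolding H_def using Y[OF 0(1)] by (intro inner_G_neg) auto
  have "\<bar>\<sigma> * b\<bar> = b" using \<sigma> b by auto
  then have Hb: "H b > 0" unfolding H_def
    using Y[OF 0(2)] b(3) by (intro outer_G_pos) (auto simp: bottom_def Q_def T_def)
  have "\<exists>t\<ge>0. t \<le> b \<and> H t = 0" using H0 Hb cH b by (intro IVT') auto
  then obtain t where t: "0 \<le> t" "t \<le> b" "H t = 0" by blast
  then have "t \<noteq> 0" using H0 by auto
  then have "sgn (\<sigma> * t) = \<sigma>" using \<sigma> t by auto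
  then show "\<exists>p\<in>frontier \<Omega>'. G p = 0 \<and> sgn (fst p) = \<sigma>"
    using t Y[of t] bottom_zero_frontier by (intro bexI[of _ "(\<sigma> * t, Y t)"]) (auto simp: H_def)
  show "\<exists>p\<in>frontier \<Omega>'. G p < 0" "\<exists>p\<in>frontier \<Omega>'. G p > 0"
    using H0 Hb Y[OF 0(1)] Y[OF 0(2)] bottom_zero_frontier by (auto simp: H_def)
qed

lemma Curv_sign:
  assumes "p \<in> frontier \<Omega>'"
  shows "Curv \<Omega>' p < 0 \<longleftrightarrow> G p < 0" "Curv \<Omega>' p > 0 \<longleftrightarrow> G p > 0" "Curv \<Omega>' p = 0 \<longleftrightarrow> G p = 0"
  using lvl.grad_norm_pos[OF assms]
  by (auto simp: lvl.Curv_eq[OF assms] curv_num_eq divide_less_0_iff zero_less_divide_iff)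

lemma curvature_changes_sign:
  "\<exists>p\<in>frontier \<Omega>'. Curv \<Omega>' p < 0" "\<exists>p\<in>frontier \<Omega>'. Curv \<Omega>' p > 0"
  using G_zero_exists(2,3)[of 1] Curv_sign by auto

lemma card_curvature_zeros: "card {p \<in> frontier \<Omega>'. Curv \<Omega>' p = 0} = 2"
proof -
  obtain p where p: "p \<in> frontier \<Omega>'" "G p = 0" "sgn (fst p) = 1" using G_zero_exists(1)[of 1] by auto
  obtain q where q: "q \<in> frontier \<Omega>'" "G q = 0" "sgn (fst q) = - 1" using G_zero_exists(1)[of "- 1"] by auto
  have "r = p \<or> r = q" if r: "r \<in> frontier \<Omega>'" "G r = 0" for r
  proof -
    have "fst r \<noteq> 0"
    proof
      assume "fst r = 0"
      then have "(c2 + B) * Q 2 r \<le> A * (s * \<epsilon>)"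
        using const_bounds e_le pos B by (intro mult_mono) (auto simp: Q_def T_def)
      also have "\<dots> \<le> 1 * \<epsilon>" using mult_right_mono[of "A * s" 1 \<epsilon>] s_A(3) pos by (simp add: mult.assoc)
      finally show False using inner_G_neg[of r] frontier_cases[OF r(1)] r(2) by auto
    qed
    then have "sgn (fst r) = 1 \<or> sgn (fst r) = - 1" by (auto simp: sgn_if)
    then show ?thesis using G_zero_unique[OF r p(1,2)] G_zero_unique[OF r q(1,2)] p(3) q(3) by auto
  qed
  then have "{p \<in> frontier \<Omega>'. Curv \<Omega>' p = 0} = {p, q}"
    using p q Curv_sign(3) by auto
  moreover have "p \<noteq> q" using p(3) q(3) by auto
  ultimately show ?thesis by simp
qed

text \<open>Since the minimum is negative it is attained in \<open>bottom\<close>, where the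
  numerator is at most \<open>4 * A * \<epsilon>\<close> and the gradient at least 1/2; the cube of
  1/2 turns 4 into 32.\<close>

lemma min_curvature:
  "\<exists>q\<in>frontier \<Omega>'. (\<forall>p\<in>frontier \<Omega>'. Curv \<Omega>' q \<le> Curv \<Omega>' p) \<and> \<bar>Curv \<Omega>' q\<bar> \<le> 32 * A * \<epsilon>"
proof -
  obtain p0 where p0: "p0 \<in> frontier \<Omega>'" "Curv \<Omega>' p0 < 0" using curvature_changes_sign by blast
  then obtain q where q: "q \<in> frontier \<Omega>'" "\<forall>p\<in>frontier \<Omega>'. Curv \<Omega>' q \<le> Curv \<Omega>' p"
    using lvl.Curv_attains_min[OF frontier_\<Omega>'_compact] by blast
  then have neg: "Curv \<Omega>' q < 0" using p0 by fastforce
  then have bq: "q \<in> bottom" using frontier_cases[OF q(1)] Curv_sign(1)[OF q(1)] by auto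
  have "1 / 2 \<le> \<bar>Uy q\<bar>" using bottom_bounds(2)[OF bq] by simp
  also have "\<dots> \<le> lvl.grad_norm q" unfolding lvl.grad_norm_def by (rule real_sqrt_ge_abs2)
  finally have "(1 / 2) ^ 3 \<le> lvl.grad_norm q ^ 3" by (intro power_mono) auto
  then have gn: "1 / 8 \<le> lvl.grad_norm q ^ 3" by (simp add: power3_eq_cube)
  have "\<bar>lvl.grad_norm q ^ 3\<bar> = lvl.grad_norm q ^ 3"
    by (rule abs_of_nonneg) (use gn in linarith)
  then have "\<bar>Curv \<Omega>' q\<bar> = \<bar>G q\<bar> / lvl.grad_norm q ^ 3"
    unfolding lvl.Curv_eq[OF q(1)] curv_num_eq abs_divide by (rule arg_cong)
  also have "\<dots> \<le> (4 * (A * \<epsilon>)) / (1 / 8)"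
    using bottom_G_bound[OF bq] gn by (intro frac_le) auto
  finally show ?thesis using q by (intro bexI[of _ q]) auto
qed

section \<open>Smoothness, comparison with the strip, separating lines\<close>

lemma \<Omega>'_smooth_bounded_domain:
  assumes "real_polynomial_function V0"
  shows "smooth_bounded_domain \<Omega>'" "torsion_domain \<Omega>' U"
proof -
  have lin: "real_polynomial_function (fst :: real \<times> real \<Rightarrow> real)" "real_polynomial_function (snd :: real \<times> real \<Rightarrow> real)"
    by (auto intro: real_polynomial_function.intros(1) bounded_linear_fst bounded_linear_snd)
  have poly: "real_polynomial_function U"
    unfolding U_def[abs_def]
    by (intro real_polynomial_function_diff real_polynomial_function.intros(2-4) real_polynomial_function_divide
        real_polynomial_function_power lin assms)
  have bd: "bounded \<Omega>'" by (rule bounded_subset[OF obox_props(4)]) (auto simp: \<Omega>'_def)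
  have D: "D1 U = Ux" "D2 U = Uy" "D1 Ux = Uxx" "D2 Uy = Uyy"
    using has_derivative_D1D2(1,2)[OF U_derivatives(1)] has_derivative_D1D2(1)[OF U_derivatives(2)]
      has_derivative_D1D2(2)[OF U_derivatives(3)] by (auto simp: fun_eq_iff)
  have "\<exists>O' \<rho>. open O' \<and> p \<in> O' \<and> smooth_fun_on \<rho> O' \<and> grad \<rho> p \<noteq> 0 \<and> \<Omega>' \<inter> O' = {q \<in> O'. \<rho> q > 0}"
    if p: "p \<in> frontier \<Omega>'" for p
  proof (intro exI conjI)
    show "grad U p \<noteq> 0" using lvl.regular[OF p] by (auto simp: grad_def D zero_prod_def)
    show "p \<in> obox" using p by (simp add: frontier_\<Omega>')
    show "smooth_fun_on U obox" by (rule real_polynomial_function_smooth[OF poly])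
    show "\<Omega>' \<inter> obox = {q \<in> obox. U q > 0}" by (auto simp: \<Omega>'_def)
  qed (rule obox_props)
  then show "smooth_bounded_domain \<Omega>'"
    unfolding smooth_bounded_domain_def
    using origin_in \<Omega>'_open \<Omega>'_connected bd by blast
  show "torsion_domain \<Omega>' U"
  proof
    show "Laplacian U p = - 1" for p by (simp add: Laplacian_def D Uxx_def Uyy_def)
    show "\<Omega>' \<noteq> {}" using origin_in by auto
    show "0 < U p" if "p \<in> \<Omega>'" for p using that by (simp add: \<Omega>'_def)
    show "U p = 0" if "p \<in> frontier \<Omega>'" for p using that by (simp add: frontier_\<Omega>')
  qed (use \<Omega>'_open bd poly in auto)
qed

text \<open>Where \<open>T p\<close> is bounded by a fixed \<open>R\<close>, the inequality
  \<open>e \<le> s * \<epsilon>\<close> puts the point in the inner region; this gives the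
  convergence to the strip on compact sets.\<close>

lemma compact_approx:
  assumes "p \<in> kbox" "T p \<le> R" "s * R ^ (N + 2) \<le> 1"
  shows "\<bar>U p - (1 / 2 - (snd p)\<^sup>2 / 2)\<bar> \<le> A * s"
proof (rule U_inner_approx[OF assms(1)])
  have "Q 2 p \<le> e * R ^ (N + 2)"
    unfolding Q_def using pos T_ge[of p] assms(2) by (intro mult_left_mono power_mono) auto
  also have "\<dots> \<le> s * \<epsilon> * R ^ (N + 2)"
    using e_le T_ge[of p] assms(2) by (intro mult_right_mono) auto
  also have "\<dots> = (s * R ^ (N + 2)) * \<epsilon>" by simp
  also have "\<dots> \<le> 1 * \<epsilon>" using assms(3) pos by (intro mult_right_mono) auto
  finally show "Q 2 p \<le> 4 * \<epsilon>" using pos by simp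
qed

text \<open>On the vertical line through \<open>x\<close> the cubic term gains at most \<open>O(\<epsilon>\<^sup>2)\<close>, which
  \<open>e F(x) = \<epsilon>\<^bsup>3/2\<^esup> F(x) < 0\<close> outweighs.\<close>

lemma separating_line:
  assumes c: "c = 4 + 3 * x\<^sup>2 + B * (1 + \<bar>x\<bar>) ^ (N + 2)" and neg: "c\<^sup>2 * s \<le> - 2 * V0 (x, 0)"
    and ee: "\<epsilon>\<^sup>2 \<le> e * s" and y: "\<bar>y\<bar> \<le> 2"
  shows "U (x, y) \<le> 1 / 2"
proof -
  have "\<bar>V0 (x, y) - V0 (x, 0)\<bar> \<le> B * (1 + \<bar>x\<bar>) ^ (N + 2) * \<bar>y - 0\<bar>"
  proof -
    have "norm (V0 (x, y) - V0 (x, 0)) \<le> B * (1 + \<bar>x\<bar>) ^ (N + 2) * norm (y - 0)"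
    proof (rule field_differentiable_bound[where S = "{-2..2}" and f' = "\<lambda>t. - W1 (x, t)"])
      show "((\<lambda>t. V0 (x, t)) has_real_derivative - W1 (x, t)) (at t within {-2..2})" for t
        using has_derivative_D1D2(4)[OF dV0[of "(x, t)"]] by (simp add: has_field_derivative_at_within)
      show "norm (- W1 (x, t)) \<le> B * (1 + \<bar>x\<bar>) ^ (N + 2)" if "t \<in> {-2..2}" for t
        using bW1[of t x] that by auto
    qed (use y in auto)
    then show ?thesis by simp
  qed
  \<comment> \<open>Replacing \<open>e\<close> by the larger \<epsilon> gives the variation of
    \<open>F\<close> the same form as the cubic term, so one constant \<open>c\<close> covers
    both.\<close>
  then have "e * \<bar>V0 (x, y) - V0 (x, 0)\<bar> \<le> \<epsilon> * (B * (1 + \<bar>x\<bar>) ^ (N + 2) * \<bar>y\<bar>)"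
    using e_le_\<epsilon> pos by (intro mult_mono) auto
  moreover have "e * (V0 (x, y) - V0 (x, 0)) \<le> e * \<bar>V0 (x, y) - V0 (x, 0)\<bar>"
    using pos by (intro mult_left_mono) auto
  ultimately have 1: "e * V0 (x, y) \<le> e * V0 (x, 0) + \<epsilon> * (B * (1 + \<bar>x\<bar>) ^ (N + 2) * \<bar>y\<bar>)"
    by (simp add: right_diff_distrib)
  have "y\<^sup>2 \<le> 2\<^sup>2" using y abs_le_square_iff[of y 2] by simp
  then have "y\<^sup>2 \<le> 4" by simp
  then have "\<bar>y\<^sup>2 - 3 * x\<^sup>2\<bar> \<le> 4 + 3 * x\<^sup>2"
    using zero_le_power2[of x] zero_le_power2[of y] unfolding abs_le_iff by (intro conjI; linarith)
  then have "\<bar>y * (y\<^sup>2 - 3 * x\<^sup>2)\<bar> \<le> \<bar>y\<bar> * (4 + 3 * x\<^sup>2)"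
    by (intro abs_mult_le) auto
  then have "\<epsilon> * (y * (y\<^sup>2 - 3 * x\<^sup>2)) \<le> \<epsilon> * (\<bar>y\<bar> * (4 + 3 * x\<^sup>2))"
    using pos by (intro mult_left_mono) auto
  then have 2: "\<epsilon> * (y ^ 3 - 3 * x\<^sup>2 * y) \<le> \<epsilon> * (\<bar>y\<bar> * (4 + 3 * x\<^sup>2))"
    by (simp add: power3_eq_cube power2_eq_square algebra_simps)
  have "U (x, y) \<le> 1 / 2 - y\<^sup>2 / 2 + c * \<epsilon> * \<bar>y\<bar> + e * V0 (x, 0)"
    using 1 2 unfolding U_def c by (simp add: algebra_simps)
  \<comment> \<open>Completing the square: a perturbation linear in \<epsilon> and in the height
    gains only the square of \<epsilon> against the parabola.\<close>
  also have "- y\<^sup>2 / 2 + c * \<epsilon> * \<bar>y\<bar> \<le> c\<^sup>2 * \<epsilon>\<^sup>2 / 2"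
    using zero_le_power2[of "\<bar>y\<bar> - c * \<epsilon>"] by (simp add: power2_eq_square algebra_simps)
  then have "1 / 2 - y\<^sup>2 / 2 + c * \<epsilon> * \<bar>y\<bar> + e * V0 (x, 0) \<le> 1 / 2 + c\<^sup>2 * \<epsilon>\<^sup>2 / 2 + e * V0 (x, 0)"
    by simp
  also have "c\<^sup>2 * \<epsilon>\<^sup>2 \<le> e * (c\<^sup>2 * s)"
    using mult_left_mono[OF ee, of "c\<^sup>2"] by (simp add: mult_ac)
  also have "\<dots> \<le> e * (- 2 * V0 (x, 0))" using neg pos by (intro mult_left_mono) auto
  finally show ?thesis by simp
qed

end

section \<open>The polynomial perturbation\<close>

lemma poly_Complex_derivative:
  fixes r :: "complex poly"
  shows "((\<lambda>q. Re (poly r (Complex (fst q) (snd q)))) has_derivative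
      (\<lambda>h. Re (poly (pderiv r) (Complex (fst p) (snd p))) * fst h
        - Im (poly (pderiv r) (Complex (fst p) (snd p))) * snd h)) (at p)"
    "((\<lambda>q. Im (poly r (Complex (fst q) (snd q)))) has_derivative
      (\<lambda>h. Im (poly (pderiv r) (Complex (fst p) (snd p))) * fst h
        + Re (poly (pderiv r) (Complex (fst p) (snd p))) * snd h)) (at p)"
proof -
  let ?z = "Complex (fst p) (snd p)"
  have "((\<lambda>q. of_real (fst q) + \<i> * of_real (snd q)) has_derivative (\<lambda>h. of_real (fst h) + \<i> * of_real (snd h))) (at p)"
    by (auto intro!: derivative_eq_intros)
  then have c: "((\<lambda>q. Complex (fst q) (snd q)) has_derivative (\<lambda>h. Complex (fst h) (snd h))) (at p)"
    by (simp add: Complex_eq)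
  have "((\<lambda>q. poly r (Complex (fst q) (snd q))) has_derivative (\<lambda>h. poly (pderiv r) ?z * Complex (fst h) (snd h))) (at p)"
    by (rule has_derivative_compose[OF c, where g = "poly r"])
      (use poly_DERIV[of r ?z] in \<open>simp add: has_field_derivative_def\<close>)
  from has_derivative_Re[OF this] has_derivative_Im[OF this]
  show "((\<lambda>q. Re (poly r (Complex (fst q) (snd q)))) has_derivative
      (\<lambda>h. Re (poly (pderiv r) (Complex (fst p) (snd p))) * fst h
        - Im (poly (pderiv r) (Complex (fst p) (snd p))) * snd h)) (at p)"
    "((\<lambda>q. Im (poly r (Complex (fst q) (snd q)))) has_derivative
      (\<lambda>h. Im (poly (pderiv r) (Complex (fst p) (snd p))) * fst h
        + Re (poly (pderiv r) (Complex (fst p) (snd p))) * snd h)) (at p)"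
    by (simp_all add: add.commute)
qed

lemma poly_strip_bound:
  fixes r :: "complex poly"
  assumes "degree r \<le> m"
  shows "\<exists>K\<ge>0. \<forall>a b. \<bar>b\<bar> \<le> 2 \<longrightarrow> cmod (poly r (Complex a b)) \<le> K * (1 + \<bar>a\<bar>) ^ m"
proof (intro exI conjI allI impI)
  let ?K = "(\<Sum>i\<le>degree r. cmod (coeff r i)) * 3 ^ m"
  show "0 \<le> ?K" by (simp add: sum_nonneg)
  fix a b :: real assume b: "\<bar>b\<bar> \<le> 2"
  have z: "cmod (Complex a b) \<le> 3 * (1 + \<bar>a\<bar>)"
    using cmod_le[of "Complex a b"] b by simp
  have "cmod (coeff r i * Complex a b ^ i) \<le> cmod (coeff r i) * (3 * (1 + \<bar>a\<bar>)) ^ m" if "i \<le> degree r" for i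
  proof -
    have "cmod (Complex a b) ^ i \<le> (3 * (1 + \<bar>a\<bar>)) ^ i" using z by (intro power_mono) auto
    also have "\<dots> \<le> (3 * (1 + \<bar>a\<bar>)) ^ m" using that assms by (intro power_increasing) auto
    finally show ?thesis by (simp add: norm_mult norm_power mult_left_mono)
  qed
  then have "(\<Sum>i\<le>degree r. cmod (coeff r i * Complex a b ^ i)) \<le> (\<Sum>i\<le>degree r. cmod (coeff r i) * (3 * (1 + \<bar>a\<bar>)) ^ m)"
    by (intro sum_mono) auto
  also have "\<dots> = ?K * (1 + \<bar>a\<bar>) ^ m"
    by (simp only: power_mult_distrib sum_distrib_right[symmetric] mult.assoc)
  finally show "cmod (poly r (Complex a b)) \<le> ?K * (1 + \<bar>a\<bar>) ^ m"
    unfolding poly_altdef by (rule order_trans[OF norm_sum])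
qed

text \<open>The two bases differ by at most 3 in the strip, and the factorisation of a difference of
  powers leaves \<open>Suc m\<close> products of degree \<open>m\<close>, each base being at most
  \<open>3 * (1 + \<bar>a\<bar>)\<close> in modulus.\<close>

lemma power_strip_bound:
  assumes b: "\<bar>b\<bar> \<le> 2"
  shows "cmod (Complex a b ^ Suc m - of_real ((sgn a * (1 + \<bar>a\<bar>)) ^ Suc m)) \<le> 3 * real (Suc m) * 3 ^ m * (1 + \<bar>a\<bar>) ^ m"
proof -
  define z where "z = Complex a b"
  define w where "w = complex_of_real (sgn a * (1 + \<bar>a\<bar>))"
  have z: "cmod z \<le> 3 * (1 + \<bar>a\<bar>)"
    unfolding z_def using cmod_le[of "Complex a b"] b by simp
  have "cmod w \<le> 1 + \<bar>a\<bar>" unfolding w_def norm_of_real abs_mult by (cases "a = 0") (auto simp: abs_sgn_eq)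
  then have w: "cmod w \<le> 3 * (1 + \<bar>a\<bar>)" by simp
  have "z - w = Complex (a - sgn a * (1 + \<bar>a\<bar>)) b"
    by (simp add: z_def w_def complex_eq_iff)
  moreover have "\<bar>a - sgn a * (1 + \<bar>a\<bar>)\<bar> \<le> 1" by (auto simp: sgn_if)
  ultimately have zw: "cmod (z - w) \<le> 3" using cmod_le[of "z - w"] b by simp
  have "cmod (z ^ Suc m - w ^ Suc m) = cmod (z - w) * cmod (\<Sum>i<Suc m. w ^ (Suc m - Suc i) * z ^ i)"
    by (simp only: power_diff_sumr2 norm_mult)
  also have "\<dots> \<le> 3 * (\<Sum>i<Suc m. (3 * (1 + \<bar>a\<bar>)) ^ m)"
  proof (intro mult_mono zw order_trans[OF norm_sum] sum_mono)
    fix i assume i: "i \<in> {..<Suc m}"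
    have "cmod (w ^ (Suc m - Suc i) * z ^ i) \<le> (3 * (1 + \<bar>a\<bar>)) ^ (Suc m - Suc i) * (3 * (1 + \<bar>a\<bar>)) ^ i"
      unfolding norm_mult norm_power by (intro mult_mono power_mono[OF w] power_mono[OF z]) auto
    also have "\<dots> = (3 * (1 + \<bar>a\<bar>)) ^ m" using i by (simp flip: power_add)
    finally show "cmod (w ^ (Suc m - Suc i) * z ^ i) \<le> (3 * (1 + \<bar>a\<bar>)) ^ m" .
  qed auto
  also have "\<dots> = 3 * real (Suc m) * 3 ^ m * (1 + \<bar>a\<bar>) ^ m"
    by (simp only: power_mult_distrib sum_constant card_lessThan mult.assoc)
  finally show ?thesis by (simp add: z_def w_def)
qed

text \<open>Removing the leading monomial lowers the degree, and \<open>power_strip_bound\<close>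
  replaces the monomial by a real power. For even \<open>m\<close> the exponent is odd and the sign
  of \<open>a\<close> survives.\<close>

lemma poly_strip_asymptotics:
  fixes r :: "complex poly"
  assumes deg: "degree r \<le> Suc m" and co: "coeff r (Suc m) = of_real (- c)"
  shows "\<exists>K\<ge>0. \<forall>a b. \<bar>b\<bar> \<le> 2 \<longrightarrow>
    \<bar>Re (poly r (Complex a b)) + c * (if even m then sgn a else 1) * (1 + \<bar>a\<bar>) ^ Suc m\<bar> \<le> K * (1 + \<bar>a\<bar>) ^ m \<and>
    \<bar>Im (poly r (Complex a b))\<bar> \<le> K * (1 + \<bar>a\<bar>) ^ m"
proof -
  define r' where "r' = r - monom (of_real (- c)) (Suc m)"
  have "degree r' \<le> m"
  proof (rule degree_le, intro allI impI)
    fix i assume "m < i"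
    then show "coeff r' i = 0"
      using deg co coeff_eq_0[of r i] by (cases "i = Suc m") (auto simp: r'_def coeff_monom)
  qed
  then obtain K where K: "K \<ge> 0" "\<And>a b. \<bar>b\<bar> \<le> 2 \<Longrightarrow> cmod (poly r' (Complex a b)) \<le> K * (1 + \<bar>a\<bar>) ^ m"
    using poly_strip_bound by blast
  define K' where "K' = K + \<bar>c\<bar> * (3 * real (Suc m) * 3 ^ m) + \<bar>c\<bar>"
  have "K' \<ge> 0" using K by (simp add: K'_def)
  moreover have "\<bar>Re (poly r (Complex a b)) + c * (if even m then sgn a else 1) * (1 + \<bar>a\<bar>) ^ Suc m\<bar> \<le> K' * (1 + \<bar>a\<bar>) ^ m \<and>
    \<bar>Im (poly r (Complex a b))\<bar> \<le> K' * (1 + \<bar>a\<bar>) ^ m" if b: "\<bar>b\<bar> \<le> 2" for a b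
  proof -
    define t where "t = (sgn a * (1 + \<bar>a\<bar>)) ^ Suc m"
    define d where "d = poly r (Complex a b) + of_real (c * t)"
    have "poly r (Complex a b) = poly r' (Complex a b) - of_real c * Complex a b ^ Suc m"
      by (simp add: r'_def poly_monom)
    then have "d = poly r' (Complex a b) - of_real c * (Complex a b ^ Suc m - of_real t)"
      by (simp add: d_def algebra_simps)
    then have "cmod d \<le> cmod (poly r' (Complex a b)) + cmod (of_real c * (Complex a b ^ Suc m - of_real t))"
      by (simp only: norm_triangle_ineq4)
    also have "\<dots> \<le> K * (1 + \<bar>a\<bar>) ^ m + \<bar>c\<bar> * (3 * real (Suc m) * 3 ^ m * (1 + \<bar>a\<bar>) ^ m)"
      unfolding norm_mult norm_of_real
      using K(2)[OF b, of a] power_strip_bound[OF b, of a m] by (intro add_mono mult_left_mono) (auto simp: t_def)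
    finally have d: "cmod d \<le> (K + \<bar>c\<bar> * (3 * real (Suc m) * 3 ^ m)) * (1 + \<bar>a\<bar>) ^ m"
      by (simp add: algebra_simps)
    \<comment> \<open>Both sides agree unless \<open>a = 0\<close>, where the sign vanishes and the
      discrepancy is at most 1.\<close>
    have t: "\<bar>t - (if even m then sgn a else 1) * (1 + \<bar>a\<bar>) ^ Suc m\<bar> \<le> (1 + \<bar>a\<bar>) ^ m"
    proof (cases "a = 0")
      case True
      then show ?thesis by (simp add: t_def)
    next
      case False
      then have "sgn a ^ Suc m = (if even m then sgn a else 1)"
        by (auto simp: sgn_if minus_one_power_iff)
      then show ?thesis by (simp only: t_def power_mult_distrib) simp
    qed
    have "\<bar>c * (t - (if even m then sgn a else 1) * (1 + \<bar>a\<bar>) ^ Suc m)\<bar> \<le> \<bar>c\<bar> * (1 + \<bar>a\<bar>) ^ m"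
      unfolding abs_mult[of c] using t by (intro mult_left_mono) auto
    moreover have "\<bar>Re d\<bar> \<le> cmod d" "\<bar>Im d\<bar> \<le> cmod d" by (rule abs_Re_le_cmod abs_Im_le_cmod)+
    moreover have "Re d = Re (poly r (Complex a b)) + c * t" "Im d = Im (poly r (Complex a b))"
      by (simp_all add: d_def)
    moreover have "K' * (1 + \<bar>a\<bar>) ^ m = (K + \<bar>c\<bar> * (3 * real (Suc m) * 3 ^ m)) * (1 + \<bar>a\<bar>) ^ m + \<bar>c\<bar> * (1 + \<bar>a\<bar>) ^ m"
      by (simp add: K'_def algebra_simps)
    moreover have "\<bar>c\<bar> * (1 + \<bar>a\<bar>) ^ m \<ge> 0" by simp
    moreover have "c * (t - (if even m then sgn a else 1) * (1 + \<bar>a\<bar>) ^ Suc m)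
      = c * t - c * (if even m then sgn a else 1) * (1 + \<bar>a\<bar>) ^ Suc m"
      by (simp only: right_diff_distrib mult.assoc)
    ultimately show ?thesis using d unfolding abs_le_iff by linarith
  qed
  ultimately show ?thesis by blast
qed

definition F_cpoly :: "nat \<Rightarrow> (nat \<Rightarrow> real) \<Rightarrow> complex poly" where
  "F_cpoly k x = - (\<Prod>i=1..2*k. [:- of_real (x i), 1:])"

lemma F_poly_eq: "F_poly k x z = poly (F_cpoly k x) z"
  by (simp add: F_poly_def F_cpoly_def poly_prod)

lemma F_cpoly_degree: "degree (F_cpoly k x) = 2 * k" "coeff (F_cpoly k x) (2 * k) = - 1"
proof -
  have "degree (\<Prod>i=1..2*k. [:- complex_of_real (x i), 1:]) = (\<Sum>i=1..2*k. degree [:- complex_of_real (x i), 1:])"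
    by (intro degree_prod_eq_sum_degree) auto
  also have "\<dots> = 2 * k" by simp
  finally have d: "degree (\<Prod>i=1..2*k. [:- complex_of_real (x i), 1:]) = 2 * k" .
  then show "degree (F_cpoly k x) = 2 * k" by (simp add: F_cpoly_def)
  have "lead_coeff (\<Prod>i=1..2*k. [:- complex_of_real (x i), 1:]) = 1"
    by (simp only: lead_coeff_prod) simp
  then show "coeff (F_cpoly k x) (2 * k) = - 1" using d by (simp add: F_cpoly_def)
qed

text \<open>Real and imaginary parts go through the induction together, since each enters the
  product of the other.\<close>

lemma Re_F_polynomial: "real_polynomial_function (\<lambda>q. Re (poly (F_cpoly k x) (Complex (fst q) (snd q))))"
proof -
  have lin: "real_polynomial_function (fst :: real \<times> real \<Rightarrow> real)" "real_polynomial_function (snd :: real \<times> real \<Rightarrow> real)"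
    by (auto intro: real_polynomial_function.intros(1) bounded_linear_fst bounded_linear_snd)
  have "real_polynomial_function (\<lambda>q. Re (\<Prod>i\<in>S. Complex (fst q) (snd q) - of_real (x i))) \<and>
      real_polynomial_function (\<lambda>q. Im (\<Prod>i\<in>S. Complex (fst q) (snd q) - of_real (x i)))" if "finite S" for S
    using that
  proof (induction S)
    case (insert j S)
    show ?case
      unfolding prod.insert[OF insert(1,2)] times_complex.sel minus_complex.sel complex.sel Re_complex_of_real Im_complex_of_real
      by (intro conjI real_polynomial_function_diff real_polynomial_function.intros(2-4) lin
          insert.IH[THEN conjunct1] insert.IH[THEN conjunct2])
  qed auto
  from this[of "{1..2*k}"] show ?thesis
    by (simp add: F_poly_eq[symmetric] F_poly_def real_polynomial_function_minus)
qed

text \<open>Exactly \<open>2 * k - j\<close> of the factors are negative, and this number has the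
  parity of \<open>j\<close>; the leading minus belongs to \<open>F\<close>.\<close>

lemma F_poly_axis_sign:
  fixes x :: "nat \<Rightarrow> real"
  assumes j: "j \<le> 2 * k"
    and lo: "\<And>i. i \<in> {1..j} \<Longrightarrow> x i < t" and hi: "\<And>i. i \<in> {j<..2*k} \<Longrightarrow> t < x i"
  shows "Re (F_poly k x (Complex t 0)) = - ((- 1) ^ j * (\<Prod>i=1..2*k. \<bar>t - x i\<bar>))"
    "(\<Prod>i=1..2*k. \<bar>t - x i\<bar>) > 0"
proof -
  have un: "{1..2*k} = {1..j} \<union> {j<..2*k}" using j by auto
  have split: "prod g {1..2*k} = prod g {1..j} * prod g {j<..2*k}" for g :: "nat \<Rightarrow> real"
    unfolding un by (rule prod.union_disjoint) auto
  have "(\<Prod>i=1..2*k. t - x i) = (\<Prod>i=1..j. \<bar>t - x i\<bar>) * (\<Prod>i\<in>{j<..2*k}. - \<bar>t - x i\<bar>)"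
  proof -
    have "t - x i = \<bar>t - x i\<bar>" if "i \<in> {1..j}" for i using lo[OF that] by simp
    moreover have "t - x i = - \<bar>t - x i\<bar>" if "i \<in> {j<..2*k}" for i using hi[OF that] by simp
    ultimately show ?thesis
      unfolding split by (intro arg_cong2[where f = "(*)"] prod.cong refl)
  qed
  also have "(\<Prod>i\<in>{j<..2*k}. - \<bar>t - x i\<bar>) = (- 1) ^ (2 * k - j) * (\<Prod>i\<in>{j<..2*k}. \<bar>t - x i\<bar>)"
    by (simp add: prod_uminus)
  also have "(- 1 :: real) ^ (2 * k - j) = (- 1) ^ j" using j by (simp add: minus_one_power_iff)
  finally have "(\<Prod>i=1..2*k. t - x i) = (- 1) ^ j * (\<Prod>i=1..2*k. \<bar>t - x i\<bar>)"
    unfolding split by (simp add: mult_ac)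
  moreover have "F_poly k x (Complex t 0) = - of_real (\<Prod>i=1..2*k. t - x i)"
    by (simp add: F_poly_def Complex_eq of_real_prod)
  ultimately show "Re (F_poly k x (Complex t 0)) = - ((- 1) ^ j * (\<Prod>i=1..2*k. \<bar>t - x i\<bar>))"
    by (simp only: uminus_complex.sel Re_complex_of_real)
  have "t \<noteq> x i" if "i \<in> {1..2*k}" for i
    using lo[of i] hi[of i] that by (cases "i \<le> j") auto
  then show "(\<Prod>i=1..2*k. \<bar>t - x i\<bar>) > 0" by (intro prod_pos) auto
qed

text \<open>With \<open>e = \<epsilon> * sqrt \<epsilon>\<close> the two inequalities between
  \<open>e\<close>, \<open>\<epsilon>\<close> and \<open>\<epsilon>\<^sup>2\<close> both reduce to
  \<open>sqrt \<epsilon> \<le> s\<close>, and \<tau> is defined by the equation it has to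
  satisfy.\<close>

lemma small_parameters:
  fixes s :: real
  assumes s: "0 < s" "s \<le> 1"
  shows "\<exists>\<epsilon>1>0. \<forall>\<epsilon>\<in>{0<..<\<epsilon>1 :: real}. \<exists>\<tau>. let e = \<epsilon> powr (3/2) in
    e > 0 \<and> e \<le> s * \<epsilon> \<and> \<epsilon>\<^sup>2 \<le> e * s \<and> e * \<tau> ^ (N + 4) = 4 \<and> \<epsilon> * \<tau>\<^sup>2 \<le> s \<and> 1 \<le> s * \<tau> \<and> \<tau> \<ge> 2"
proof -
  \<comment> \<open>A lower bound to be enforced on \<tau>; the summands serve
    \<open>\<tau> \<ge> 2\<close>, \<open>1 \<le> s * \<tau>\<close> and
    \<open>\<epsilon> * \<tau>\<^sup>2 \<le> s\<close> in this order.\<close>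
  define Y where "Y = 2 + 1 / s + 4 / s\<^sup>2"
  have Y: "Y \<ge> 2" "Y \<ge> 1 / s" "Y \<ge> 4 / s\<^sup>2" using s by (auto simp: Y_def)
  define \<epsilon>1 where "\<epsilon>1 = min 1 (min (s\<^sup>2) (4 / Y ^ (N + 4)))"
  have "\<epsilon>1 > 0" using s Y by (auto simp: \<epsilon>1_def)
  moreover have "\<exists>\<tau>. let e = \<epsilon> powr (3/2) in
    e > 0 \<and> e \<le> s * \<epsilon> \<and> \<epsilon>\<^sup>2 \<le> e * s \<and> e * \<tau> ^ (N + 4) = 4 \<and> \<epsilon> * \<tau>\<^sup>2 \<le> s \<and> 1 \<le> s * \<tau> \<and> \<tau> \<ge> 2"
    if \<epsilon>: "\<epsilon> \<in> {0<..<\<epsilon>1}" for \<epsilon>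
  proof -
    have e0: "\<epsilon> > 0" "\<epsilon> < 1" "\<epsilon> < s\<^sup>2" "\<epsilon> < 4 / Y ^ (N + 4)" using \<epsilon> by (auto simp: \<epsilon>1_def)
    define e where "e = \<epsilon> powr (3/2)"
    define q where "q = sqrt \<epsilon>"
    have q: "q > 0" "q * q = \<epsilon>" "q < 1" "q \<le> s" using e0 s by (auto simp: q_def real_le_lsqrt)
    have "\<epsilon> powr (1 + 1 / 2) = \<epsilon> powr 1 * \<epsilon> powr (1 / 2)" by (rule powr_add)
    then have eq: "e = \<epsilon> * q" using e0 by (simp add: e_def q_def powr_half_sqrt)
    have epos: "e > 0" using eq e0 q by simp
    have e_eps: "e \<le> \<epsilon>" using eq e0 q by simp
    define \<tau> where "\<tau> = root (N + 4) (4 / e)"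
    have \<tau>n: "\<tau> ^ (N + 4) = 4 / e" unfolding \<tau>_def using epos by (intro real_root_pow_pos2) auto
    have \<tau>0: "\<tau> \<ge> 0" unfolding \<tau>_def using epos by (intro real_root_ge_zero) auto
    have \<tau>Y: "\<tau> \<ge> Y"
    proof (rule power_le_imp_le_base[of Y "N + 3"])
      have "e * Y ^ (N + 4) \<le> \<epsilon> * Y ^ (N + 4)" using e_eps Y by (intro mult_right_mono) auto
      also have "\<dots> \<le> 4" using e0(4) Y by (simp add: field_simps)
      finally have "Y ^ (N + 4) \<le> \<tau> ^ (N + 4)"
        unfolding \<tau>n using epos by (simp add: pos_le_divide_eq mult.commute)
      then show "Y ^ Suc (N + 3) \<le> \<tau> ^ Suc (N + 3)" by (simp add: add.commute)
    qed (rule \<tau>0)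
    have e\<tau>: "e * \<tau> ^ (N + 4) = 4" using \<tau>n epos by simp
    have "\<tau> \<ge> 4 / s\<^sup>2" "\<tau> \<ge> 2" "\<tau> \<ge> 1 / s" using \<tau>Y Y by auto
    \<comment> \<open>Cubing turns \<epsilon> into the square of \<open>e\<close>: times
      \<open>\<tau>\<^sup>2\<close> the left side is \<open>e\<^sup>2 * \<tau> ^ 8\<close>, at most
      the square of \<open>e * \<tau> ^ (N + 4) = 4\<close>.\<close>
    have "(\<epsilon> * \<tau>\<^sup>2) ^ 3 \<le> s ^ 3"
    proof -
      have "1 \<le> \<tau> ^ (2 * N)" using \<open>\<tau> \<ge> 2\<close> by (intro one_le_power) auto
      then have "(e\<^sup>2 * \<tau> ^ 8) * 1 \<le> (e\<^sup>2 * \<tau> ^ 8) * \<tau> ^ (2 * N)" by (intro mult_left_mono) auto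
      also have "\<dots> = (e * \<tau> ^ (N + 4))\<^sup>2"
        by (simp add: power_mult_distrib power_mult[symmetric] power_add[symmetric] mult.assoc add.commute mult.commute)
      finally have "e\<^sup>2 * \<tau> ^ 8 \<le> 16" by (simp add: e\<tau>)
      moreover have "(\<epsilon> * \<tau>\<^sup>2) ^ 3 * \<tau>\<^sup>2 = e\<^sup>2 * \<tau> ^ 8"
        unfolding eq q(2)[symmetric] by (simp add: numeral_eq_Suc mult_ac)
      ultimately have "(\<epsilon> * \<tau>\<^sup>2) ^ 3 * \<tau>\<^sup>2 \<le> 16" by simp
      moreover have "16 \<le> s ^ 3 * \<tau>\<^sup>2"
      proof -
        have "4 \<le> s\<^sup>2 * \<tau>" using \<open>\<tau> \<ge> 4 / s\<^sup>2\<close> s by (simp add: field_simps)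
        then have "4\<^sup>2 \<le> (s\<^sup>2 * \<tau>)\<^sup>2" by (intro power_mono) auto
        also have "\<dots> = s * (s ^ 3 * \<tau>\<^sup>2)" by (simp add: power_mult_distrib numeral_eq_Suc mult_ac)
        also have "\<dots> \<le> 1 * (s ^ 3 * \<tau>\<^sup>2)" using s by (intro mult_right_mono) auto
        finally show ?thesis by simp
      qed
      ultimately have "(\<epsilon> * \<tau>\<^sup>2) ^ 3 * \<tau>\<^sup>2 \<le> s ^ 3 * \<tau>\<^sup>2" by linarith
      then show ?thesis using \<open>\<tau> \<ge> 2\<close> by simp
    qed
    then have "\<epsilon> * \<tau>\<^sup>2 \<le> s"
      using power_le_imp_le_base[of "\<epsilon> * \<tau>\<^sup>2" 2 s] s by (simp add: numeral_eq_Suc)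
    moreover have "e \<le> s * \<epsilon>" using q e0 by (simp add: eq mult.commute mult_right_mono)
    moreover have "\<epsilon>\<^sup>2 \<le> e * s"
    proof -
      have "\<epsilon>\<^sup>2 = e * q" using q(2) by (simp add: eq power2_eq_square mult.assoc)
      then show ?thesis using q epos by simp
    qed
    moreover have "1 \<le> s * \<tau>" using \<open>\<tau> \<ge> 1 / s\<close> s by (simp add: field_simps)
    ultimately show ?thesis
      using epos e\<tau> \<open>\<tau> \<ge> 2\<close> unfolding e_def Let_def by blast
  qed
  ultimately show ?thesis by blast
qed

definition VF :: "nat \<Rightarrow> (nat \<Rightarrow> real) \<Rightarrow> nat \<Rightarrow> real \<times> real \<Rightarrow> real" where
  "VF k x j q = Re (poly ((pderiv ^^ j) (F_cpoly k x)) (Complex (fst q) (snd q)))"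

definition WF :: "nat \<Rightarrow> (nat \<Rightarrow> real) \<Rightarrow> nat \<Rightarrow> real \<times> real \<Rightarrow> real" where
  "WF k x j q = Im (poly ((pderiv ^^ j) (F_cpoly k x)) (Complex (fst q) (snd q)))"

lemma VF_WF_derivative:
  "(VF k x j has_derivative (\<lambda>h. VF k x (Suc j) p * fst h - WF k x (Suc j) p * snd h)) (at p)"
  "(WF k x j has_derivative (\<lambda>h. WF k x (Suc j) p * fst h + VF k x (Suc j) p * snd h)) (at p)"
  unfolding VF_def[abs_def] WF_def[abs_def] funpow.simps o_apply by (rule poly_Complex_derivative)+

lemma VF_WF_bounds:
  assumes k: "2 * k = N + 4" and j: "j \<le> 3"
  shows "\<exists>K\<ge>0. \<forall>a b. \<bar>b\<bar> \<le> 2 \<longrightarrow>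
    \<bar>VF k x j (a, b) + (\<Prod>i<j. real (N + 4 - i)) * (if odd j then sgn a else 1) * (1 + \<bar>a\<bar>) ^ (N + 4 - j)\<bar>
      \<le> K * (1 + \<bar>a\<bar>) ^ (N + 3 - j) \<and>
    \<bar>WF k x j (a, b)\<bar> \<le> K * (1 + \<bar>a\<bar>) ^ (N + 3 - j)"
proof -
  have "degree ((pderiv ^^ j) (F_cpoly k x)) = N + 4 - j \<and>
      coeff ((pderiv ^^ j) (F_cpoly k x)) (N + 4 - j) = of_real (- (\<Prod>i<j. real (N + 4 - i)))"
    using j
  proof (induction j)
    case 0
    then show ?case using F_cpoly_degree[of k x] k by simp
  next
    case (Suc j)
    let ?r = "(pderiv ^^ j) (F_cpoly k x)"
    have IH: "degree ?r = N + 4 - j" "coeff ?r (N + 4 - j) = of_real (- (\<Prod>i<j. real (N + 4 - i)))"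
      using Suc by auto
    have S: "Suc (N + 4 - Suc j) = N + 4 - j" using Suc.prems by simp
    have "coeff (pderiv ?r) (N + 4 - Suc j) = of_nat (N + 4 - j) * of_real (- (\<Prod>i<j. real (N + 4 - i)))"
      by (simp only: coeff_pderiv S IH(2))
    then show ?case
      using IH(1) by (simp add: degree_pderiv mult.commute)
  qed
  moreover have S: "Suc (N + 3 - j) = N + 4 - j" using j by simp
  ultimately have d: "degree ((pderiv ^^ j) (F_cpoly k x)) \<le> Suc (N + 3 - j)"
    "coeff ((pderiv ^^ j) (F_cpoly k x)) (Suc (N + 3 - j)) = of_real (- (\<Prod>i<j. real (N + 4 - i)))"
    by (simp_all only:)
  have "even N" using k by presburger
  then have ev: "even (N + 3 - j) \<longleftrightarrow> odd j" using j by simp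
  show ?thesis
    using poly_strip_asymptotics[OF d] unfolding ev S VF_def WF_def fst_conv snd_conv .
qed

text \<open>The constant \<open>A\<close> of the locale, named outside it because \<open>s\<close>
  is chosen before any instance exists.\<close>

definition "strip_const N B = 12 + 4 * ((real N + 4) * (real N + 3)) + 4 * B
  + 4 * ((real N + 4) * (real N + 3) * (real N + 2))"

definition "F_strip k x N B \<epsilon> \<tau> s = strip N B \<epsilon> (\<epsilon> powr (3/2)) \<tau> s (VF k x 0) (VF k x 1) (VF k x 2) (VF k x 3)
  (WF k x 1) (WF k x 2) (WF k x 3)"

text \<open>The order of quantifiers is the point: \<open>B\<close> depends on the polynomial alone,
  so \<open>s\<close> can be adapted to it before \<epsilon> and \<tau> are chosen.\<close>

lemma F_strip_exists:
  assumes k: "2 * k = N + 4"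
  shows "\<exists>B\<ge>1. \<forall>\<epsilon> \<tau> s. 0 < \<epsilon> \<and> 0 < s \<and> \<epsilon> powr (3/2) \<le> s * \<epsilon> \<and> \<epsilon> powr (3/2) * \<tau> ^ (N + 4) = 4
      \<and> \<epsilon> * \<tau>\<^sup>2 \<le> s \<and> 1 \<le> s * \<tau> \<and> 2 \<le> \<tau> \<and> 1000 * strip_const N B ^ 3 * s \<le> 1
      \<and> s * (2 * B) ^ (N + 2) * strip_const N B \<le> 1 \<longrightarrow> F_strip k x N B \<epsilon> \<tau> s"
proof -
  have "\<forall>j\<in>{..3}. \<exists>K\<ge>0. \<forall>a b. \<bar>b\<bar> \<le> 2 \<longrightarrow>
    \<bar>VF k x j (a, b) + (\<Prod>i<j. real (N + 4 - i)) * (if odd j then sgn a else 1) * (1 + \<bar>a\<bar>) ^ (N + 4 - j)\<bar>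
      \<le> K * (1 + \<bar>a\<bar>) ^ (N + 3 - j) \<and> \<bar>WF k x j (a, b)\<bar> \<le> K * (1 + \<bar>a\<bar>) ^ (N + 3 - j)"
    using VF_WF_bounds[OF k] by blast
  then obtain K where K: "\<And>j. j \<le> 3 \<Longrightarrow> K j \<ge> 0" "\<And>j a b. j \<le> 3 \<Longrightarrow> \<bar>b\<bar> \<le> 2 \<Longrightarrow>
    \<bar>VF k x j (a, b) + (\<Prod>i<j. real (N + 4 - i)) * (if odd j then sgn a else 1) * (1 + \<bar>a\<bar>) ^ (N + 4 - j)\<bar>
      \<le> K j * (1 + \<bar>a\<bar>) ^ (N + 3 - j) \<and> \<bar>WF k x j (a, b)\<bar> \<le> K j * (1 + \<bar>a\<bar>) ^ (N + 3 - j)"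
    unfolding Ball_def atMost_iff by metis
  define B where "B = 1 + (\<Sum>j\<le>3. K j)"
  have KB: "K j \<le> B" if "j \<le> 3" for j
    unfolding B_def using member_le_sum[of j "{..3}" K] that K(1) by auto
  have "B \<ge> 1" using K(1) by (auto simp: B_def intro!: sum_nonneg)
  have b: "\<bar>VF k x j (a, b) + (\<Prod>i<j. real (N + 4 - i)) * (if odd j then sgn a else 1) * (1 + \<bar>a\<bar>) ^ (N + 4 - j)\<bar>
      \<le> B * (1 + \<bar>a\<bar>) ^ (N + 3 - j)" "\<bar>WF k x j (a, b)\<bar> \<le> B * (1 + \<bar>a\<bar>) ^ (N + 3 - j)"
    if "j \<le> 3" "\<bar>b\<bar> \<le> 2" for j a b
  proof -
    have "K j * (1 + \<bar>a\<bar>) ^ (N + 3 - j) \<le> B * (1 + \<bar>a\<bar>) ^ (N + 3 - j)"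
      using KB[OF that(1)] by (intro mult_right_mono) auto
    then show "\<bar>VF k x j (a, b) + (\<Prod>i<j. real (N + 4 - i)) * (if odd j then sgn a else 1) * (1 + \<bar>a\<bar>) ^ (N + 4 - j)\<bar>
      \<le> B * (1 + \<bar>a\<bar>) ^ (N + 3 - j)" "\<bar>WF k x j (a, b)\<bar> \<le> B * (1 + \<bar>a\<bar>) ^ (N + 3 - j)"
      using K(2)[OF that, of a] by linarith+
  qed
  have pr: "(\<Prod>i<0. real (N + 4 - i)) = 1" "(\<Prod>i<1. real (N + 4 - i)) = real N + 4"
    "(\<Prod>i<2. real (N + 4 - i)) = (real N + 4) * (real N + 3)"
    "(\<Prod>i<3. real (N + 4 - i)) = (real N + 4) * (real N + 3) * (real N + 2)"
    by (simp_all add: eval_nat_numeral add.commute)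
  have ar: "N + 4 - 0 = N + 4" "N + 3 - 0 = N + 3" "N + 4 - 1 = N + 3" "N + 3 - 1 = N + 2"
    "N + 4 - 2 = N + 2" "N + 3 - 2 = N + 1" "N + 4 - 3 = N + 1" "N + 3 - 3 = N" by auto
  have "F_strip k x N B \<epsilon> \<tau> s" if h: "0 < \<epsilon>" "0 < s" "\<epsilon> powr (3/2) \<le> s * \<epsilon>" "\<epsilon> powr (3/2) * \<tau> ^ (N + 4) = 4"
    "\<epsilon> * \<tau>\<^sup>2 \<le> s" "1 \<le> s * \<tau>" "2 \<le> \<tau>" "1000 * strip_const N B ^ 3 * s \<le> 1"
    "s * (2 * B) ^ (N + 2) * strip_const N B \<le> 1" for \<epsilon> \<tau> s
    unfolding F_strip_def
  proof
    show "(VF k x 0 has_derivative (\<lambda>h. VF k x 1 p * fst h - WF k x 1 p * snd h)) (at p)" for p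
      using VF_WF_derivative(1)[of k x 0 p] by simp
    show "(VF k x 1 has_derivative (\<lambda>h. VF k x 2 p * fst h - WF k x 2 p * snd h)) (at p)" for p
      using VF_WF_derivative(1)[of k x 1 p] by (simp add: eval_nat_numeral)
    show "(VF k x 2 has_derivative (\<lambda>h. VF k x 3 p * fst h - WF k x 3 p * snd h)) (at p)" for p
      using VF_WF_derivative(1)[of k x 2 p] by (simp add: eval_nat_numeral)
    show "(WF k x 1 has_derivative (\<lambda>h. WF k x 2 p * fst h + VF k x 2 p * snd h)) (at p)" for p
      using VF_WF_derivative(2)[of k x 1 p] by (simp add: eval_nat_numeral)
    show "(WF k x 2 has_derivative (\<lambda>h. WF k x 3 p * fst h + VF k x 3 p * snd h)) (at p)" for p
      using VF_WF_derivative(2)[of k x 2 p] by (simp add: eval_nat_numeral)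
    fix a y :: real assume y: "\<bar>y\<bar> \<le> 2"
    show "\<bar>VF k x 0 (a, y) + (1 + \<bar>a\<bar>) ^ (N + 4)\<bar> \<le> B * (1 + \<bar>a\<bar>) ^ (N + 3)"
      using b(1)[of 0 y a] y unfolding pr ar by simp
    show "\<bar>VF k x 1 (a, y) + (real N + 4) * sgn a * (1 + \<bar>a\<bar>) ^ (N + 3)\<bar> \<le> B * (1 + \<bar>a\<bar>) ^ (N + 2)"
      using b(1)[of 1 y a] y unfolding pr ar by simp
    show "\<bar>VF k x 2 (a, y) + (real N + 4) * (real N + 3) * (1 + \<bar>a\<bar>) ^ (N + 2)\<bar> \<le> B * (1 + \<bar>a\<bar>) ^ (N + 1)"
      using b(1)[of 2 y a] y unfolding pr ar by simp
    show "\<bar>VF k x 3 (a, y) + (real N + 4) * (real N + 3) * (real N + 2) * sgn a * (1 + \<bar>a\<bar>) ^ (N + 1)\<bar>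
        \<le> B * (1 + \<bar>a\<bar>) ^ N"
      using b(1)[of 3 y a] y unfolding pr ar by simp
    show "\<bar>WF k x 1 (a, y)\<bar> \<le> B * (1 + \<bar>a\<bar>) ^ (N + 2)"
      using b(2)[of 1 y a] y unfolding ar by simp
    show "\<bar>WF k x 2 (a, y)\<bar> \<le> B * (1 + \<bar>a\<bar>) ^ (N + 1)"
      using b(2)[of 2 y a] y unfolding ar by simp
    show "\<bar>WF k x 3 (a, y)\<bar> \<le> B * (1 + \<bar>a\<bar>) ^ N"
      using b(2)[of 3 y a] y unfolding ar by simp
  qed (use h \<open>B \<ge> 1\<close> in \<open>auto simp: strip_const_def\<close>)
  with \<open>B \<ge> 1\<close> show ?thesis by blast
qed

text \<open>Exports the results of the locale as statements about \<open>Omega\<close>, because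
  different values of \<open>s\<close> and \<tau> are used for the same domain later on. The root
  \<open>x 1\<close> inside the box identifies the component.\<close>

lemma Omega_facts:
  assumes S: "F_strip k x N B \<epsilon> \<tau> s" and x1: "\<bar>x 1\<bar> < \<tau> - 1" and k: "k \<ge> 1"
  shows "smooth_bounded_domain (Omega k x \<epsilon>)" "torsion_domain (Omega k x \<epsilon>) (u_eps k x \<epsilon>)"
    "\<exists>p\<in>frontier (Omega k x \<epsilon>). Curv (Omega k x \<epsilon>) p < 0" "\<exists>p\<in>frontier (Omega k x \<epsilon>). Curv (Omega k x \<epsilon>) p > 0"
    "card {p \<in> frontier (Omega k x \<epsilon>). Curv (Omega k x \<epsilon>) p = 0} = 2"
    "\<exists>q\<in>frontier (Omega k x \<epsilon>). (\<forall>p\<in>frontier (Omega k x \<epsilon>). Curv (Omega k x \<epsilon>) q \<le> Curv (Omega k x \<epsilon>) p)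
      \<and> \<bar>Curv (Omega k x \<epsilon>) q\<bar> \<le> 32 * strip_const N B * \<epsilon>"
    "Omega k x \<epsilon> = {p. \<bar>fst p\<bar> < \<tau> - 1 \<and> \<bar>snd p\<bar> < 2 \<and> u_eps k x \<epsilon> p > 0}"
    "\<And>p R. \<lbrakk>\<bar>fst p\<bar> \<le> \<tau> - 1; \<bar>snd p\<bar> \<le> 2; 1 + \<bar>fst p\<bar> \<le> R; s * R ^ (N + 2) \<le> 1\<rbrakk>
      \<Longrightarrow> \<bar>u_eps k x \<epsilon> p - (1 / 2 - (snd p)\<^sup>2 / 2)\<bar> \<le> strip_const N B * s"
    "\<And>c t y. \<lbrakk>c = 4 + 3 * t\<^sup>2 + B * (1 + \<bar>t\<bar>) ^ (N + 2); c\<^sup>2 * s \<le> - 2 * VF k x 0 (t, 0);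
      \<epsilon>\<^sup>2 \<le> \<epsilon> powr (3/2) * s; \<bar>y\<bar> \<le> 2\<rbrakk> \<Longrightarrow> u_eps k x \<epsilon> (t, y) \<le> 1 / 2"
proof -
  interpret strip N B \<epsilon> "\<epsilon> powr (3/2)" \<tau> s "VF k x 0" "VF k x 1" "VF k x 2" "VF k x 3" "WF k x 1" "WF k x 2" "WF k x 3"
    using S by (simp add: F_strip_def)
  have u: "u_eps k x \<epsilon> = U"
    by (auto simp: fun_eq_iff u_eps_def U_def VF_def F_poly_eq)
  have Ac: "strip_const N B = A"
    by (simp add: strip_const_def A_def c2_def c3_def)
  have "1 \<in> {1..2*k}" using k by auto
  then have "(\<Prod>i=1..2*k. complex_of_real (x 1) - of_real (x i)) = 0"
    by (intro prod_zero) auto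
  then have "F_poly k x (Complex (x 1) 0) = 0"
    by (simp add: F_poly_def Complex_eq)
  then have "U (x 1, 0) = 1 / 2"
    by (simp add: U_def VF_def F_poly_eq)
  then have "(x 1, 0) \<in> \<Omega>'"
    using x1 by (simp add: \<Omega>'_def obox_def)
  then have O: "Omega k x \<epsilon> = \<Omega>'"
    unfolding Omega_def u by (rule component_eq)
  have poly: "real_polynomial_function (VF k x 0)"
    using Re_F_polynomial[of k x] by (simp add: VF_def[abs_def])
  show "smooth_bounded_domain (Omega k x \<epsilon>)" "torsion_domain (Omega k x \<epsilon>) (u_eps k x \<epsilon>)"
    unfolding O u using \<Omega>'_smooth_bounded_domain[OF poly] by auto
  show "\<exists>p\<in>frontier (Omega k x \<epsilon>). Curv (Omega k x \<epsilon>) p < 0" "\<exists>p\<in>frontier (Omega k x \<epsilon>). Curv (Omega k x \<epsilon>) p > 0"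
    "card {p \<in> frontier (Omega k x \<epsilon>). Curv (Omega k x \<epsilon>) p = 0} = 2"
    "\<exists>q\<in>frontier (Omega k x \<epsilon>). (\<forall>p\<in>frontier (Omega k x \<epsilon>). Curv (Omega k x \<epsilon>) q \<le> Curv (Omega k x \<epsilon>) p)
      \<and> \<bar>Curv (Omega k x \<epsilon>) q\<bar> \<le> 32 * strip_const N B * \<epsilon>"
    unfolding O Ac using curvature_changes_sign card_curvature_zeros min_curvature by blast+
  show "Omega k x \<epsilon> = {p. \<bar>fst p\<bar> < \<tau> - 1 \<and> \<bar>snd p\<bar> < 2 \<and> u_eps k x \<epsilon> p > 0}"
    unfolding O u by (auto simp: \<Omega>'_def obox_def)
  show "\<bar>u_eps k x \<epsilon> p - (1 / 2 - (snd p)\<^sup>2 / 2)\<bar> \<le> strip_const N B * s"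
    if "\<bar>fst p\<bar> \<le> \<tau> - 1" "\<bar>snd p\<bar> \<le> 2" "1 + \<bar>fst p\<bar> \<le> R" "s * R ^ (N + 2) \<le> 1" for p R
    unfolding u Ac using that by (intro compact_approx) (auto simp: kbox_def T_def)
  show "u_eps k x \<epsilon> (t, y) \<le> 1 / 2"
    if "c = 4 + 3 * t\<^sup>2 + B * (1 + \<bar>t\<bar>) ^ (N + 2)" "c\<^sup>2 * s \<le> - 2 * VF k x 0 (t, 0)"
      "\<epsilon>\<^sup>2 \<le> \<epsilon> powr (3/2) * s" "\<bar>y\<bar> \<le> 2" for c t y
    unfolding u by (rule separating_line[OF that])
qed

lemma eventually_small: "L > 0 \<Longrightarrow> \<forall>\<^sub>F s in at_right 0. K * s \<le> L" for K L :: real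
proof -
  assume L: "L > 0"
  have "((\<lambda>s. K * s) \<longlongrightarrow> K * 0) (at_right 0)" by (intro tendsto_intros)
  then have "\<forall>\<^sub>F s in at_right 0. K * s < L" by (rule order_tendstoD) (use L in simp)
  then show ?thesis by eventually_elim simp
qed

theorem theorem1p2:
  fixes k :: nat and x :: "nat \<Rightarrow> real"
  assumes "k \<ge> 2" and "strict_mono_on {1..2*k} x"
  shows "\<exists>\<epsilon>\<^sub>0>0.
    (\<forall>\<epsilon>\<in>{0<..<\<epsilon>\<^sub>0}. smooth_bounded_domain (Omega k x \<epsilon>)) \<and>
    P2 (Omega k x) \<and> P3 (Omega k x) \<epsilon>\<^sub>0 \<and>
    (\<forall>(f :: real \<Rightarrow> real) f' (C :: real) \<epsilon>.
      (\<forall>t\<ge>0. (f has_real_derivative f' t) (at t within {0..})) \<and> continuous_on {0..} f' \<and>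
      f 0 > 0 \<and> C > 0 \<and> \<epsilon> \<in> {0<..<\<epsilon>\<^sub>0} \<longrightarrow>
      (\<exists>lam_bar>0. \<forall>lam\<in>{0<..<lam_bar}. \<forall>u.
         classical_solution (Omega k x \<epsilon>) lam f u \<and> (\<forall>p\<in>Omega k x \<epsilon>. \<bar>u p\<bar> \<le> C) \<longrightarrow>
         semi_stable (Omega k x \<epsilon>) lam f' u \<and> P1 k (Omega k x \<epsilon>) u))"
proof -
  obtain N where N: "2 * k = N + 4" using assms(1) by (metis le_add_diff_inverse2 mult_le_mono2 mult_2 numeral_Bit0)
  obtain B where B: "B \<ge> 1" "\<And>\<epsilon> \<tau> s. 0 < \<epsilon> \<Longrightarrow> 0 < s \<Longrightarrow> \<epsilon> powr (3/2) \<le> s * \<epsilon> \<Longrightarrow> \<epsilon> powr (3/2) * \<tau> ^ (N + 4) = 4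
      \<Longrightarrow> \<epsilon> * \<tau>\<^sup>2 \<le> s \<Longrightarrow> 1 \<le> s * \<tau> \<Longrightarrow> 2 \<le> \<tau> \<Longrightarrow> 1000 * strip_const N B ^ 3 * s \<le> 1
      \<Longrightarrow> s * (2 * B) ^ (N + 2) * strip_const N B \<le> 1 \<Longrightarrow> F_strip k x N B \<epsilon> \<tau> s"
    using F_strip_exists[OF N, of x] by metis
  define Ac where "Ac = strip_const N B"
  have Ac0: "Ac > 0" using B(1) by (simp add: Ac_def strip_const_def add_pos_nonneg)
  \<comment> \<open>On the axis \<open>F\<close> is positive between the roots
    \<open>2 * j - 1\<close> and \<open>2 * j\<close> and negative between \<open>2 * j\<close> and
    \<open>2 * j + 1\<close>; the midpoints mark the peaks and the separating lines.\<close>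
  define m where "m j = (x (2 * j - 1) + x (2 * j)) / 2" for j
  define \<xi> where "\<xi> j = (x (2 * j) + x (2 * j + 1)) / 2" for j
  have mono: "x i < x j" if "i < j" "1 \<le> i" "j \<le> 2 * k" for i j
    using assms(2) that by (auto simp: strict_mono_on_def)
  have monoe: "x i \<le> x j" if "i \<le> j" "1 \<le> i" "j \<le> 2 * k" for i j
    using mono[of i j] that by (cases "i = j") auto
  have mlt: "x (2 * j - 1) < m j" "m j < x (2 * j)" if "j \<in> {1..k}" for j
    using mono[of "2 * j - 1" "2 * j"] that by (auto simp: m_def)
  have \<xi>lt: "x (2 * j) < \<xi> j" "\<xi> j < x (2 * j + 1)" if "j \<in> {1..<k}" for j
    using mono[of "2 * j" "2 * j + 1"] that by (auto simp: \<xi>_def)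
  have sep: "m i < \<xi> i \<and> \<xi> i < m j" if "i \<in> {1..k}" "j \<in> {1..k}" "i < j" for i j
  proof -
    have i: "i \<in> {1..<k}" using that by auto
    have "x (2 * i + 1) \<le> x (2 * j - 1)" using that by (intro monoe) auto
    then show ?thesis using mlt[OF that(1)] mlt[OF that(2)] \<xi>lt[OF i] by linarith
  qed
  have V0: "VF k x 0 (t, 0) = Re (F_poly k x (Complex t 0))" for t
    by (simp add: VF_def F_poly_eq)
  have Fm: "VF k x 0 (m j, 0) > 0" if j: "j \<in> {1..k}" for j
  proof -
    have "x i < m j" if "i \<in> {1..2 * j - 1}" for i
      using monoe[of i "2 * j - 1"] mlt[OF j] that j by force
    moreover have "m j < x i" if "i \<in> {2 * j - 1<..2 * k}" for i
      using monoe[of "2 * j" i] mlt[OF j] that j by force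
    moreover have "2 * j - 1 \<le> 2 * k" "odd (2 * j - 1)" using j by auto
    ultimately show ?thesis
      using F_poly_axis_sign[of "2 * j - 1" k x "m j"] unfolding V0 by simp
  qed
  have F\<xi>: "VF k x 0 (\<xi> j, 0) < 0" if j: "j \<in> {1..<k}" for j
  proof -
    have "x i < \<xi> j" if "i \<in> {1..2 * j}" for i
      using monoe[of i "2 * j"] \<xi>lt[OF j] that j by force
    moreover have "\<xi> j < x i" if "i \<in> {2 * j<..2 * k}" for i
      using monoe[of "2 * j + 1" i] \<xi>lt[OF j] that j by force
    moreover have "2 * j \<le> 2 * k" "even (2 * j)" using j by auto
    ultimately show ?thesis
      using F_poly_axis_sign[of "2 * j" k x "\<xi> j"] unfolding V0 by simp
  qed
  define c where "c j = 4 + 3 * (\<xi> j)\<^sup>2 + B * (1 + \<bar>\<xi> j\<bar>) ^ (N + 2)" for j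
  \<comment> \<open>Apart from positivity, every requirement on \<open>s\<close> bounds a multiple
    of \<open>s\<close> by a positive number, so finitely many of them hold together for small
    \<open>s\<close>. The clauses with 3 put \<open>x 1\<close> and the peaks inside the
    box.\<close>
  define good where "good s \<longleftrightarrow> 0 < s \<and> 1 * s \<le> 1 \<and> (1000 * Ac ^ 3) * s \<le> 1 \<and> ((2 * B) ^ (N + 2) * Ac) * s \<le> 1 \<and>
      (3 + \<bar>x 1\<bar>) * s \<le> 1 \<and> (\<forall>j\<in>{1..k}. (3 + \<bar>m j\<bar>) * s \<le> 1) \<and>
      (\<forall>j\<in>{1..<k}. (c j)\<^sup>2 * s \<le> - 2 * VF k x 0 (\<xi> j, 0))" for s :: real
  have ev_good: "\<forall>\<^sub>F s in at_right 0. good s"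
    unfolding good_def
    by (intro eventually_conj eventually_ball_finite ballI eventually_small)
      (auto simp: F\<xi> eventually_at_right_less)
  have regime: "\<exists>\<epsilon>1>0. \<forall>\<epsilon>\<in>{0<..<\<epsilon>1}. \<exists>\<tau>. F_strip k x N B \<epsilon> \<tau> s \<and> \<epsilon>\<^sup>2 \<le> \<epsilon> powr (3/2) * s \<and> 1 \<le> s * \<tau>"
    if g: "good s" for s
  proof -
    have s: "0 < s" "s \<le> 1" using g by (auto simp: good_def)
    obtain \<epsilon>1 where \<epsilon>1: "\<epsilon>1 > 0" "\<And>\<epsilon>. \<epsilon> \<in> {0<..<\<epsilon>1} \<Longrightarrow> \<exists>\<tau>. \<epsilon> powr (3/2) > 0 \<and> \<epsilon> powr (3/2) \<le> s * \<epsilon> \<and>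
        \<epsilon>\<^sup>2 \<le> \<epsilon> powr (3/2) * s \<and> \<epsilon> powr (3/2) * \<tau> ^ (N + 4) = 4 \<and> \<epsilon> * \<tau>\<^sup>2 \<le> s \<and> 1 \<le> s * \<tau> \<and> \<tau> \<ge> 2"
      using small_parameters[OF s, of N] unfolding Let_def by blast
    have "\<exists>\<tau>. F_strip k x N B \<epsilon> \<tau> s \<and> \<epsilon>\<^sup>2 \<le> \<epsilon> powr (3/2) * s \<and> 1 \<le> s * \<tau>" if \<epsilon>: "\<epsilon> \<in> {0<..<\<epsilon>1}" for \<epsilon>
    proof -
      obtain \<tau> where \<tau>: "\<epsilon> powr (3/2) \<le> s * \<epsilon>" "\<epsilon>\<^sup>2 \<le> \<epsilon> powr (3/2) * s" "\<epsilon> powr (3/2) * \<tau> ^ (N + 4) = 4"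
        "\<epsilon> * \<tau>\<^sup>2 \<le> s" "1 \<le> s * \<tau>" "\<tau> \<ge> 2" using \<epsilon>1(2)[OF \<epsilon>] by blast
      have "1000 * strip_const N B ^ 3 * s \<le> 1" "s * (2 * B) ^ (N + 2) * strip_const N B \<le> 1"
        using g by (simp_all add: good_def Ac_def mult.commute mult.left_commute)
      then have "F_strip k x N B \<epsilon> \<tau> s" using \<tau> s \<epsilon> by (intro B(2)) auto
      then show ?thesis using \<tau> by blast
    qed
    then show ?thesis using \<epsilon>1(1) by blast
  qed
  have large: "b < \<tau> - 1" if "(3 + b) * s \<le> 1" "1 \<le> s * \<tau>" "s > 0" for b s \<tau> :: real
  proof -
    have "s * (3 + b) \<le> s * \<tau>"
      using order_trans[OF that(1,2)] by (simp only: mult.commute)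
    then have "3 + b \<le> \<tau>" using that(3) by (rule mult_left_le_imp_le)
    then show ?thesis by simp
  qed
  have gx: "\<bar>x 1\<bar> < \<tau> - 1" if "good s" "1 \<le> s * \<tau>" for s \<tau>
    using large[of "\<bar>x 1\<bar>" s \<tau>] that by (simp add: good_def)
  have k1: "k \<ge> 1" using assms(1) by simp
  \<comment> \<open>One fixed \<open>s\<close> provides the threshold for \<epsilon> and serves
    every claim except the convergence to the strip, where \<open>s\<close> has to shrink with the
    tolerance.\<close>
  obtain s where s: "good s" using eventually_happens'[OF _ ev_good] by auto
  obtain \<epsilon>0 where \<epsilon>0: "\<epsilon>0 > 0" "\<And>\<epsilon>. \<epsilon> \<in> {0<..<\<epsilon>0} \<Longrightarrow> \<exists>\<tau>. F_strip k x N B \<epsilon> \<tau> s \<and> \<epsilon>\<^sup>2 \<le> \<epsilon> powr (3/2) * s \<and> 1 \<le> s * \<tau>"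
    using regime[OF s] by blast
  have P2: "P2 (Omega k x)"
    unfolding P2_def
  proof (intro allI impI ballI)
    fix Q :: "(real \<times> real) set" and \<delta> :: real
    assume Q: "compact Q" and \<delta>: "\<delta> \<in> {0<..<1}"
    obtain R where R: "R > 0" "\<And>p. p \<in> Q \<Longrightarrow> norm p \<le> R"
      using compact_imp_bounded[OF Q] bounded_pos by metis
    \<comment> \<open>A second \<open>s\<close>, adapted to \<open>Q\<close> and \<delta>; it only
      shortens the range of \<epsilon> for which the inclusions are claimed.\<close>
    have "\<forall>\<^sub>F s in at_right 0. good s \<and> (3 + R) * s \<le> 1 \<and> (1 + R) ^ (N + 2) * s \<le> 1 \<and> Ac * s \<le> \<delta> / 4"
      using \<delta> by (intro eventually_conj ev_good eventually_small) auto
    then obtain s where s: "good s" "(3 + R) * s \<le> 1" "(1 + R) ^ (N + 2) * s \<le> 1" "Ac * s \<le> \<delta> / 4"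
      using eventually_happens'[OF _] trivial_limit_at_right_real by blast
    obtain \<epsilon>1 where \<epsilon>1: "\<epsilon>1 > 0" "\<And>\<epsilon>. \<epsilon> \<in> {0<..<\<epsilon>1} \<Longrightarrow> \<exists>\<tau>. F_strip k x N B \<epsilon> \<tau> s \<and> \<epsilon>\<^sup>2 \<le> \<epsilon> powr (3/2) * s \<and> 1 \<le> s * \<tau>"
      using regime[OF s(1)] by blast
    have main: "{(a, b). \<bar>b\<bar> < 1 - \<delta>} \<inter> Q \<subseteq> Omega k x \<epsilon> \<inter> Q \<and> Omega k x \<epsilon> \<inter> Q \<subseteq> {(a, b). \<bar>b\<bar> < 1 + \<delta>} \<inter> Q"
      if \<epsilon>: "\<epsilon> \<in> {0<..<\<epsilon>1}" for \<epsilon>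
    proof -
      obtain \<tau> where \<tau>: "F_strip k x N B \<epsilon> \<tau> s" "1 \<le> s * \<tau>" using \<epsilon>1(2)[OF \<epsilon>] by blast
      note O = Omega_facts[OF \<tau>(1) gx[OF s(1) \<tau>(2)] k1]
      have R\<tau>: "R < \<tau> - 1" using large[OF s(2) \<tau>(2)] s(1) by (simp add: good_def)
      have fR: "\<bar>fst p\<bar> \<le> R" if "p \<in> Q" for p
        using R(2)[OF that] norm_fst_le[of "fst p" "snd p"] by simp
      have apx: "\<bar>u_eps k x \<epsilon> p - (1 / 2 - (snd p)\<^sup>2 / 2)\<bar> \<le> \<delta> / 4" if "p \<in> Q" "\<bar>snd p\<bar> \<le> 2" for p
      proof -
        have "\<bar>u_eps k x \<epsilon> p - (1 / 2 - (snd p)\<^sup>2 / 2)\<bar> \<le> strip_const N B * s"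
          using fR[OF that(1)] R\<tau> that s(3) by (intro O(8)[of p "1 + R"]) (auto simp: mult.commute)
        then show ?thesis using s(4) by (simp add: Ac_def)
      qed
      have "p \<in> Omega k x \<epsilon>" if p: "p \<in> Q" "\<bar>snd p\<bar> < 1 - \<delta>" for p
      proof -
        have "(snd p)\<^sup>2 \<le> (1 - \<delta>)\<^sup>2" using p(2) abs_le_square_iff[of "snd p" "1 - \<delta>"] by simp
        also have "\<dots> \<le> 1 - \<delta>" using \<delta> mult_right_mono[of "1 - \<delta>" 1 "1 - \<delta>"] by (simp add: power2_eq_square)
        finally have "(snd p)\<^sup>2 \<le> 1 - \<delta>" .
        moreover have "\<delta> > 0" "\<bar>snd p\<bar> \<le> 2" using p(2) \<delta> by auto
        ultimately have "u_eps k x \<epsilon> p > 0" using apx[OF p(1)] unfolding abs_le_iff by linarith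
        then show ?thesis using p(2) \<delta> fR[OF p(1)] R\<tau> unfolding O(7) by simp
      qed
      moreover have "\<bar>snd p\<bar> < 1 + \<delta>" if p: "p \<in> Q" "p \<in> Omega k x \<epsilon>" for p
      proof (rule ccontr)
        assume "\<not> \<bar>snd p\<bar> < 1 + \<delta>"
        then have "(1 + \<delta>)\<^sup>2 \<le> (snd p)\<^sup>2" using \<delta> abs_le_square_iff[of "1 + \<delta>" "snd p"] by simp
        then have "1 + \<delta>\<^sup>2 + 2 * \<delta> \<le> (snd p)\<^sup>2" by (simp add: power2_sum)
        then have "1 + 2 * \<delta> \<le> (snd p)\<^sup>2" using zero_le_power2[of \<delta>] by linarith
        moreover have "\<bar>snd p\<bar> \<le> 2" "u_eps k x \<epsilon> p > 0" using p(2) unfolding O(7) by auto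
        moreover have "\<delta> > 0" using \<delta> by simp
        ultimately show False using apx[OF p(1)] unfolding abs_le_iff by linarith
      qed
      ultimately show ?thesis by force
    qed
    show "\<forall>\<^sub>F \<epsilon> in at_right 0. {(a, b). \<bar>b\<bar> < 1 - \<delta>} \<inter> Q \<subseteq> Omega k x \<epsilon> \<inter> Q
        \<and> Omega k x \<epsilon> \<inter> Q \<subseteq> {(a, b). \<bar>b\<bar> < 1 + \<delta>} \<inter> Q"
      using \<epsilon>1(1) main unfolding eventually_at_right_field by (intro exI[of _ \<epsilon>1]) auto
  qed
  have P3: "P3 (Omega k x) \<epsilon>0"
  proof -
    have "\<forall>\<epsilon>\<in>{0<..<\<epsilon>0}. \<exists>q. q \<in> frontier (Omega k x \<epsilon>) \<and>
        (\<forall>p\<in>frontier (Omega k x \<epsilon>). Curv (Omega k x \<epsilon>) q \<le> Curv (Omega k x \<epsilon>) p) \<and> \<bar>Curv (Omega k x \<epsilon>) q\<bar> \<le> 32 * Ac * \<epsilon>"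
    proof
      fix \<epsilon> assume "\<epsilon> \<in> {0<..<\<epsilon>0}"
      then obtain \<tau> where \<tau>: "F_strip k x N B \<epsilon> \<tau> s" "1 \<le> s * \<tau>" using \<epsilon>0(2) by blast
      from Omega_facts(6)[OF \<tau>(1) gx[OF s \<tau>(2)] k1]
      show "\<exists>q. q \<in> frontier (Omega k x \<epsilon>) \<and> (\<forall>p\<in>frontier (Omega k x \<epsilon>). Curv (Omega k x \<epsilon>) q \<le> Curv (Omega k x \<epsilon>) p)
          \<and> \<bar>Curv (Omega k x \<epsilon>) q\<bar> \<le> 32 * Ac * \<epsilon>"
        unfolding Ac_def by blast
    qed
    then obtain q where q: "\<And>\<epsilon>. \<epsilon> \<in> {0<..<\<epsilon>0} \<Longrightarrow> q \<epsilon> \<in> frontier (Omega k x \<epsilon>) \<and>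
        (\<forall>p\<in>frontier (Omega k x \<epsilon>). Curv (Omega k x \<epsilon>) (q \<epsilon>) \<le> Curv (Omega k x \<epsilon>) p) \<and> \<bar>Curv (Omega k x \<epsilon>) (q \<epsilon>)\<bar> \<le> 32 * Ac * \<epsilon>"
      by metis
    define M where "M \<epsilon> = Curv (Omega k x \<epsilon>) (q \<epsilon>)" for \<epsilon>
    have "(M \<longlongrightarrow> 0) (at_right 0)"
    proof (rule Lim_null_comparison)
      show "\<forall>\<^sub>F \<epsilon> in at_right 0. norm (M \<epsilon>) \<le> 32 * Ac * \<epsilon>"
        using \<epsilon>0(1) q unfolding eventually_at_right_field M_def by (intro exI[of _ \<epsilon>0]) auto
      have "((\<lambda>\<epsilon>. 32 * Ac * \<epsilon>) \<longlongrightarrow> 32 * Ac * 0) (at_right 0)" by (intro tendsto_intros)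
      then show "((\<lambda>\<epsilon>. 32 * Ac * \<epsilon>) \<longlongrightarrow> 0) (at_right 0)" by simp
    qed
    moreover have "\<forall>\<epsilon>\<in>{0<..<\<epsilon>0}. M \<epsilon> \<in> Curv (Omega k x \<epsilon>) ` frontier (Omega k x \<epsilon>) \<and>
        (\<forall>p\<in>frontier (Omega k x \<epsilon>). M \<epsilon> \<le> Curv (Omega k x \<epsilon>) p)"
      using q by (auto simp: M_def)
    moreover have "\<forall>\<epsilon>\<in>{0<..<\<epsilon>0}. (\<exists>p\<in>frontier (Omega k x \<epsilon>). Curv (Omega k x \<epsilon>) p < 0) \<and>
        (\<exists>p\<in>frontier (Omega k x \<epsilon>). Curv (Omega k x \<epsilon>) p > 0) \<and>
        card {p \<in> frontier (Omega k x \<epsilon>). Curv (Omega k x \<epsilon>) p = 0} = 2"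
    proof
      fix \<epsilon> assume "\<epsilon> \<in> {0<..<\<epsilon>0}"
      then obtain \<tau> where \<tau>: "F_strip k x N B \<epsilon> \<tau> s" "1 \<le> s * \<tau>" using \<epsilon>0(2) by blast
      note O = Omega_facts[OF \<tau>(1) gx[OF s \<tau>(2)] k1]
      show "(\<exists>p\<in>frontier (Omega k x \<epsilon>). Curv (Omega k x \<epsilon>) p < 0) \<and>
        (\<exists>p\<in>frontier (Omega k x \<epsilon>). Curv (Omega k x \<epsilon>) p > 0) \<and>
        card {p \<in> frontier (Omega k x \<epsilon>). Curv (Omega k x \<epsilon>) p = 0} = 2"
        using O(3,4,5) by blast
    qed
    ultimately show ?thesis unfolding P3_def by blast
  qed
  have sm: "\<forall>\<epsilon>\<in>{0<..<\<epsilon>0}. smooth_bounded_domain (Omega k x \<epsilon>)"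
  proof
    fix \<epsilon> assume "\<epsilon> \<in> {0<..<\<epsilon>0}"
    then obtain \<tau> where \<tau>: "F_strip k x N B \<epsilon> \<tau> s" "1 \<le> s * \<tau>" using \<epsilon>0(2) by blast
    show "smooth_bounded_domain (Omega k x \<epsilon>)" by (rule Omega_facts(1)[OF \<tau>(1) gx[OF s \<tau>(2)] k1])
  qed
  have sol: "\<exists>lam_bar>0. \<forall>lam\<in>{0<..<lam_bar}. \<forall>u.
         classical_solution (Omega k x \<epsilon>) lam f u \<and> (\<forall>p\<in>Omega k x \<epsilon>. \<bar>u p\<bar> \<le> C) \<longrightarrow>
         semi_stable (Omega k x \<epsilon>) lam f' u \<and> P1 k (Omega k x \<epsilon>) u"
    if f: "\<forall>t\<ge>0. (f has_real_derivative f' t) (at t within {0..})" "continuous_on {0..} f'" "f 0 > 0" "C > 0"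
      and \<epsilon>: "\<epsilon> \<in> {0<..<\<epsilon>0}" for f f' C \<epsilon>
  proof -
    obtain \<tau> where \<tau>: "F_strip k x N B \<epsilon> \<tau> s" "\<epsilon>\<^sup>2 \<le> \<epsilon> powr (3/2) * s" "1 \<le> s * \<tau>" using \<epsilon>0(2)[OF \<epsilon>] by blast
    note O = Omega_facts[OF \<tau>(1) gx[OF s \<tau>(3)] k1]
    interpret torsion_domain "Omega k x \<epsilon>" "u_eps k x \<epsilon>" by (rule O(2))
    have e: "\<epsilon> powr (3/2) > 0" using \<epsilon> by simp
    \<comment> \<open>The smallest excess over 1/2 among the peaks. It shrinks with \<epsilon>, and
      the bound on \<open>lam\<close> shrinks with it.\<close>
    define \<eta> where "\<eta> = \<epsilon> powr (3/2) * Min ((\<lambda>j. VF k x 0 (m j, 0)) ` {1..k})"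
    have "Min ((\<lambda>j. VF k x 0 (m j, 0)) ` {1..k}) > 0" using k1 Fm by (subst Min_gr_iff) auto
    then have \<eta>: "\<eta> > 0" using e by (simp add: \<eta>_def)
    have um: "u_eps k x \<epsilon> (t, 0) = 1 / 2 + \<epsilon> powr (3/2) * VF k x 0 (t, 0)" for t
      by (simp add: u_eps_def V0)
    show ?thesis
    proof (rule small_solutions[where f = f and f' = f' and \<eta> = \<eta> and m = m and \<xi> = \<xi>, OF _ f(2-4) k1 \<eta>])
      show "(f has_real_derivative f' t) (at t within {0..})" if "0 \<le> t" for t using f(1) that by blast
      show "(m j, 0) \<in> Omega k x \<epsilon> \<and> 1 / 2 + \<eta> \<le> u_eps k x \<epsilon> (m j, 0)" if j: "j \<in> {1..k}" for j
      proof
        have "Min ((\<lambda>j. VF k x 0 (m j, 0)) ` {1..k}) \<le> VF k x 0 (m j, 0)" using j by (intro Min_le) auto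
        then show u: "1 / 2 + \<eta> \<le> u_eps k x \<epsilon> (m j, 0)" unfolding um \<eta>_def using e by simp
        have "\<bar>m j\<bar> < \<tau> - 1" using large[of "\<bar>m j\<bar>" s \<tau>] s j \<tau>(3) by (auto simp: good_def)
        then show "(m j, 0) \<in> Omega k x \<epsilon>" unfolding O(7) using u \<eta> by simp
      qed
      show "u_eps k x \<epsilon> p \<le> 1 / 2" if "j \<in> {1..<k}" "p \<in> Omega k x \<epsilon>" "fst p = \<xi> j" for j p
      proof -
        have "u_eps k x \<epsilon> (\<xi> j, snd p) \<le> 1 / 2"
          using s that \<tau>(2) unfolding O(7) by (intro O(9)[OF c_def[of j]]) (auto simp: good_def)
        then show ?thesis using that(3) by (metis prod.collapse)
      qed
    qed (use sep in auto)
  qed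
  show ?thesis
    using \<epsilon>0(1) sm P2 P3 sol by (intro exI[of _ \<epsilon>0]) blast
qed

end
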